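(* Let $m\in\mathbb{N}$, $m\ge1$, and $k,d,L>0$. Let $P$ be a known probe function on $\mathbb{R}^m$ of plane wave shape or of Gaussian shape, and let $U\subset\mathbb{R}^m$ be a nonempty open set. Then any object transmission function $O\in 1+\mathscr{S}_c'(\mathbb{R}^m)$ arising from a compactly supported sample is uniquely determined by the intensity data $(I_d)|_U$, where $$I_d=\left|\mathcal{D}_d^{\mathrm F}(P\cdot O)\right|^2,$$ measured at the single distance $d$. Moreover, $O$ is uniquely determined by the linearized intensities $(I_{d,\mathrm{lin}})|_U$, where $$I_{d,\mathrm{lin}}:=I_d-\left|\mathcal{D}_d^{\mathrm F}(P\cdot(O-1))\right|^2.$$ That is: if $O,\tilde O\in1+\mathscr{S}_c'(\mathbb{R}^m)$ are two object transmission functions arising from compactly supported samples (with the same $P,k,d$) whose intensities $I_d$ coincide on $U$, or whose linearized intensities $I_{d,\mathrm{lin}}$ coincide on $U$, then $O=\tilde O$.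
   Context: $\mathscr{S}_c'(\mathbb{R}^m)$ denotes the compactly supported distributions in the space $\mathscr{S}'(\mathbb{R}^m)$ of tempered distributions, and $1+\mathscr{S}_c'(\mathbb{R}^m)=\{1+u:u\in\mathscr{S}_c'(\mathbb{R}^m)\}$. For $x\in\mathbb{R}^m$, $x^2:=x\cdot x$. Object transmission functions: the sample is described by a pair of real-valued, compactly supported $\delta,\beta$ on $\mathbb{R}^{m}\times\mathbb{R}$ (refractive index $n=1-\delta+i\beta$), with support in $\mathbb{R}^m\times[-L,0]$. $O$ arises from this sample if $$O(x)=\exp\left(-ik\int_{-L}^0(\delta(x,z)-i\beta(x,z))\,dz\right),$$ where it is understood that the formula makes sense and defines an element of $1+\mathscr{S}_c'(\mathbb{R}^m)$. The wave field behind the object is $\Psi_0=P\cdot O$. Fresnel propagator: $$\mathcal{D}_d^{\mathrm F}(\Psi)(x)=e^{i(kd-m\pi/4)}\left(\frac{k}{2\pi d}\right)^{m/2}\exp\left(\frac{ikx^2}{2d}\right)\int_{\mathbb{R}^m}\Psi(x')\exp\left(\frac{ikx'^2}{2d}\right)\exp\left(-\frac{ikx\cdot x'}{d}\right)dx',$$ extended to $\Psi\in\mathscr{S}'(\mathbb{R}^m)$ by interpreting the integral as a (rescaled) distributional Fourier transform: $\mathcal{D}_d^{\mathrm F}(\Psi)(x)=e^{i(kd-m\pi/4)}(k/d)^{m/2}\exp(ikx^2/(2d))\,\mathcal{F}\big(\exp(ik(\cdot)^2/(2d))\Psi\big)(kx/d)$ with $\mathcal{F}f(\eta)=(2\pi)^{-m/2}\int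 f(x)e^{-i\eta\cdot x}dx$. Probe functions: $P$ is of plane wave shape if $P\equiv p_0$ for a constant $p_0\in\mathbb{C}\setminus\{0\}$. $P$ is of Gaussian shape if $$\mathcal{D}_d^{\mathrm F}(P)(x)=p_0e^{ikd}\exp\left(\alpha_0\frac{k}{d}x^2\right)$$ for some $p_0\in\mathbb{C}\setminus\{0\}$ and $\alpha_0\in\mathbb{C}$ with $\Re(\alpha_0)<0$ and $\Im(\alpha_0)\le0$ (Gaussian beam that is not convergent at the detector). In both cases $P$ is a smooth, bounded, everywhere nonzero function. *)

theory Defs
  imports "HOL-Analysis.Analysis"
begin

section \<open>Schwartz functions\<close>

definition partial_deriv :: "'m::finite \<Rightarrow> (real^'m \<Rightarrow> complex) \<Rightarrow> real^'m \<Rightarrow> complex" where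
  "partial_deriv j f x = frechet_derivative f (at x) (axis j 1)"

text \<open>A multi-index is given as the list of coordinates to differentiate in.\<close>

definition iter_deriv :: "'m::finite list \<Rightarrow> (real^'m \<Rightarrow> complex) \<Rightarrow> real^'m \<Rightarrow> complex" where
  "iter_deriv js f = foldr partial_deriv js f"

definition smooth_fun :: "(real^'m::finite \<Rightarrow> complex) \<Rightarrow> bool" where
  "smooth_fun f \<longleftrightarrow> (\<forall>js x. iter_deriv js f differentiable (at x))"

definition schwartz :: "(real^'m::finite \<Rightarrow> complex) set" where
  "schwartz = {\<phi>. smooth_fun \<phi> \<and>
     (\<forall>js N. \<exists>C. \<forall>x. (1 + norm x) ^ N * norm (iter_deriv js \<phi> x) \<le> C)}"

definition schwartz_norm :: "nat \<Rightarrow> (real^'m::finite \<Rightarrow> complex) \<Rightarrow> real" where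
  "schwartz_norm N \<phi> =
     (SUP (js, x) \<in> {js. length js \<le> N} \<times> UNIV. (1 + norm x) ^ N * norm (iter_deriv js \<phi> x))"

definition test_functions :: "(real^'m::finite) set \<Rightarrow> (real^'m \<Rightarrow> complex) set" where
  "test_functions V = {\<phi>. smooth_fun \<phi> \<and>
     compact (closure {x. \<phi> x \<noteq> 0}) \<and> closure {x. \<phi> x \<noteq> 0} \<subseteq> V}"

section \<open>Tempered distributions\<close>

text \<open>
  Distributions are functionals that are extensional outside \<^const>\<open>schwartz\<close>, so that
  HOL equality is equality of distributions. The pairing of a distribution with a test
  function is bilinear (no complex conjugation).
\<close>

type_synonym 'm functional = "(real^'m \<Rightarrow> complex) \<Rightarrow> complex"

definition tempered :: "'m::finite functional set" where
  "tempered = {T. T \<in> extensional schwartz \<and>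
     (\<forall>\<phi>\<in>schwartz. \<forall>\<psi>\<in>schwartz. T (\<lambda>x. \<phi> x + \<psi> x) = T \<phi> + T \<psi>) \<and>
     (\<forall>c. \<forall>\<phi>\<in>schwartz. T (\<lambda>x. c * \<phi> x) = c * T \<phi>) \<and>
     (\<exists>C N. \<forall>\<phi>\<in>schwartz. norm (T \<phi>) \<le> C * schwartz_norm N \<phi>)}"

definition dist_support :: "'m::finite functional \<Rightarrow> (real^'m) set" where
  "dist_support T = - \<Union>{V. open V \<and> (\<forall>\<phi>\<in>test_functions V. T \<phi> = 0)}"

definition compact_tempered :: "'m::finite functional set" where
  "compact_tempered = {T \<in> tempered. compact (dist_support T)}"

definition dist_of_fun :: "(real^'m::finite \<Rightarrow> complex) \<Rightarrow> 'm functional" where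
  "dist_of_fun f = (\<lambda>\<phi>\<in>schwartz. LINT x|lebesgue. f x * \<phi> x)"

definition dist_add :: "'m::finite functional \<Rightarrow> 'm functional \<Rightarrow> 'm functional" where
  "dist_add S T = (\<lambda>\<phi>\<in>schwartz. S \<phi> + T \<phi>)"

definition dist_diff :: "'m::finite functional \<Rightarrow> 'm functional \<Rightarrow> 'm functional" where
  "dist_diff S T = (\<lambda>\<phi>\<in>schwartz. S \<phi> - T \<phi>)"

definition dist_mult :: "(real^'m::finite \<Rightarrow> complex) \<Rightarrow> 'm functional \<Rightarrow> 'm functional" where
  "dist_mult g T = (\<lambda>\<phi>\<in>schwartz. T (\<lambda>x. g x * \<phi> x))"

definition fourier :: "(real^'m::finite \<Rightarrow> complex) \<Rightarrow> real^'m \<Rightarrow> complex" where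
  "fourier f \<eta> = of_real ((2 * pi) powr (- real CARD('m) / 2)) *
     (LINT x|lebesgue. f x * exp (- \<i> * of_real (\<eta> \<bullet> x)))"

definition dist_fourier :: "'m::finite functional \<Rightarrow> 'm functional" where
  "dist_fourier T = (\<lambda>\<phi>\<in>schwartz. T (fourier \<phi>))"

text \<open>The rescaled distribution \<open>x \<mapsto> T (c x)\<close> for \<open>c > 0\<close>.\<close>

definition dist_scale :: "real \<Rightarrow> 'm::finite functional \<Rightarrow> 'm functional" where
  "dist_scale c T =
     (\<lambda>\<phi>\<in>schwartz. of_real (c powr (- real CARD('m))) * T (\<lambda>y. \<phi> ((1 / c) *\<^sub>R y)))"

text \<open>
  The continuous function by which a distribution is given, where there is one. Requiring
  integrability against all Schwartz functions excludes functions that grow so fast that the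
  integral in \<^const>\<open>dist_of_fun\<close> would only be a default value.
\<close>

definition dist_density :: "'m::finite functional \<Rightarrow> real^'m \<Rightarrow> complex" where
  "dist_density T = (THE f. continuous_on UNIV f \<and>
     (\<forall>\<phi>\<in>schwartz. integrable lebesgue (\<lambda>x. f x * \<phi> x)) \<and> T = dist_of_fun f)"

section \<open>Fresnel propagation and intensities\<close>

definition chirp :: "real \<Rightarrow> real \<Rightarrow> real^'m::finite \<Rightarrow> complex" where
  "chirp k d x = exp (\<i> * of_real (k * (x \<bullet> x) / (2 * d)))"

definition fresnel :: "real \<Rightarrow> real \<Rightarrow> 'm::finite functional \<Rightarrow> 'm functional" where
  "fresnel k d T = dist_mult
     (\<lambda>x. exp (\<i> * of_real (k * d - real CARD('m) * pi / 4)) *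
          of_real ((k / d) powr (real CARD('m) / 2)) * chirp k d x)
     (dist_scale (k / d) (dist_fourier (dist_mult (chirp k d) T)))"

definition intensity ::
  "real \<Rightarrow> real \<Rightarrow> (real^'m::finite \<Rightarrow> complex) \<Rightarrow> 'm functional \<Rightarrow> real^'m \<Rightarrow> real" where
  "intensity k d P Ob x = (norm (dist_density (fresnel k d (dist_mult P Ob)) x))\<^sup>2"

definition lin_intensity ::
  "real \<Rightarrow> real \<Rightarrow> (real^'m::finite \<Rightarrow> complex) \<Rightarrow> 'm functional \<Rightarrow> real^'m \<Rightarrow> real" where
  "lin_intensity k d P Ob x = intensity k d P Ob x -
     (norm (dist_density (fresnel k d (dist_mult P (dist_diff Ob (dist_of_fun (\<lambda>_. 1))))) x))\<^sup>2"

section \<open>Probe functions\<close>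

definition plane_wave :: "(real^'m::finite \<Rightarrow> complex) \<Rightarrow> bool" where
  "plane_wave P \<longleftrightarrow> (\<exists>p0. p0 \<noteq> 0 \<and> P = (\<lambda>_. p0))"

text \<open>
  The identity for the propagated probe is one between tempered distributions and determines
  the function \<open>P\<close> only almost everywhere; continuity selects its smooth representative.
\<close>

definition gaussian_probe :: "real \<Rightarrow> real \<Rightarrow> (real^'m::finite \<Rightarrow> complex) \<Rightarrow> bool" where
  "gaussian_probe k d P \<longleftrightarrow> continuous_on UNIV P \<and> bounded (range P) \<and>
     (\<exists>p0 \<alpha>0. p0 \<noteq> 0 \<and> Re \<alpha>0 < 0 \<and> Im \<alpha>0 \<le> 0 \<and>
        fresnel k d (dist_of_fun P) =
          dist_of_fun (\<lambda>x. p0 * exp (\<i> * of_real (k * d)) * exp (\<alpha>0 * of_real (k / d * (x \<bullet> x)))))"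

section \<open>Object transmission functions\<close>

definition one_plus_compact :: "'m::finite functional set" where
  "one_plus_compact = {dist_add (dist_of_fun (\<lambda>_. 1)) u | u. u \<in> compact_tempered}"

definition sample_component :: "real \<Rightarrow> ((real^'m::finite) \<times> real \<Rightarrow> real) \<Rightarrow> bool" where
  "sample_component L f \<longleftrightarrow> compact (closure {p. f p \<noteq> 0}) \<and>
     closure {p. f p \<noteq> 0} \<subseteq> UNIV \<times> {-L..0} \<and>
     (AE x in lebesgue. (\<lambda>z. f (x, z)) absolutely_integrable_on {-L..0})"

definition transmission ::
  "real \<Rightarrow> real \<Rightarrow> ((real^'m::finite) \<times> real \<Rightarrow> real) \<Rightarrow> ((real^'m) \<times> real \<Rightarrow> real) \<Rightarrow>
   real^'m \<Rightarrow> complex" where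
  "transmission k L \<delta> \<beta> x = exp (- \<i> * of_real k *
     (LINT z:{-L..0}|lebesgue. of_real (\<delta> (x, z)) - \<i> * of_real (\<beta> (x, z))))"

text \<open>
  The formula makes sense: the line integrals converge almost everywhere and their exponential
  is locally integrable, hence a distribution.
\<close>

definition object_transmission :: "real \<Rightarrow> real \<Rightarrow> 'm::finite functional set" where
  "object_transmission k L = {Ob \<in> one_plus_compact. \<exists>\<delta> \<beta>.
     sample_component L \<delta> \<and> sample_component L \<beta> \<and>
     (\<forall>K. compact K \<longrightarrow> transmission k L \<delta> \<beta> absolutely_integrable_on K) \<and>
     Ob = dist_of_fun (transmission k L \<delta> \<beta>)}"

end

theory Submission
  imports
    Defs
    "HOL-Probability.Probability"
    "HOL-Complex_Analysis.Complex_Analysis"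
    "HOL-Real_Asymp.Real_Asymp"
begin

text \<open>
  An object transmission function is \<open>1 + h\<close> with \<open>h\<close> integrable and compactly supported, and the
  probe is a nonvanishing Gaussian (or constant) \<open>P\<close>. Up to a constant, the field at the detector is
  \<open>p + w\<close> with \<open>p (x) = exp (\<alpha> k x\<^sup>2 / d)\<close> and \<open>w = chirp \<cdot> F (k x / d)\<close>, where \<open>F\<close> is the Fourier
  transform of \<open>chirp \<cdot> P \<cdot> h\<close>, an entire function of exponential type. Equality of the data on \<open>U\<close>
  for two objects reads, on every line through a point of \<open>U\<close> with complex parameter \<open>t\<close>,
  \<open>exp (a t\<^sup>2) A (t) + exp (cnj a t\<^sup>2) A\<^sup>* (t) + E (t) = 0\<close>,
  where \<open>A\<close> (which contains the difference of the two transforms \<open>F\<close>), \<open>A\<^sup>*\<close> and \<open>E\<close> are of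
  exponential type. The sign conditions on the probe give \<open>Im a > 0\<close>. Along the ray through \<open>1 - \<i>\<close>
  the first exponential dominates, so \<open>A\<close> decays like a Gaussian there, and Phragmen-Lindelof forces
  \<open>A = 0\<close>. Hence the two transforms agree everywhere, and so do the objects.
\<close>

section \<open>Entire functions of exponential type\<close>

text \<open>Intensity data contain only the real part of the interference between probe and
  scattered field, so the unknown always comes together with its twin \<open>A\<^sup>*\<close>, and
  at real points the two cannot be told apart. They separate at complex \<open>t\<close> because
  their quadratic phases are conjugate: for \<open>t = r * (1 - \<i>)\<close> the square is
  \<open>- 2 * \<i> * r\<^sup>2\<close>, and the two exponentials have norms exp (2 b r^2) and exp
  (- 2 b r^2) with b = Im a. The self-interference of the scattered field has no quadratic phase,
  since the chirp is unimodular; it is of exponential type and does no harm, whether it is present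
  (intensities) or subtracted (linearized data). Compact support enters twice: it gives the
  exponential type, and it allows the probe, which may decay, to be divided out at the end. A
  further obstacle is that a propagated plane wave is not an absolutely convergent integral; it is
  reached as a limit of integrable Gaussians.\<close>

definition exp_type :: "(complex \<Rightarrow> complex) \<Rightarrow> bool" where
  "exp_type f \<longleftrightarrow> f holomorphic_on UNIV \<and> (\<exists>C B. \<forall>z. norm (f z) \<le> C * exp (B * norm z))"

section \<open>Growth bounds and closure properties\<close>

lemma exp_type_bound:
  assumes "exp_type f"
  obtains C B where "C > 0" "B \<ge> 0" "\<And>z. norm (f z) \<le> C * exp (B * norm z)"
proof -
  obtain C B where CB: "\<And>z. norm (f z) \<le> C * exp (B * norm z)"
    using assms by (auto simp: exp_type_def)
  have "C \<ge> 0" using order_trans[OF norm_ge_zero CB[of 0]] by simp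
  have "norm (f z) \<le> (C + 1) * exp (\<bar>B\<bar> * norm z)" for z
    by (rule order_trans[OF CB], rule mult_mono) (use \<open>C \<ge> 0\<close> in \<open>auto intro!: mult_right_mono\<close>)
  then show thesis using that[of "C + 1" "\<bar>B\<bar>"] \<open>C \<ge> 0\<close> by auto
qed

lemma exp_typeI:
  assumes "f holomorphic_on UNIV" "\<And>z. norm (f z) \<le> C * exp (B * norm z)"
  shows "exp_type f"
  using assms by (auto simp: exp_type_def)

lemma exp_type_add:
  assumes "exp_type f" "exp_type g"
  shows "exp_type (\<lambda>z. f z + g z)"
proof -
  obtain C B where 1: "C > 0" "B \<ge> 0" "\<And>z. norm (f z) \<le> C * exp (B * norm z)"
    using exp_type_bound[OF assms(1)] by blast
  obtain C' B' where 2: "C' > 0" "B' \<ge> 0" "\<And>z. norm (g z) \<le> C' * exp (B' * norm z)"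
    using exp_type_bound[OF assms(2)] by blast
  show ?thesis
  proof (rule exp_typeI)
    show "(\<lambda>z. f z + g z) holomorphic_on UNIV"
      using assms by (auto simp: exp_type_def intro!: holomorphic_intros)
    fix z
    have "norm (f z + g z) \<le> C * exp (B * norm z) + C' * exp (B' * norm z)"
      using 1(3)[of z] 2(3)[of z] norm_triangle_ineq[of "f z" "g z"] by linarith
    also have "\<dots> \<le> C * exp ((B + B') * norm z) + C' * exp ((B + B') * norm z)"
      using 1 2 by (intro add_mono mult_left_mono) (auto intro!: mult_right_mono)
    finally show "norm (f z + g z) \<le> (C + C') * exp ((B + B') * norm z)"
      by (simp add: algebra_simps)
  qed
qed

lemma exp_type_mult:
  assumes "exp_type f" "exp_type g"
  shows "exp_type (\<lambda>z. f z * g z)"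
proof -
  obtain C B where 1: "C > 0" "B \<ge> 0" "\<And>z. norm (f z) \<le> C * exp (B * norm z)"
    using exp_type_bound[OF assms(1)] by blast
  obtain C' B' where 2: "C' > 0" "B' \<ge> 0" "\<And>z. norm (g z) \<le> C' * exp (B' * norm z)"
    using exp_type_bound[OF assms(2)] by blast
  show ?thesis
  proof (rule exp_typeI)
    show "(\<lambda>z. f z * g z) holomorphic_on UNIV"
      using assms by (auto simp: exp_type_def intro!: holomorphic_intros)
    fix z
    have "norm (f z * g z) \<le> (C * exp (B * norm z)) * (C' * exp (B' * norm z))"
      unfolding norm_mult using 1 2 by (intro mult_mono) auto
    then show "norm (f z * g z) \<le> (C * C') * exp ((B + B') * norm z)"
      by (simp add: algebra_simps exp_add)
  qed
qed

lemma exp_type_const: "exp_type (\<lambda>_. c)"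
  by (rule exp_typeI[where C = "norm c" and B = 0]) auto

lemma exp_type_exp: "exp_type (\<lambda>z. exp (a * z + b))"
proof (rule exp_typeI)
  fix z
  show "norm (exp (a * z + b)) \<le> exp (norm b) * exp (norm a * norm z)"
    using abs_Re_le_cmod[of "a * z + b"] norm_triangle_ineq[of "a * z" b]
    by (simp add: norm_mult flip: exp_add)
qed (auto intro!: holomorphic_intros)

lemma exp_type_scale:
  assumes "exp_type f"
  shows "exp_type (\<lambda>z. f (c * z))"
proof -
  obtain C B where CB: "\<And>z. norm (f z) \<le> C * exp (B * norm z)"
    using assms by (auto simp: exp_type_def)
  have "f holomorphic_on UNIV" using assms by (auto simp: exp_type_def)
  then have "(f \<circ> (*) c) holomorphic_on UNIV"
    by (intro holomorphic_on_compose_gen[of _ _ f UNIV] holomorphic_intros) auto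
  then show ?thesis
    using CB by (intro exp_typeI[where C = C and B = "B * norm c"])
      (auto simp: norm_mult o_def algebra_simps, metis norm_mult)
qed

lemma exp_type_cnj:
  assumes "exp_type f"
  shows "exp_type (\<lambda>z. cnj (f (cnj z)))"
proof -
  obtain C B where CB: "\<And>z. norm (f z) \<le> C * exp (B * norm z)"
    using assms by (auto simp: exp_type_def)
  have "f holomorphic_on cnj ` UNIV" 
    using assms by (auto simp: exp_type_def intro: holomorphic_on_subset)
  then have "(cnj \<circ> f \<circ> cnj) holomorphic_on UNIV"
    by (rule holomorphic_on_compose_cnj_cnj) auto
  then show ?thesis
    using CB[of "cnj _"] by (intro exp_typeI[where C = C and B = B]) (auto simp: o_def)
qed

text \<open>The sector has half-angle arctan (1/2), below pi/4, so \<open>z\<^sup>2\<close> stays in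
  the right half-plane and the entire factor \<open>exp (- e * z\<^sup>2)\<close> beats any
  exponential type. The maximum principle applies on a truncated sector, and the bound obtained does
  not depend on \<open>e\<close>, which finally tends to 0.\<close>

lemma phragmen_lindelof_sector:
  assumes f: "exp_type f" and "M > 0"
    and upper: "\<And>r. r \<ge> 0 \<Longrightarrow> norm (f (of_real r * (2 + \<i>))) \<le> M"
    and lower: "\<And>r. r \<ge> 0 \<Longrightarrow> norm (f (of_real r * (2 - \<i>))) \<le> M"
    and z: "2 * \<bar>Im z\<bar> \<le> Re z"
  shows "norm (f z) \<le> M"
proof -
  obtain C B where CB: "C > 0" "B \<ge> 0" "\<And>z. norm (f z) \<le> C * exp (B * norm z)"
    using exp_type_bound[OF f] by blast
  have Re_sq: "Re (w\<^sup>2) \<ge> 3/4 * (Re w)\<^sup>2" if "2 * \<bar>Im w\<bar> \<le> Re w" for w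
  proof -
    have "(2 * \<bar>Im w\<bar>)\<^sup>2 \<le> (Re w)\<^sup>2" using that by (intro power_mono) auto
    then show ?thesis by (simp add: power2_eq_square)
  qed
  have damped: "norm (f z * exp (- of_real e * z\<^sup>2)) \<le> M" if "e > 0" for e
  proof -
    define g where "g = (\<lambda>z. f z * exp (- of_real e * z\<^sup>2))"
    \<comment> \<open>On the truncating side \<open>norm w \<le> 2 * Re w\<close> and
      \<open>Re (w\<^sup>2) \<ge> 3/4 * (Re w)\<^sup>2\<close>, so this expression bounds the damped
      function there; \<open>R\<close> brings it below \<open>M\<close>.\<close>
    have "((\<lambda>x. C * exp (2 * B * x - 3/4 * e * x\<^sup>2)) \<longlongrightarrow> 0) at_top"
      using \<open>e > 0\<close> by real_asymp
    then have "eventually (\<lambda>x. C * exp (2 * B * x - 3/4 * e * x\<^sup>2) < M) at_top"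
      using \<open>M > 0\<close> by (rule order_tendstoD)
    then have "eventually (\<lambda>x. C * exp (2 * B * x - 3/4 * e * x\<^sup>2) < M \<and> x \<ge> Re z) at_top"
      using eventually_ge_at_top by (rule eventually_conj)
    then obtain R where R: "C * exp (2 * B * R - 3/4 * e * R\<^sup>2) < M" "R \<ge> Re z"
      using eventually_happens'[OF trivial_limit_at_top_linorder] by blast
    define S where "S = {w. 2 * \<bar>Im w\<bar> \<le> Re w \<and> Re w \<le> R}"
    have "closed S" unfolding S_def by (intro closed_Collect_conj closed_Collect_le continuous_intros)
    have norm_le: "norm w \<le> 2 * Re w" if "w \<in> S" for w
      using that cmod_le[of w] by (auto simp: S_def)
    have "bounded S"
    proof (rule boundedI)
      fix w assume "w \<in> S"
      then show "norm w \<le> 2 * R" using norm_le[of w] by (simp add: S_def)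
    qed
    have hol: "g holomorphic_on UNIV"
      unfolding g_def using f by (auto simp: exp_type_def intro!: holomorphic_intros)
    have frontier: "norm (g w) \<le> M" if w: "w \<in> frontier S" for w
    proof -
      have wS: "w \<in> S" using w \<open>closed S\<close> frontier_subset_closed by blast
      then have nn: "Re w \<ge> 0" "2 * \<bar>Im w\<bar> \<le> Re w" by (auto simp: S_def)
      have ex: "norm (exp (- of_real e * w\<^sup>2)) \<le> exp (- (3/4 * e * (Re w)\<^sup>2))"
        using mult_left_mono[OF Re_sq[OF nn(2)], of e] \<open>e > 0\<close> by (simp add: mult_ac)
      have boundary: "\<not> (2 * \<bar>Im w\<bar> < Re w \<and> Re w < R)"
      proof
        assume a: "2 * \<bar>Im w\<bar> < Re w \<and> Re w < R"
        have "open {w. 2 * \<bar>Im w\<bar> < Re w \<and> Re w < R}"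
          by (intro open_Collect_conj open_Collect_less continuous_intros)
        moreover have "{w. 2 * \<bar>Im w\<bar> < Re w \<and> Re w < R} \<subseteq> S" by (auto simp: S_def)
        ultimately have "w \<in> interior S" using a interior_maximal by blast
        then show False using w by (simp add: frontier_def)
      qed
      consider "Re w = R" | "2 * Im w = Re w" | "2 * Im w = - Re w"
      proof -
        have "Re w = R \<or> 2 * \<bar>Im w\<bar> = Re w"
          using wS boundary unfolding S_def mem_Collect_eq by linarith
        then show thesis using that by (cases "Im w \<ge> 0") auto
      qed
      then show ?thesis
      proof cases
        case 1
        have "norm (g w) \<le> (C * exp (B * (2 * Re w))) * exp (- (3/4 * e * (Re w)\<^sup>2))"
          unfolding g_def norm_mult using CB(1,2) norm_le[OF wS]
          by (intro mult_mono ex order_trans[OF CB(3)]) (auto intro: mult_left_mono)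
        also have "\<dots> = C * exp (2 * B * R - 3/4 * e * R\<^sup>2)"
          using 1 by (simp add: mult.assoc flip: exp_add)
        finally show ?thesis using R by simp
      next
        case 2
        have "w = of_real (Re w / 2) * (2 + \<i>)" using 2 by (simp add: complex_eq_iff)
        moreover have "norm (f (of_real (Re w / 2) * (2 + \<i>))) \<le> M"
          by (rule upper) (use nn in simp)
        ultimately have "norm (f w) \<le> M" by metis
        moreover have "norm (exp (- of_real e * w\<^sup>2)) \<le> 1"
          by (rule order_trans[OF ex]) (use \<open>e > 0\<close> in auto)
        ultimately have "norm (f w) * norm (exp (- of_real e * w\<^sup>2)) \<le> M * 1"
          using \<open>M > 0\<close> by (intro mult_mono) auto
        then show ?thesis by (simp add: g_def norm_mult)
      next
        case 3
        have "w = of_real (Re w / 2) * (2 - \<i>)" using 3 by (simp add: complex_eq_iff)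
        moreover have "norm (f (of_real (Re w / 2) * (2 - \<i>))) \<le> M"
          by (rule lower) (use nn in simp)
        ultimately have "norm (f w) \<le> M" by metis
        moreover have "norm (exp (- of_real e * w\<^sup>2)) \<le> 1"
          by (rule order_trans[OF ex]) (use \<open>e > 0\<close> in auto)
        ultimately have "norm (f w) * norm (exp (- of_real e * w\<^sup>2)) \<le> M * 1"
          using \<open>M > 0\<close> by (intro mult_mono) auto
        then show ?thesis by (simp add: g_def norm_mult)
      qed
    qed
    have "norm (g z) \<le> M"
    proof (rule maximum_modulus_frontier[of g S])
      show "continuous_on (closure S) g"
        using hol holomorphic_on_imp_continuous_on continuous_on_subset by blast
      show "g holomorphic_on interior S" using hol holomorphic_on_subset by blast
      show "z \<in> S" using z R by (auto simp: S_def)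
    qed (use frontier \<open>bounded S\<close> in auto)
    then show ?thesis by (simp add: g_def)
  qed
  have "((\<lambda>e::real. norm (f z * exp (- of_real e * z\<^sup>2))) \<longlongrightarrow> norm (f z * exp (- of_real 0 * z\<^sup>2))) (at_right 0)"
    by (intro tendsto_intros)
  moreover have "eventually (\<lambda>e. norm (f z * exp (- of_real e * z\<^sup>2)) \<le> M) (at_right (0::real))"
    using damped by (auto simp: eventually_at_filter intro: always_eventually)
  ultimately show ?thesis
    using tendsto_upperbound[of "\<lambda>e. norm (f z * exp (- of_real e * z\<^sup>2))"] by fastforce
qed

section \<open>Decay along rays and its spread to all directions\<close>

definition superexp_decay :: "(complex \<Rightarrow> complex) \<Rightarrow> complex \<Rightarrow> bool" where
  "superexp_decay f u \<longleftrightarrow> (\<forall>M. \<exists>C. \<forall>r\<ge>0. norm (f (of_real r * u)) \<le> C * exp (- M * r))"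

text \<open>
  The ray through \<open>u\<close> is the lower side of the sector with axis \<open>v\<close>. The factor \<open>exp (l t)\<close> uses up
  the decay \<open>K\<close> on this side and compensates the exponential type on the other one; inside the
  sector the resulting bound improves without limit as \<open>K\<close> grows.
\<close>

lemma superexp_decay_rotate_upper:
  assumes f: "exp_type f" and dec: "superexp_decay f u"
    and w: "Re w > 0" "0 \<le> Im w" "2 * Im w \<le> Re w"
  shows "superexp_decay f (u * w)"
  unfolding superexp_decay_def
proof
  fix M
  obtain C B where CB: "C > 0" "B \<ge> 0" "\<And>z. norm (f z) \<le> C * exp (B * norm z)"
    using exp_type_bound[OF f] by blast
  \<comment> \<open>\<open>v * (2 - \<i>) = u\<close> places the given ray on the lower side of the
    sector; the upper side corresponds to a point of the same norm.\<close>
  define v where "v = u * (2 + \<i>) / 5"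
  \<comment> \<open>Chosen so that the real part of \<open>l\<close> becomes
    \<open>\<bar>M\<bar> / (2 * Re w)\<close>.\<close>
  define K where "K = 2 * \<bar>M\<bar> / Re w + B * norm u"
  \<comment> \<open>Solution of the two real equations
    \<open>Re (l * (2 + \<i>)) = - B * norm u\<close> and
    \<open>Re (l * (2 - \<i>)) = K\<close>.\<close>
  define l where "l = Complex ((K - B * norm u) / 4) ((K + B * norm u) / 2)"
  obtain D where D: "\<And>r. r \<ge> 0 \<Longrightarrow> norm (f (of_real r * u)) \<le> D * exp (- K * r)"
    using dec unfolding superexp_decay_def by blast
  define N where "N = max C D"
  have N: "N > 0" "C \<le> N" "D \<le> N" using CB by (auto simp: N_def)
  have v_lower: "v * (2 - \<i>) = u" by (simp add: v_def algebra_simps)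
  have norm_v: "norm (v * (2 + \<i>)) = norm u"
  proof -
    have "norm (2 + \<i>) = norm (2 - \<i>)" by (simp add: norm_complex_def)
    then have "norm (v * (2 + \<i>)) = norm (v * (2 - \<i>))" by (simp only: norm_mult)
    then show ?thesis by (simp only: v_lower)
  qed
  have "exp_type (\<lambda>t. f (v * t) * exp (l * t + 0))"
    by (intro exp_type_mult exp_type_scale f exp_type_exp)
  then have et: "exp_type (\<lambda>t. f (v * t) * exp (l * t))" by simp
  have bound: "norm (f (v * t) * exp (l * t)) \<le> N" if "2 * \<bar>Im t\<bar> \<le> Re t" for t
  proof (rule phragmen_lindelof_sector[OF et N(1) _ _ that])
    fix r :: real assume r: "r \<ge> 0"
    have "norm (f (v * (of_real r * (2 + \<i>)))) \<le> C * exp (B * (r * norm u))"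
      using CB(3)[of "of_real r * (v * (2 + \<i>))"] r norm_v by (simp add: norm_mult mult_ac)
    moreover have "Re (l * (of_real r * (2 + \<i>))) = - (B * (r * norm u))"
      by (simp add: l_def field_simps)
    ultimately have "norm (f (v * (of_real r * (2 + \<i>))) * exp (l * (of_real r * (2 + \<i>)))) \<le>
      (C * exp (B * (r * norm u))) * exp (- (B * (r * norm u)))"
      unfolding norm_mult norm_exp_eq_Re by (intro mult_mono) (use CB in auto)
    also have "\<dots> = C" by (simp add: exp_minus)
    finally show "norm (f (v * (of_real r * (2 + \<i>))) * exp (l * (of_real r * (2 + \<i>)))) \<le> N"
      using N by simp
    have "v * (of_real r * (2 - \<i>)) = of_real r * (v * (2 - \<i>))" by (rule mult.left_commute)
    then have "v * (of_real r * (2 - \<i>)) = of_real r * u" by (simp only: v_lower)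
    then have "norm (f (v * (of_real r * (2 - \<i>)))) \<le> D * exp (- K * r)"
      by (metis D r)
    moreover have "Re (l * (of_real r * (2 - \<i>))) = K * r"
      by (simp add: l_def field_simps)
    ultimately have "norm (f (v * (of_real r * (2 - \<i>))) * exp (l * (of_real r * (2 - \<i>)))) \<le>
      (D * exp (- K * r)) * exp (K * r)"
      unfolding norm_mult norm_exp_eq_Re by (intro mult_mono) (use order_trans[OF norm_ge_zero D[OF r]] in auto)
    also have "\<dots> = D" by (simp flip: exp_add)
    finally show "norm (f (v * (of_real r * (2 - \<i>))) * exp (l * (of_real r * (2 - \<i>)))) \<le> N"
      using N by simp
  qed
  have "norm (f (of_real r * (u * w))) \<le> N * exp (- M * r)" if r: "r \<ge> 0" for r
  proof -
    \<comment> \<open>The conditions on \<open>w\<close> keep \<open>t\<close> in the lower half of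
      the sector, where \<open>Im t \<le> 0\<close> and the imaginary part of \<open>l\<close> only
      improves the bound.\<close>
    define t where "t = of_real r * ((2 - \<i>) * w)"
    have t: "Re t = r * (2 * Re w + Im w)" "Im t = - (r * (Re w - 2 * Im w))"
      by (simp_all add: t_def algebra_simps)
    have "2 * \<bar>Im t\<bar> = r * (2 * (Re w - 2 * Im w))"
      using t w r by (simp add: abs_mult)
    also have "\<dots> \<le> r * (2 * Re w + Im w)"
      using w r by (intro mult_left_mono) auto
    finally have "2 * \<bar>Im t\<bar> \<le> Re t" by (simp add: t)
    then have "norm (f (v * t)) * exp (Re (l * t)) \<le> N"
      using bound[of t] by (simp add: norm_mult)
    moreover have "M * r \<le> Re (l * t)"
    proof -
      have "M * r \<le> \<bar>M\<bar> * r" using r by (intro mult_right_mono) auto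
      also have "\<dots> = (\<bar>M\<bar> / (2 * Re w)) * (r * (2 * Re w))" using w by simp
      also have "\<dots> \<le> (\<bar>M\<bar> / (2 * Re w)) * Re t"
        unfolding t using w r by (intro mult_left_mono) auto
      also have "\<dots> = (K - B * norm u) / 4 * Re t" by (simp add: K_def)
      also have "\<dots> \<le> (K - B * norm u) / 4 * Re t - (K + B * norm u) / 2 * Im t"
      proof -
        have "(K + B * norm u) / 2 * Im t \<le> 0"
          unfolding t(2) using r w CB(2) by (intro mult_nonneg_nonpos) (auto simp: K_def)
        then show ?thesis by linarith
      qed
      also have "\<dots> = Re (l * t)" by (simp add: l_def)
      finally show ?thesis .
    qed
    ultimately have "norm (f (v * t)) * exp (M * r) \<le> N"
      by (smt (verit) exp_le_cancel_iff mult_left_mono norm_ge_zero)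
    moreover have "v * t = of_real r * (u * w)"
      using v_lower by (simp add: t_def flip: mult.assoc)
    ultimately show ?thesis by (simp add: exp_minus field_simps)
  qed
  then show "\<exists>C. \<forall>r\<ge>0. norm (f (of_real r * (u * w))) \<le> C * exp (- M * r)" by blast
qed

text \<open>Downward rotations are reflected into upward ones by passing to
  \<open>cnj (f (cnj z))\<close>, which is again of exponential type and decays along
  \<open>cnj u\<close>.\<close>

lemma superexp_decay_rotate:
  assumes f: "exp_type f" and dec: "superexp_decay f u"
    and w: "Re w > 0" "2 * \<bar>Im w\<bar> \<le> Re w"
  shows "superexp_decay f (u * w)"
proof (cases "Im w \<ge> 0")
  case True
  then show ?thesis using superexp_decay_rotate_upper[OF f dec] w by simp
next
  case False
  have "superexp_decay (\<lambda>z. cnj (f (cnj z))) (cnj u)"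
    using dec by (simp add: superexp_decay_def)
  then have "superexp_decay (\<lambda>z. cnj (f (cnj z))) (cnj u * cnj w)"
    using False w by (intro superexp_decay_rotate_upper exp_type_cnj f) auto
  then show ?thesis by (simp add: superexp_decay_def)
qed

lemma superexp_decay_scale:
  assumes "superexp_decay f u" "s > 0"
  shows "superexp_decay f (of_real s * u)"
  unfolding superexp_decay_def
proof
  fix M
  obtain C where C: "\<And>r. r \<ge> 0 \<Longrightarrow> norm (f (of_real r * u)) \<le> C * exp (- (M / s) * r)"
    using assms unfolding superexp_decay_def by blast
  have "norm (f (of_real r * (of_real s * u))) \<le> C * exp (- M * r)" if "r \<ge> 0" for r
    using C[of "r * s"] that \<open>s > 0\<close> by (simp add: mult_ac)
  then show "\<exists>C. \<forall>r\<ge>0. norm (f (of_real r * (of_real s * u))) \<le> C * exp (- M * r)" by blast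
qed

lemma superexp_decay_all_directions:
  assumes f: "exp_type f" and dec: "superexp_decay f u" and "u \<noteq> 0" "v \<noteq> 0"
  shows "superexp_decay f v"
proof -
  \<comment> \<open>Eight equal rotations reach any direction, and each is by at most pi/8, which is
    less than arctan (1/2).\<close>
  define th where "th = Arg (v / u) / 8"
  define w where "w = cis th"
  have arg: "\<bar>2 * th\<bar> \<le> pi / 4" 
    using Arg_le_pi[of "v / u"] mpi_less_Arg[of "v / u"] by (auto simp: abs_le_iff th_def)
  have "cos (pi / 4) \<le> cos (2 * th)"
    using cos_monotone_0_pi_le[of "\<bar>2 * th\<bar>" "pi / 4"] arg by (simp only: cos_abs_real)
  \<comment> \<open>3/5 is the cosine of twice arctan (1/2), so this is the sector condition
    expressed through the double angle.\<close>
  moreover have "3 / 5 \<le> sqrt 2 / 2"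
    using real_le_rsqrt[of "6/5" 2] by (simp add: power2_eq_square)
  ultimately have "3 / 5 \<le> cos (2 * th)"
    by (simp add: cos_45)
  then have "(2 * \<bar>sin th\<bar>)\<^sup>2 \<le> (cos th)\<^sup>2"
    by (simp add: cos_double cos_squared_eq)
  moreover have pos: "cos th > 0"
    using arg pi_gt_zero unfolding abs_le_iff by (intro cos_gt_zero_pi) linarith+
  ultimately have "2 * \<bar>sin th\<bar> \<le> cos th"
    using power2_le_imp_le less_imp_le by blast
  then have w: "Re w > 0" "2 * \<bar>Im w\<bar> \<le> Re w" using pos by (simp_all add: w_def)
  have "superexp_decay f (u * w ^ n)" for n
  proof (induction n)
    case (Suc n)
    show ?case using superexp_decay_rotate[OF f Suc w] by (simp add: mult_ac)
  qed (use dec in simp)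
  from superexp_decay_scale[OF this[of 8], of "norm (v / u)"]
  have "superexp_decay f (of_real (norm (v / u)) * (u * w ^ 8))"
    using \<open>u \<noteq> 0\<close> \<open>v \<noteq> 0\<close> by simp
  also have "w ^ 8 = cis (Arg (v / u))"
    using Complex.DeMoivre[of th 8] by (simp add: w_def th_def)
  also have "of_real (norm (v / u)) * (u * cis (Arg (v / u))) = u * (v / u)"
    using rcis_cmod_Arg[of "v / u"] by (metis mult.left_commute rcis_def)
  also have "\<dots> = v" using \<open>u \<noteq> 0\<close> by simp
  finally show ?thesis .
qed

text \<open>Decay faster than every exponential survives rotation of the ray, so it spreads from one
  ray to all. Boundedness on rays then extends to sectors covering the plane, Liouville makes
  \<open>f\<close> constant, and a constant that decays is 0.\<close>

theorem superexp_decay_imp_zero: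
  assumes f: "exp_type f" and dec: "superexp_decay f u" and "u \<noteq> 0"
  shows "f z = 0"
proof -
  note dirs = superexp_decay_all_directions[OF f dec \<open>u \<noteq> 0\<close>]
  have ray: "\<exists>C>0. \<forall>r\<ge>0. norm (f (of_real r * v)) \<le> C" if v: "v \<noteq> 0" for v
  proof -
    obtain C where "\<And>r. r \<ge> 0 \<Longrightarrow> norm (f (of_real r * v)) \<le> C * exp (- 0 * r)"
      using dirs[OF v] unfolding superexp_decay_def by blast
    then show ?thesis by (intro exI[of _ "max C 1"]) (auto intro: max.coboundedI1)
  qed
  have "\<exists>C. \<forall>t. 2 * \<bar>Im t\<bar> \<le> Re t \<longrightarrow> norm (f (v * t)) \<le> C" if v: "v \<noteq> 0" for v
  proof -
    have nz: "2 + \<i> \<noteq> 0" "2 - \<i> \<noteq> 0" by (auto simp: complex_eq_iff)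
    obtain C where C: "C > 0" "\<And>r. r \<ge> 0 \<Longrightarrow> norm (f (of_real r * (v * (2 + \<i>)))) \<le> C"
      using ray[of "v * (2 + \<i>)"] nz v by auto
    obtain D where D: "D > 0" "\<And>r. r \<ge> 0 \<Longrightarrow> norm (f (of_real r * (v * (2 - \<i>)))) \<le> D"
      using ray[of "v * (2 - \<i>)"] nz v by auto
    have "norm (f (v * t)) \<le> max C D" if "2 * \<bar>Im t\<bar> \<le> Re t" for t
    proof (rule phragmen_lindelof_sector[OF exp_type_scale[OF f] _ _ _ that])
      show "max C D > 0" using C by simp
      fix r :: real assume "r \<ge> 0"
      then show "norm (f (v * (of_real r * (2 + \<i>)))) \<le> max C D"
        "norm (f (v * (of_real r * (2 - \<i>)))) \<le> max C D"
        using C(2)[of r] D(2)[of r] by (simp_all add: mult.left_commute le_max_iff_disj)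
    qed
    then show ?thesis by blast
  qed
  then obtain C where C: "\<And>v t. v \<noteq> 0 \<Longrightarrow> 2 * \<bar>Im t\<bar> \<le> Re t \<Longrightarrow> norm (f (v * t)) \<le> C v"
    by metis
  \<comment> \<open>Axes at the multiples of pi/4: sectors of half-angle arctan (1/2), which exceeds
    pi/8, around them cover the plane.\<close>
  define V where "V = {1, -1, \<i>, -\<i>, 1 + \<i>, 1 - \<i>, -1 + \<i>, -1 - \<i>}"
  have V: "finite V" "0 \<notin> V" by (auto simp: V_def complex_eq_iff)
  have "norm (f z) \<le> Max (C ` V)" for z
  proof -
    have "\<exists>v\<in>V. 2 * \<bar>Im (z / v)\<bar> \<le> Re (z / v)"
    proof (rule ccontr)
      assume neg: "\<not> ?thesis"
      define x y where "x = Re z" and "y = Im z"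
      have "x < 2 * \<bar>y\<bar>" "- x < 2 * \<bar>y\<bar>" "y < 2 * \<bar>x\<bar>" "- y < 2 * \<bar>x\<bar>"
        "x + y < 2 * \<bar>y - x\<bar>" "x - y < 2 * \<bar>x + y\<bar>" "y - x < 2 * \<bar>x + y\<bar>" "- x - y < 2 * \<bar>y - x\<bar>"
        using neg by (simp_all add: V_def Re_divide Im_divide power2_eq_square x_def y_def abs_minus_commute add.commute)
      then show False by (smt (verit))
    qed
    then obtain v where v: "v \<in> V" "2 * \<bar>Im (z / v)\<bar> \<le> Re (z / v)" by blast
    then have "v \<noteq> 0" using V by metis
    have "norm (f z) \<le> C v" using C[OF \<open>v \<noteq> 0\<close> v(2)] \<open>v \<noteq> 0\<close> by simp
    also have "\<dots> \<le> Max (C ` V)" using v V by auto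
    finally show ?thesis .
  qed
  then have "bounded (range f)" by (auto intro!: boundedI)
  then obtain c where c: "\<And>z. f z = c"
    using Liouville_theorem[of f] f by (auto simp: exp_type_def constant_on_def)
  obtain D where D: "\<And>r. r \<ge> 0 \<Longrightarrow> norm (f (of_real r * u)) \<le> D * exp (- 1 * r)"
    using dec unfolding superexp_decay_def by blast
  have "((\<lambda>r. D * exp (- 1 * r)) \<longlongrightarrow> 0) at_top" by real_asymp
  moreover have "eventually (\<lambda>r. norm c \<le> D * exp (- 1 * r)) at_top"
    using eventually_ge_at_top[of 0] by eventually_elim (use D c in simp)
  ultimately have "norm c \<le> 0"
    by (intro tendsto_lowerbound[of "\<lambda>r::real. D * exp (- 1 * r)"]) auto
  then show ?thesis using c by simp
qed

text \<open>
  Along the ray through \<open>1 - \<i>\<close> the term \<open>exp (a t\<^sup>2)\<close> outgrows the two others, which forces its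
  coefficient to decay like a Gaussian there.
\<close>

lemma interference_term_zero:
  assumes A: "exp_type A" and A': "exp_type A'" and E: "exp_type E" and a: "Im a > 0"
    and eq: "\<And>t. exp (a * t\<^sup>2) * A t + exp (cnj a * t\<^sup>2) * A' t + E t = 0"
  shows "A z = 0"
proof (rule superexp_decay_imp_zero[OF A])
  show "1 - \<i> \<noteq> 0" by (auto simp: complex_eq_iff)
  obtain C B where CB: "C > 0" "B \<ge> 0" "\<And>z. norm (A' z) \<le> C * exp (B * norm z)"
    using exp_type_bound[OF A'] by blast
  obtain D F where DF: "D > 0" "F \<ge> 0" "\<And>z. norm (E z) \<le> D * exp (F * norm z)"
    using exp_type_bound[OF E] by blast
  define b where "b = Im a"
  have b: "b > 0" using a by (simp add: b_def)
  show "superexp_decay A (1 - \<i>)"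
    unfolding superexp_decay_def
  proof
    fix M
    \<comment> \<open>\<open>norm t \<le> 2 * r\<close> on this ray; one rate serves both
      \<open>A'\<close> and \<open>E\<close>.\<close>
    define G where "G = 2 * (B + F)"
    have "norm (A (of_real r * (1 - \<i>))) \<le> (C + D) * exp ((G + M)\<^sup>2 / (8 * b)) * exp (- M * r)" if r: "r \<ge> 0" for r
    proof -
      define t where "t = of_real r * (1 - \<i>)"
      have "norm (1 - \<i>) \<le> 2" by (rule order_trans[OF norm_triangle_ineq4]) simp
      then have nt: "norm t \<le> 2 * r" using r by (simp add: t_def norm_mult mult.commute mult_left_mono)
      have t2: "t\<^sup>2 = - 2 * \<i> * of_real (r\<^sup>2)"
        by (simp add: t_def power_mult_distrib) (simp add: power2_eq_square algebra_simps)
      have "norm (A' t) \<le> C * exp (G * r)"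
      proof (rule order_trans[OF CB(3)])
        have "B * norm t \<le> B * (2 * r)" using nt CB by (intro mult_left_mono) auto
        also have "\<dots> \<le> G * r" using r DF by (auto simp: G_def algebra_simps)
        finally show "C * exp (B * norm t) \<le> C * exp (G * r)" using CB by simp
      qed
      moreover have "norm (E t) \<le> D * exp (G * r)"
      proof (rule order_trans[OF DF(3)])
        have "F * norm t \<le> F * (2 * r)" using nt DF by (intro mult_left_mono) auto
        also have "\<dots> \<le> G * r" using r CB by (auto simp: G_def algebra_simps)
        finally show "D * exp (F * norm t) \<le> D * exp (G * r)" using DF by simp
      qed
      moreover have "norm (exp (- (a * t\<^sup>2))) = exp (- 2 * b * r\<^sup>2)"
        by (simp add: t2 b_def)
      moreover have "norm (exp (cnj a * t\<^sup>2 - a * t\<^sup>2)) \<le> exp (- 2 * b * r\<^sup>2)"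
        using b by (simp add: t2) (simp add: b_def)
      \<comment> \<open>The identity is divided by its dominant exponential; both coefficients that
        remain have norm at most exp (- 2 b r^2).\<close>
      moreover have "A t = - (exp (cnj a * t\<^sup>2 - a * t\<^sup>2) * A' t + exp (- (a * t\<^sup>2)) * E t)"
      proof -
        have "exp (- (a * t\<^sup>2)) * (exp (a * t\<^sup>2) * A t + exp (cnj a * t\<^sup>2) * A' t + E t) = 0"
          by (simp add: eq)
        then have "exp (- (a * t\<^sup>2) + a * t\<^sup>2) * A t + exp (- (a * t\<^sup>2) + cnj a * t\<^sup>2) * A' t + exp (- (a * t\<^sup>2)) * E t = 0"
          unfolding exp_add by (simp only: ring_distribs mult.assoc)
        then show ?thesis by (simp add: add_eq_0_iff2 algebra_simps)
      qed
      ultimately have "norm (A t) \<le> exp (- 2 * b * r\<^sup>2) * (C * exp (G * r)) + exp (- 2 * b * r\<^sup>2) * (D * exp (G * r))"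
        by (auto simp only: norm_minus_cancel norm_mult intro!: order_trans[OF norm_triangle_ineq] add_mono mult_mono) auto
      also have "\<dots> = (C + D) * exp (G * r - 2 * b * r\<^sup>2)"
        by (simp add: exp_diff exp_minus field_simps)
      also have "\<dots> \<le> (C + D) * exp ((G + M)\<^sup>2 / (8 * b) - M * r)"
      proof -
        \<comment> \<open>Completing the square: (G + M) r - 2 b r^2 has maximum (G + M)^2 / (8
          b).\<close>
        have "0 \<le> (4 * b * r - (G + M))\<^sup>2 / (8 * b)" using b by simp
        also have "\<dots> = 2 * b * r\<^sup>2 - (G + M) * r + (G + M)\<^sup>2 / (8 * b)"
          using b by (simp add: power2_eq_square field_simps)
        finally have "exp (G * r - 2 * b * r\<^sup>2) \<le> exp ((G + M)\<^sup>2 / (8 * b) - M * r)"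
          by (simp add: algebra_simps)
        then show ?thesis using CB DF by (intro mult_left_mono) auto
      qed
      finally show ?thesis by (simp add: t_def mult.assoc flip: exp_add)
    qed
    then show "\<exists>C. \<forall>r\<ge>0. norm (A (of_real r * (1 - \<i>))) \<le> C * exp (- M * r)" by blast
  qed
qed

text \<open>At real points the conjugate of \<open>A\<close> coincides with the entire function
  \<open>cnj (A (cnj t))\<close>. The hypothesis is thus an identity of entire functions on an
  interval, and it continues to the whole plane.\<close>

proposition real_interference_zero:
  assumes A: "exp_type A" and E: "exp_type E" and a: "Im a > 0" and "e > 0"
    and eq: "\<And>t::real. \<bar>t\<bar> < e \<Longrightarrow>
      exp (a * of_real (t\<^sup>2)) * A (of_real t) + cnj (exp (a * of_real (t\<^sup>2)) * A (of_real t)) + E (of_real t) = 0"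
  shows "A z = 0"
proof (rule interference_term_zero[OF A exp_type_cnj[OF A] E a])
  fix t
  define f where "f = (\<lambda>t. exp (a * t\<^sup>2) * A t + exp (cnj a * t\<^sup>2) * cnj (A (cnj t)) + E t)"
  have "f t = 0"
  proof (rule analytic_continuation[of f UNIV "of_real ` {-e<..<e}" 0])
    show "f holomorphic_on UNIV"
      unfolding f_def using A E exp_type_cnj[OF A]
      by (auto simp: exp_type_def intro!: holomorphic_intros)
    have "(0::real) islimpt {-e<..<e}" using \<open>e > 0\<close> by (simp add: islimpt_greaterThanLessThan1 open_imp_islimpt)
    then show "(0::complex) islimpt of_real ` {-e<..<e}"
      unfolding islimpt_approachable by (force simp: dist_norm norm_of_real)
    fix z :: complex assume "z \<in> of_real ` {-e<..<e}"
    then obtain s :: real where "z = of_real s" "\<bar>s\<bar> < e" by auto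
    then show "f z = 0" using eq[of s] by (simp add: f_def exp_cnj)
  qed auto
  then show "exp (a * t\<^sup>2) * A t + exp (cnj a * t\<^sup>2) * cnj (A (cnj t)) + E t = 0"
    by (simp add: f_def)
qed

section \<open>Integrals depending holomorphically on a parameter\<close>

lemma exp_remainder_bound:
  fixes z :: complex
  shows "norm (exp z - 1 - z) \<le> (norm z)\<^sup>2 * exp (norm z)"
  using Taylor_exp_field[of z 1] by (simp add: algebra_simps power2_eq_square)

text \<open>The one exponential moment of order \<open>r\<close> dominates \<open>f\<close>,
  \<open>f g\<close> and, for \<open>norm h \<le> r / 2\<close>, the second-order remainder, so the
  derivative follows from an explicit error bound of order (norm h)^2.\<close>

lemma exp_integral_has_derivative_0:
  fixes f g :: "'a::euclidean_space \<Rightarrow> complex"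
  assumes [measurable]: "f \<in> borel_measurable M" "g \<in> borel_measurable M"
    and r: "r > 0" and int: "integrable M (\<lambda>x. norm (f x) * exp (r * norm (g x)))"
  shows "((\<lambda>h. LINT x|M. f x * exp (h * g x)) has_field_derivative (LINT x|M. f x * g x)) (at 0)"
proof -
  define w where "w = (\<lambda>x. norm (f x) * exp (r * norm (g x)))"
  have w: "integrable M w" using int by (simp add: w_def)
  have dominated: "integrable M h" 
    if "h \<in> borel_measurable M" "\<And>x. norm (h x) \<le> c * w x" for h :: "'a \<Rightarrow> complex" and c
    using that w by (intro Bochner_Integration.integrable_bound[of M "\<lambda>x. c * w x" h])
      (auto intro: order_trans[OF _ abs_ge_self])
  have lin: "t \<le> exp (r * t) / r" if "t \<ge> 0" for t
  proof -
    have "r * t \<le> exp (r * t)" using exp_ge_add_one_self[of "r * t"] by linarith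
    then show ?thesis using r by (simp add: pos_le_divide_eq mult.commute)
  qed
  \<comment> \<open>Half of the moment is kept for \<open>exp (norm (h * g x))\<close>, the other
    half pays for the square of \<open>g\<close>; 8 / r^2 comes from y^2 / 2 \<le> exp y at y = r t
    / 2.\<close>
  have quad: "t\<^sup>2 * exp (r / 2 * t) \<le> 8 / r\<^sup>2 * exp (r * t)" if "t \<ge> 0" for t
  proof -
    have "(r / 2 * t)\<^sup>2 / 2 \<le> exp (r / 2 * t)"
    proof -
      have "0 \<le> r / 2 * t" using r that by simp
      then show ?thesis using exp_lower_Taylor_quadratic[of "r / 2 * t"] by linarith
    qed
    then have "t\<^sup>2 \<le> 8 / r\<^sup>2 * exp (r / 2 * t)" using r by (simp add: power_mult_distrib field_simps)
    then have "t\<^sup>2 * exp (r / 2 * t) \<le> 8 / r\<^sup>2 * exp (r / 2 * t) * exp (r / 2 * t)"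
      by (intro mult_right_mono) auto
    also have "\<dots> = 8 / r\<^sup>2 * exp (r * t)" by (simp flip: exp_add)
    finally show ?thesis .
  qed
  have int_f: "integrable M f"
    by (rule dominated[where c = 1]) (use r in \<open>auto simp: w_def mult_le_cancel_left1\<close>)
  have int_fg: "integrable M (\<lambda>x. f x * g x)"
  proof (rule dominated[where c = "1 / r"])
    fix x
    show "norm (f x * g x) \<le> 1 / r * w x"
      using mult_left_mono[OF lin[of "norm (g x)"], of "norm (f x)"] by (simp add: w_def norm_mult)
  qed simp
  have int_fe: "integrable M (\<lambda>x. f x * exp (h * g x))" if h: "norm h \<le> r" for h
  proof (rule dominated[where c = 1])
    fix x
    have "norm (exp (h * g x)) \<le> exp (r * norm (g x))"
      by (rule order_trans[OF norm_exp]) (use h in \<open>simp add: norm_mult mult_right_mono\<close>)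
    then show "norm (f x * exp (h * g x)) \<le> 1 * w x"
      by (simp add: w_def norm_mult mult_left_mono)
  qed simp
  define D where "D = (LINT x|M. f x * g x)"
  define F where "F = (\<lambda>h. LINT x|M. f x * exp (h * g x))"
  define K where "K = 8 / r\<^sup>2 * (LINT x|M. w x)"
  have rem: "norm (F h - F 0 - h * D) \<le> (norm h)\<^sup>2 * K" if h: "norm h \<le> r / 2" for h
  proof -
    have hr: "norm h \<le> r" using h r by linarith
    have "F h - F 0 - h * D = (LINT x|M. f x * (exp (h * g x) - 1 - h * g x))"
      unfolding F_def D_def using int_fe[OF hr] int_f int_fg
      by (simp add: algebra_simps mult.left_commute)
    also have "norm \<dots> \<le> (LINT x|M. (norm h)\<^sup>2 * (8 / r\<^sup>2) * w x)"
    proof (rule Bochner_Integration.integral_norm_bound_integral)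
      show "integrable M (\<lambda>x. f x * (exp (h * g x) - 1 - h * g x))"
        using int_fe[OF hr] int_f int_fg by (simp add: algebra_simps mult.left_commute)
      fix x
      have "norm (exp (h * g x) - 1 - h * g x) \<le> (norm (h * g x))\<^sup>2 * exp (norm (h * g x))"
        by (rule exp_remainder_bound)
      also have "\<dots> \<le> (norm (h * g x))\<^sup>2 * exp (r / 2 * norm (g x))"
        using mult_right_mono[OF h, of "norm (g x)"] by (intro mult_left_mono) (auto simp: norm_mult)
      also have "\<dots> = (norm h)\<^sup>2 * ((norm (g x))\<^sup>2 * exp (r / 2 * norm (g x)))"
        by (simp add: norm_mult power_mult_distrib)
      also have "\<dots> \<le> (norm h)\<^sup>2 * (8 / r\<^sup>2 * exp (r * norm (g x)))"
        by (intro mult_left_mono quad) auto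
      finally have "norm (f x) * norm (exp (h * g x) - 1 - h * g x) \<le>
          norm (f x) * ((norm h)\<^sup>2 * (8 / r\<^sup>2 * exp (r * norm (g x))))"
        by (intro mult_left_mono) auto
      then show "norm (f x * (exp (h * g x) - 1 - h * g x)) \<le> (norm h)\<^sup>2 * (8 / r\<^sup>2) * w x"
        by (simp add: norm_mult w_def mult_ac)
    qed (use w in simp)
    also have "\<dots> = (norm h)\<^sup>2 * K" by (simp add: K_def)
    finally show ?thesis .
  qed
  have "((\<lambda>h. (F h - F 0) / h - D) \<longlongrightarrow> 0) (at 0)"
  proof (rule Lim_null_comparison)
    show "((\<lambda>h::complex. norm h * K) \<longlongrightarrow> 0) (at 0)" by (auto intro!: tendsto_eq_intros)
    show "eventually (\<lambda>h. norm ((F h - F 0) / h - D) \<le> norm h * K) (at 0)"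
      unfolding eventually_at
    proof (intro exI[of _ "r / 2"] conjI ballI impI)
      fix h :: complex assume h: "h \<noteq> 0 \<and> dist h 0 < r / 2"
      have "(F h - F 0) / h - D = (F h - F 0 - h * D) / h" using h by (simp add: field_simps)
      then show "norm ((F h - F 0) / h - D) \<le> norm h * K"
        using rem[of h] h by (simp add: norm_divide divide_simps power2_eq_square mult_ac)
    qed (use r in auto)
  qed
  then have "(F has_field_derivative D) (at 0)"
    unfolding has_field_derivative_iff using LIM_zero_cancel by fastforce
  then show ?thesis by (simp add: F_def D_def)
qed

text \<open>Absorbing \<open>exp (t * g x)\<close> into \<open>f\<close> moves the point
  \<open>t\<close> to the origin. It serves Gaussian integrals as functions of their width
  (quadratic \<open>g\<close>) and Fourier transforms on complex lines (linear imaginary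
  \<open>g\<close>).\<close>

lemma exp_integral_holomorphic:
  fixes f g :: "'a::euclidean_space \<Rightarrow> complex"
  assumes [measurable]: "f \<in> borel_measurable M" "g \<in> borel_measurable M" and "open S"
    and int: "\<And>t. t \<in> S \<Longrightarrow> \<exists>r>0. integrable M (\<lambda>x. norm (f x * exp (t * g x)) * exp (r * norm (g x)))"
  shows "(\<lambda>t. LINT x|M. f x * exp (t * g x)) holomorphic_on S"
proof (subst holomorphic_on_open[OF \<open>open S\<close>], intro ballI)
  fix t assume "t \<in> S"
  then obtain r where r: "r > 0" "integrable M (\<lambda>x. norm (f x * exp (t * g x)) * exp (r * norm (g x)))"
    using int by blast
  have "((\<lambda>h. LINT x|M. (f x * exp (t * g x)) * exp (h * g x)) has_field_derivative
      (LINT x|M. (f x * exp (t * g x)) * g x)) (at 0)"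
    by (rule exp_integral_has_derivative_0[OF _ _ r]) auto
  then have "((\<lambda>h. LINT x|M. f x * exp ((h + t) * g x)) has_field_derivative
      (LINT x|M. (f x * exp (t * g x)) * g x)) (at 0)"
    by (simp add: ring_distribs exp_add mult_ac)
  then have "((\<lambda>h. LINT x|M. f x * exp (h * g x)) has_field_derivative
      (LINT x|M. (f x * exp (t * g x)) * g x)) (at (0 + t))"
    by (subst DERIV_shift)
  then show "\<exists>f'. ((\<lambda>h. LINT x|M. f x * exp (h * g x)) has_field_derivative f') (at t)" by auto
qed

section \<open>Gaussian integrals\<close>

text \<open>With complex \<open>a\<close> one family contains constants, chirps
  (\<open>Re a = 0\<close>), mollifiers, the probes and their propagated fields, and it is closed
  under products and rescaling.\<close>

definition gauss :: "complex \<Rightarrow> 'a::real_inner \<Rightarrow> complex" where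
  "gauss a x = exp (- a * of_real (x \<bullet> x))"

definition wave :: "'a::real_inner \<Rightarrow> 'a \<Rightarrow> complex" where
  "wave \<eta> x = exp (- \<i> * of_real (\<eta> \<bullet> x))"

lemma norm_gauss: "norm (gauss a x) = exp (- Re a * (x \<bullet> x))"
  by (simp add: gauss_def)

lemma norm_wave [simp]: "norm (wave \<eta> x) = 1"
  by (simp add: wave_def)

lemma gauss_measurable [measurable]: "gauss a \<in> borel_measurable borel"
  unfolding gauss_def[abs_def] by (intro borel_measurable_continuous_onI continuous_intros)

lemma wave_measurable [measurable]: "wave \<eta> \<in> borel_measurable borel"
  unfolding wave_def[abs_def] by (intro borel_measurable_continuous_onI continuous_intros)

lemma integrable_gauss_real:
  fixes a :: real
  assumes "a > 0"
  shows "integrable lborel (\<lambda>s::real. exp (- a * s\<^sup>2))"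
proof -
  have "integrable lborel (\<lambda>s. sqrt (pi / a) * normal_density 0 (sqrt (1 / (2 * a))) s)"
    by (intro integrable_mult_right integrable_normal_density)  (use assms in auto)
  also have "(\<lambda>s. sqrt (pi / a) * normal_density 0 (sqrt (1 / (2 * a))) s) = (\<lambda>s. exp (- a * s\<^sup>2))"
    using assms by (auto simp: normal_density_def real_sqrt_divide fun_eq_iff real_sqrt_mult power_divide power_mult_distrib)
  finally show ?thesis .
qed

text \<open>Rescaled by \<open>sqrt (2 * a)\<close> this is the characteristic function of the
  standard normal distribution. The value is written with \<open>csqrt\<close> so that it extends
  holomorphically in \<open>a\<close>.\<close>

lemma gauss_fourier_1d_real:
  assumes a: "a > 0"
  shows "(LINT s|lborel. exp (- of_real a * (of_real s)\<^sup>2) * exp (- \<i> * of_real (b * s))) =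
    csqrt (of_real pi / of_real a) * exp (- (of_real b)\<^sup>2 / (4 * of_real a))"
proof -
  define c where "c = sqrt (2 * a)"
  have c: "c > 0" "c\<^sup>2 = 2 * a" using a by (auto simp: c_def)
  define t where "t = - b / c"
  have "of_real (exp (- (t\<^sup>2) / 2)) = (CLINT x|std_normal_distribution. iexp (t * x))"
    using fun_cong[OF char_std_normal_distribution, of t] by (simp add: char_def)
  also have "\<dots> = (LINT x|lborel. std_normal_density x *\<^sub>R iexp (t * x))"
    by (subst integral_density) auto
  also have "\<dots> = c *\<^sub>R (LINT s|lborel. std_normal_density (0 + c * s) *\<^sub>R iexp (t * (0 + c * s)))"
    using c by (subst lborel_integral_real_affine[of c _ 0]) auto
  also have "(LINT s|lborel. std_normal_density (0 + c * s) *\<^sub>R iexp (t * (0 + c * s))) =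
      (LINT s|lborel. of_real (1 / sqrt (2 * pi)) * (exp (- of_real a * (of_real s)\<^sup>2) * exp (- \<i> * of_real (b * s))))"
  proof (rule Bochner_Integration.integral_cong[OF refl])
    fix s :: real
    have "(c * s)\<^sup>2 / 2 = a * s\<^sup>2" using c by (simp add: power_mult_distrib)
    then have "std_normal_density (c * s) = 1 / sqrt (2 * pi) * exp (- (a * s\<^sup>2))"
      by (simp add: std_normal_density_def)
    moreover have "t * (c * s) = - (b * s)" using c by (simp add: t_def)
    ultimately show "std_normal_density (0 + c * s) *\<^sub>R iexp (t * (0 + c * s)) = 
      of_real (1 / sqrt (2 * pi)) * (exp (- of_real a * (of_real s)\<^sup>2) * exp (- \<i> * of_real (b * s)))"
      by (simp add: scaleR_conv_of_real flip: exp_of_real)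
  qed
  finally have "of_real (exp (- (t\<^sup>2) / 2)) = of_real (c / sqrt (2 * pi)) *
      (LINT s|lborel. exp (- of_real a * (of_real s)\<^sup>2) * exp (- \<i> * of_real (b * s)))" (is "_ = _ * ?I")
    by (simp add: scaleR_conv_of_real)
  then have "?I = of_real (sqrt (2 * pi) / c) * of_real (exp (- (t\<^sup>2) / 2))"
    using c by (simp add: field_simps)
  also have "sqrt (2 * pi) / c = sqrt (pi / a)"
    unfolding c_def by (simp add: real_sqrt_divide real_sqrt_mult)
  also have "of_real (sqrt (pi / a)) = csqrt (of_real pi / of_real a)"
    using a by (subst of_real_sqrt) auto
  also have "t\<^sup>2 / 2 = b\<^sup>2 / (4 * a)" using c by (simp add: t_def power_divide)
  then have "of_real (exp (- (t\<^sup>2) / 2)) = exp (- (of_real b)\<^sup>2 / (4 * of_real a) :: complex)"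
    by (simp flip: exp_of_real)
  finally show ?thesis .
qed

text \<open>Analytic continuation in \<open>a\<close> from the positive axis to the right
  half-plane. The principal root is holomorphic along the way because \<open>of_real pi / a\<close>
  stays in that half-plane.\<close>

lemma gauss_fourier_1d:
  assumes a: "Re a > 0"
  shows "(LINT s|lborel. exp (- a * (of_real s)\<^sup>2) * exp (- \<i> * of_real (b * s))) =
    csqrt (of_real pi / a) * exp (- (of_real b)\<^sup>2 / (4 * a))"
proof -
  define S where "S = {z::complex. Re z > 0}"
  define F where "F = (\<lambda>a. LINT s|lborel. exp (- \<i> * of_real (b * s)) * exp (a * - (of_real s)\<^sup>2))"
  define G where "G = (\<lambda>a. csqrt (of_real pi / a) * exp (- (of_real b)\<^sup>2 / (4 * a)))"
  have S: "open S" "connected S"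
    by (auto simp: S_def open_halfspace_Re_gt intro!: convex_connected convex_halfspace_Re_gt)
  have "F holomorphic_on S"
    unfolding F_def
  proof (rule exp_integral_holomorphic[OF _ _ S(1)])
    fix t assume "t \<in> S"
    then have t: "Re t > 0" by (simp add: S_def)
    show "\<exists>r>0. integrable lborel (\<lambda>s. norm (exp (- \<i> * of_real (b * s)) * exp (t * - (of_real s)\<^sup>2)) * exp (r * norm (- (complex_of_real s)\<^sup>2)))"
    proof (intro exI conjI)
      show "Re t / 2 > 0" using t by simp
      have "integrable lborel (\<lambda>s::real. exp (- (Re t / 2) * s\<^sup>2))"
        using t by (intro integrable_gauss_real) auto
      also have "(\<lambda>s::real. exp (- (Re t / 2) * s\<^sup>2)) = (\<lambda>s. norm (exp (- \<i> * of_real (b * s)) * exp (t * - (of_real s)\<^sup>2)) * exp (Re t / 2 * norm (- (complex_of_real s)\<^sup>2)))"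
        by (auto simp: norm_mult norm_power fun_eq_iff simp flip: exp_add of_real_power)
      finally show "integrable lborel \<dots>" .
    qed
  qed auto
  moreover have "G holomorphic_on S"
  proof -
    have "of_real pi / z \<notin> \<real>\<^sub>\<le>\<^sub>0" if "z \<in> S" for z
    proof -
      have "Re (of_real pi / z) > 0"
        using that by (auto simp: S_def Re_divide intro!: divide_pos_pos sum_power2_gt_zero_iff[THEN iffD2])
      then show ?thesis by (auto simp: complex_nonpos_Reals_iff)
    qed
    moreover have "0 \<notin> S" by (simp add: S_def)
    ultimately show ?thesis unfolding G_def by (intro holomorphic_intros) auto
  qed
  ultimately have hol: "(\<lambda>z. F z - G z) holomorphic_on S" by (intro holomorphic_intros)
  have "F a - G a = 0"
  proof (rule analytic_continuation[OF hol S, of "of_real ` {0<..}" 1])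
    show "(1::complex) islimpt of_real ` {0<..}"
      unfolding islimpt_approachable
    proof (intro allI impI)
      fix e :: real assume "e > 0"
      then show "\<exists>x'\<in>of_real ` {0<..}. x' \<noteq> 1 \<and> dist x' (1::complex) < e"
        by (intro bexI[of _ "of_real (1 + e / 2)"] imageI) (auto simp: dist_norm norm_divide)
    qed
    fix z :: complex assume "z \<in> of_real ` {0<..}"
    then obtain c where "c > 0" "z = of_real c" by auto
    then show "F z - G z = 0"
      using gauss_fourier_1d_real[of c b] by (simp add: F_def G_def mult_ac)
  qed (use a in \<open>auto simp: S_def\<close>)
  then show ?thesis by (simp add: F_def G_def mult_ac)
qed

section \<open>Gaussian integrals in several variables as products over the coordinates\<close>

lemma
  fixes f :: "'a::euclidean_space \<Rightarrow> real \<Rightarrow> complex"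
  assumes f: "\<And>b. b \<in> Basis \<Longrightarrow> integrable lborel (f b)"
  shows integrable_lborel_prod: "integrable lborel (\<lambda>x. \<Prod>b\<in>Basis. f b (x \<bullet> b))"
    and integral_lborel_prod: "(LINT x|lborel. (\<Prod>b\<in>Basis. f b (x \<bullet> b))) = (\<Prod>b\<in>Basis. LINT s|lborel. f b s)"
proof -
  interpret product_sigma_finite "\<lambda>_::'a. lborel :: real measure" by standard
  define T where "T = (\<lambda>g::'a \<Rightarrow> real. \<Sum>b\<in>Basis. g b *\<^sub>R b)"
  have T[measurable]: "T \<in> measurable (\<Pi>\<^sub>M b\<in>Basis. lborel) borel" by (simp add: T_def)
  have coord: "T g \<bullet> b = g b" if "b \<in> Basis" for g b
    using that by (simp add: T_def inner_sum_left_Basis)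
  have eq: "(lborel :: 'a measure) = distr (\<Pi>\<^sub>M b\<in>Basis. lborel) borel T"
    unfolding T_def by (rule lborel_eq)
  have [measurable]: "f b \<in> borel_measurable borel" if "b \<in> Basis" for b
    using borel_measurable_integrable[OF f[OF that]] by simp
  have meas: "(\<lambda>x. \<Prod>b\<in>Basis. f b (x \<bullet> b)) \<in> borel_measurable borel" by measurable
  have co: "(\<Prod>b\<in>Basis. f b (T g \<bullet> b)) = (\<Prod>b\<in>Basis. f b (g b))" for g
    by (intro prod.cong) (auto simp: coord)
  show "integrable lborel (\<lambda>x. \<Prod>b\<in>Basis. f b (x \<bullet> b))"
    unfolding eq using product_integrable_prod[OF finite_Basis f]
    by (subst integrable_distr_eq[OF T]) (auto simp: co meas)
  show "(LINT x|lborel. (\<Prod>b\<in>Basis. f b (x \<bullet> b))) = (\<Prod>b\<in>Basis. LINT s|lborel. f b s)"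
    unfolding eq using product_integral_prod[OF finite_Basis f]
    by (subst integral_distr[OF T]) (auto simp: co meas)
qed

lemma gauss_wave_prod:
  fixes x \<eta> :: "'a::euclidean_space"
  shows "gauss a x * wave \<eta> x =
    (\<Prod>b\<in>Basis. exp (- a * (of_real (x \<bullet> b))\<^sup>2) * exp (- \<i> * of_real ((\<eta> \<bullet> b) * (x \<bullet> b))))"
proof -
  have "(\<Sum>b\<in>Basis. - a * (of_real (x \<bullet> b))\<^sup>2 + - \<i> * of_real ((\<eta> \<bullet> b) * (x \<bullet> b))) =
      - a * of_real (x \<bullet> x) + - \<i> * of_real (\<eta> \<bullet> x)"
    unfolding euclidean_inner[of x x] euclidean_inner[of \<eta> x]
    by (simp add: sum.distrib sum_distrib_left power2_eq_square sum_subtractf sum_negf)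
  then show ?thesis
    unfolding gauss_def wave_def exp_add[symmetric] exp_sum[OF finite_Basis, symmetric] by simp
qed

lemma integrable_gauss_1d:
  assumes "Re a > 0"
  shows "integrable lborel (\<lambda>s. exp (- a * (of_real s)\<^sup>2) * exp (- \<i> * of_real (b * s)))"
proof (rule Bochner_Integration.integrable_bound[OF integrable_gauss_real[OF assms]])
  show "AE s in lborel. norm (exp (- a * (of_real s)\<^sup>2) * exp (- \<i> * of_real (b * s))) \<le> norm (exp (- Re a * s\<^sup>2))"
    by (simp add: norm_mult flip: of_real_power)
qed simp

lemma
  fixes \<eta> :: "'a::euclidean_space"
  assumes a: "Re a > 0"
  shows integrable_gauss_wave: "integrable lborel (\<lambda>x. gauss a x * wave \<eta> x)"
    and gauss_fourier: "(LINT x|lborel. gauss a x * wave \<eta> x) =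
      csqrt (of_real pi / a) ^ DIM('a) * gauss (1 / (4 * a)) \<eta>"
proof -
  show "integrable lborel (\<lambda>x. gauss a x * wave \<eta> x)"
    unfolding gauss_wave_prod by (rule integrable_lborel_prod[OF integrable_gauss_1d[OF a]])
  have "(LINT x|lborel. gauss a x * wave \<eta> x) =
      (\<Prod>b\<in>Basis. csqrt (of_real pi / a) * exp (- (of_real (\<eta> \<bullet> b))\<^sup>2 / (4 * a)))"
    unfolding gauss_wave_prod
    by (subst integral_lborel_prod[OF integrable_gauss_1d[OF a]]) (simp only: gauss_fourier_1d[OF a])
  also have "\<dots> = csqrt (of_real pi / a) ^ DIM('a) * gauss (1 / (4 * a)) \<eta>"
  proof -
    have "(\<Sum>b\<in>Basis. - (of_real (\<eta> \<bullet> b))\<^sup>2 / (4 * a)) = - (1 / (4 * a)) * of_real (\<eta> \<bullet> \<eta>)"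
      unfolding euclidean_inner[of \<eta> \<eta>]
      by (simp add: power2_eq_square sum_divide_distrib sum_negf)
    then show ?thesis
      by (simp only: gauss_def prod.distrib prod_constant exp_sum[OF finite_Basis, symmetric])
  qed
  finally show "(LINT x|lborel. gauss a x * wave \<eta> x) =
      csqrt (of_real pi / a) ^ DIM('a) * gauss (1 / (4 * a)) \<eta>" .
qed

lemma integrable_gauss:
  assumes "Re a > 0"
  shows "integrable lborel (gauss a :: 'a::euclidean_space \<Rightarrow> complex)"
  using integrable_gauss_wave[OF assms, of 0] by (simp add: wave_def)

section \<open>Fourier uniqueness\<close>

lemma integrable_cmult_iff:
  fixes f :: "'a \<Rightarrow> complex"
  assumes "c \<noteq> 0"
  shows "integrable M (\<lambda>x. c * f x) \<longleftrightarrow> integrable M f"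
  using integrable_mult_right[of c M f] integrable_mult_right[of "1 / c" M "\<lambda>x. c * f x"] assms by auto

lemma
  fixes f :: "'a::euclidean_space \<Rightarrow> complex" and c :: real
  assumes c: "c \<noteq> 0" and [measurable]: "f \<in> borel_measurable borel"
  shows lborel_integral_affine: "(LINT x|lborel. f x) = of_real (\<bar>c\<bar> ^ DIM('a)) * (LINT x|lborel. f (t + c *\<^sub>R x))"
    and lborel_integrable_affine: "integrable lborel (\<lambda>x. f (t + c *\<^sub>R x)) \<longleftrightarrow> integrable lborel f"
proof -
  have meas: "(\<lambda>x. t + c *\<^sub>R x) \<in> measurable lborel (borel :: 'a measure)" by simp
  show "(LINT x|lborel. f x) = of_real (\<bar>c\<bar> ^ DIM('a)) * (LINT x|lborel. f (t + c *\<^sub>R x))"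
    by (subst lborel_affine[OF c, of t])
      (simp add: integral_density integral_distr scaleR_conv_of_real)
  show "integrable lborel (\<lambda>x. f (t + c *\<^sub>R x)) \<longleftrightarrow> integrable lborel f"
    using c by (subst (2) lborel_affine[OF c, of t])
      (simp add: integrable_density integrable_distr_eq scaleR_conv_of_real integrable_cmult_iff flip: of_real_power)
qed

text \<open>Boundedness of the kernel supplies the integrable majorant
  \<open>C * norm (v x) * norm (w y)\<close>.\<close>

lemma fubini_kernel:
  fixes v w :: "'a::euclidean_space \<Rightarrow> complex" and K :: "'a \<Rightarrow> 'a \<Rightarrow> complex"
  assumes v: "integrable lborel v" and w: "integrable lborel w"
    and K[measurable]: "(\<lambda>(x, y). K x y) \<in> borel_measurable (borel \<Otimes>\<^sub>M borel)"
    and bound: "\<And>x y. norm (K x y) \<le> C"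
  shows "(LINT x|lborel. v x * (LINT y|lborel. w y * K x y)) = (LINT y|lborel. w y * (LINT x|lborel. v x * K x y))"
proof -
  have [measurable]: "v \<in> borel_measurable borel" "w \<in> borel_measurable borel"
    using v w borel_measurable_integrable by force+
  have Kx[measurable]: "K x \<in> borel_measurable borel" for x
    using measurable_compose[OF measurable_Pair1'[of x borel borel] K] by simp
  have "C \<ge> 0" using order_trans[OF norm_ge_zero bound] .
  have intK: "integrable lborel (\<lambda>y. w y * K x y)" for x
  proof (rule Bochner_Integration.integrable_bound)
    show "integrable lborel (\<lambda>y. of_real C * w y)" using w by simp
    show "AE y in lborel. norm (w y * K x y) \<le> norm (of_real C * w y)"
      using bound[of x] \<open>C \<ge> 0\<close> by (auto simp: norm_mult mult.commute[of C] intro!: mult_left_mono)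
  qed simp
  have "integrable (lborel \<Otimes>\<^sub>M lborel) (\<lambda>(x, y). v x * w y * K x y)"
  proof (rule lborel_pair.Fubini_integrable)
    show "AE x in lborel. integrable lborel (\<lambda>y. case (x, y) of (x, y) \<Rightarrow> v x * w y * K x y)"
      using integrable_mult_right[OF intK] by (simp add: mult.assoc)
    show "integrable lborel (\<lambda>x. LINT y|lborel. norm (case (x, y) of (x, y) \<Rightarrow> v x * w y * K x y))"
    proof (rule Bochner_Integration.integrable_bound)
      show "integrable lborel (\<lambda>x. of_real (C * (LINT y|lborel. norm (w y))) * v x)" using v by simp
      show "AE x in lborel. norm (LINT y|lborel. norm (case (x, y) of (x, y) \<Rightarrow> v x * w y * K x y))
          \<le> norm (of_real (C * (LINT y|lborel. norm (w y))) * v x)"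
      proof (rule AE_I2)
        fix x
        have "(LINT y|lborel. norm (v x * w y * K x y)) \<le> (LINT y|lborel. norm (v x) * C * norm (w y))"
        proof (rule integral_mono)
          show "integrable lborel (\<lambda>y. norm (v x * w y * K x y))"
            using integrable_norm[OF integrable_mult_right[OF intK]] by (simp add: mult.assoc)
          show "integrable lborel (\<lambda>y. norm (v x) * C * norm (w y))" using w by simp
          show "norm (v x * w y * K x y) \<le> norm (v x) * C * norm (w y)" for y
            using mult_left_mono[OF bound[of x y], of "norm (v x) * norm (w y)"] by (simp add: norm_mult mult_ac)
        qed
        also have "\<dots> = C * (LINT y|lborel. norm (w y)) * norm (v x)" by simp
        also have "\<dots> = norm (of_real (C * (LINT y|lborel. norm (w y))) * v x)"
          using \<open>C \<ge> 0\<close> by (simp add: norm_mult)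
        finally show "norm (LINT y|lborel. norm (case (x, y) of (x, y) \<Rightarrow> v x * w y * K x y))
          \<le> norm (of_real (C * (LINT y|lborel. norm (w y))) * v x)" by simp
      qed
    qed measurable
  qed measurable
  from lborel_pair.Fubini_integral[OF this]
  have "(LINT y|lborel. LINT x|lborel. v x * w y * K x y) = (LINT x|lborel. LINT y|lborel. v x * w y * K x y)" .
  moreover have "(LINT x|lborel. v x * w y * K x y) = w y * (LINT x|lborel. v x * K x y)" for y
  proof -
    have "(\<lambda>x. v x * w y * K x y) = (\<lambda>x. w y * (v x * K x y))" by (simp add: fun_eq_iff)
    then show ?thesis by (simp only: integral_mult_right_zero)
  qed
  moreover have "(LINT y|lborel. v x * w y * K x y) = v x * (LINT y|lborel. w y * K x y)" for x
    by (simp add: mult.assoc)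
  ultimately show ?thesis by simp
qed

text \<open>Convolution with a shrinking Gaussian, substituted so that the kernel is fixed and the
  dilation sits in the continuous factor; \<open>sqrt pi ^ DIM('a)\<close> is the mass of the
  kernel.\<close>

lemma gauss_average_tendsto:
  fixes \<phi> :: "'a::euclidean_space \<Rightarrow> complex"
  assumes cont: "continuous_on UNIV \<phi>" and bd: "\<And>x. norm (\<phi> x) \<le> C" and e: "e \<longlonglongrightarrow> (0::real)"
  shows "(\<lambda>n. LINT y|lborel. gauss 1 y * \<phi> (x + e n *\<^sub>R y)) \<longlonglongrightarrow> of_real (sqrt pi ^ DIM('a)) * \<phi> x"
proof -
  have [measurable]: "\<phi> \<in> borel_measurable borel"
    using cont by (rule borel_measurable_continuous_onI)
  have "(\<lambda>n. LINT y|lborel. gauss 1 y * \<phi> (x + e n *\<^sub>R y)) \<longlonglongrightarrow> (LINT y|lborel. gauss 1 (y::'a) * \<phi> x)"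
  proof (rule integral_dominated_convergence)
    show "integrable lborel (\<lambda>y::'a. norm (gauss 1 y) * C)" 
      by (intro integrable_mult_left integrable_norm integrable_gauss) simp
    show "AE y in lborel. (\<lambda>n. gauss 1 y * \<phi> (x + e n *\<^sub>R y)) \<longlonglongrightarrow> gauss 1 y * \<phi> x"
    proof (rule AE_I2)
      fix y :: 'a
      have "(\<lambda>n. x + e n *\<^sub>R y) \<longlonglongrightarrow> x + 0 *\<^sub>R y" by (intro tendsto_intros e)
      then have "(\<lambda>n. \<phi> (x + e n *\<^sub>R y)) \<longlonglongrightarrow> \<phi> x"
        using cont by (auto intro: isCont_tendsto_compose simp: continuous_on_eq_continuous_at)
      then show "(\<lambda>n. gauss 1 y * \<phi> (x + e n *\<^sub>R y)) \<longlonglongrightarrow> gauss 1 y * \<phi> x"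
        by (intro tendsto_intros)
    qed
    show "AE y in lborel. norm (gauss 1 y * \<phi> (x + e n *\<^sub>R y)) \<le> norm (gauss 1 y) * C" for n
      using bd by (auto simp: norm_mult intro!: mult_left_mono)
  qed auto
  also have "(LINT y|lborel. gauss 1 (y::'a) * \<phi> x) = of_real (sqrt pi ^ DIM('a)) * \<phi> x"
    using gauss_fourier[of 1 "0::'a"] by (simp add: wave_def gauss_def)
  finally show ?thesis .
qed

text \<open>A Gaussian is a superposition of waves, so \<open>v\<close> is orthogonal to every
  translated Gaussian and hence, by Fubini, to all Gaussian averages of \<open>\<phi>\<close>. These
  converge boundedly to a multiple of \<open>\<phi>\<close>.\<close>

theorem fourier_uniqueness:
  fixes v \<phi> :: "'a::euclidean_space \<Rightarrow> complex"
  assumes v: "integrable lborel v" and zero: "\<And>\<eta>. (LINT x|lborel. v x * wave \<eta> x) = 0"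
    and \<phi>: "continuous_on UNIV \<phi>" "integrable lborel \<phi>" "\<And>x. norm (\<phi> x) \<le> C"
  shows "(LINT x|lborel. v x * \<phi> x) = 0"
proof -
  have [measurable]: "v \<in> borel_measurable borel" "\<phi> \<in> borel_measurable borel"
    using v \<phi>(2) borel_measurable_integrable by force+
  have kernel: "(LINT x|lborel. v x * gauss (of_real s) (x - z)) = 0" if s: "s > 0" for s :: real and z
  proof -
    \<comment> \<open>The width for which the transform of the Gaussian is a multiple of
      \<open>gauss s\<close>.\<close>
    define \<tau> where "\<tau> = 1 / (4 * s)"
    have \<tau>: "\<tau> > 0" "1 / (4 * \<tau>) = s" using s by (auto simp: \<tau>_def)
    define k where "k = csqrt (of_real pi / of_real \<tau>) ^ DIM('a)"
    have k: "k \<noteq> 0" using \<tau> by (simp add: k_def)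
    have "(LINT y|lborel. gauss (of_real \<tau>) y * wave (x - z) y) = k * gauss (of_real s) (x - z)" for x
      using gauss_fourier[of "of_real \<tau>" "x - z"] \<tau> unfolding k_def
      by (simp add: \<tau>(2)[symmetric])
    then have "k * (LINT x|lborel. v x * gauss (of_real s) (x - z)) =
        (LINT x|lborel. v x * (LINT y|lborel. gauss (of_real \<tau>) y * wave (x - z) y))"
      by (simp add: mult.left_commute)
    also have "\<dots> = (LINT y|lborel. gauss (of_real \<tau>) y * (LINT x|lborel. v x * wave (x - z) y))"
    proof (rule fubini_kernel[OF v _ _ order_refl[THEN order_trans]])
      show "integrable lborel (gauss (of_real \<tau>) :: 'a \<Rightarrow> complex)"
        using \<tau> by (intro integrable_gauss) simp
      show "(\<lambda>(x, y). wave (x - z) y) \<in> borel_measurable (borel \<Otimes>\<^sub>M borel)"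
        unfolding wave_def by measurable
      show "norm (wave (x - z) y) \<le> 1" for x y by simp
    qed
    also have "(\<lambda>y. LINT x|lborel. v x * wave (x - z) y) = (\<lambda>y. 0)"
    proof
      fix y
      \<comment> \<open>As a function of \<open>x\<close> the kernel is a wave of frequency
        \<open>y\<close> times a constant, so \<open>zero\<close> applies.\<close>
      have "wave (x - z) y = wave y x * wave z (- y)" for x
        by (simp add: wave_def inner_diff_left inner_commute[of y] flip: exp_add) (simp add: algebra_simps inner_commute)
      then show "(LINT x|lborel. v x * wave (x - z) y) = 0"
        using zero[of y] by (simp flip: mult.assoc)
    qed
    finally show ?thesis using k by simp
  qed
  define e where "e = (\<lambda>n. 1 / real (Suc n))"
  have e: "e n > 0" for n by (simp add: e_def)
  have lim: "e \<longlonglongrightarrow> 0" unfolding e_def by (rule LIMSEQ_Suc[OF lim_1_over_n])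
  define \<Phi> where "\<Phi> = (\<lambda>n x. LINT y|lborel. gauss 1 y * \<phi> (x + e n *\<^sub>R y))"
  \<comment> \<open>Substituting \<open>z = x + e n *\<^sub>R y\<close> moves the dilation into the
    kernel, the form in which Fubini and \<open>kernel\<close> apply.\<close>
  have \<Phi>: "\<Phi> n x = of_real ((1 / e n) ^ DIM('a)) * (LINT z|lborel. \<phi> z * gauss (of_real (1 / (e n)\<^sup>2)) (x - z))" for n x
  proof -
    have "(LINT y|lborel. gauss 1 y * \<phi> (x + e n *\<^sub>R y)) = of_real (\<bar>1 / e n\<bar> ^ DIM('a)) *
      (LINT z|lborel. gauss 1 (- (1 / e n) *\<^sub>R x + (1 / e n) *\<^sub>R z) * \<phi> (x + e n *\<^sub>R (- (1 / e n) *\<^sub>R x + (1 / e n) *\<^sub>R z)))"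
      using e[of n] by (intro lborel_integral_affine) auto
    also have "\<dots> = of_real ((1 / e n) ^ DIM('a)) * (LINT z|lborel. \<phi> z * gauss (of_real (1 / (e n)\<^sup>2)) (x - z))"
    proof -
      have "gauss 1 (- (1 / e n) *\<^sub>R x + (1 / e n) *\<^sub>R z) = gauss (of_real (1 / (e n)\<^sup>2)) (x - z)" for z
      proof -
        have "- (1 / e n) *\<^sub>R x + (1 / e n) *\<^sub>R z = (- 1 / e n) *\<^sub>R (x - z)"
          by (simp add: scaleR_diff_right)
        then show ?thesis by (simp add: gauss_def power2_eq_square)
      qed
      moreover have "x + e n *\<^sub>R (- (1 / e n) *\<^sub>R x + (1 / e n) *\<^sub>R z) = z" for z
        using e[of n] by (simp add: scaleR_add_right scaleR_diff_right)
      ultimately show ?thesis using e[of n] by (simp add: mult.commute)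
    qed
    finally show ?thesis by (simp add: \<Phi>_def)
  qed
  have zero': "(LINT x|lborel. v x * \<Phi> n x) = 0" for n
  proof -
    have "(LINT x|lborel. v x * (LINT z|lborel. \<phi> z * gauss (of_real (1 / (e n)\<^sup>2)) (x - z))) =
       (LINT z|lborel. \<phi> z * (LINT x|lborel. v x * gauss (of_real (1 / (e n)\<^sup>2)) (x - z)))"
    proof (rule fubini_kernel[OF v \<phi>(2)])
      show "(\<lambda>(x, y). gauss (of_real (1 / (e n)\<^sup>2)) (x - y)) \<in> borel_measurable (borel \<Otimes>\<^sub>M (borel :: 'a measure))"
        by measurable
      show "norm (gauss (of_real (1 / (e n)\<^sup>2)) (x - y)) \<le> 1" for x y :: 'a
        by (simp add: norm_gauss)
    qed
    also have "\<dots> = 0" using e[of n] by (subst kernel) auto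
    finally show ?thesis
      unfolding \<Phi> mult.left_commute[of "v _"] integral_mult_right_zero by simp
  qed
  have "(\<lambda>n. LINT x|lborel. v x * \<Phi> n x) \<longlonglongrightarrow> (LINT x|lborel. v x * (of_real (sqrt pi ^ DIM('a)) * \<phi> x))"
  proof (rule integral_dominated_convergence)
    define N where "N = (LINT y|lborel. norm (gauss 1 (y::'a)) * C)"
    have intN: "integrable lborel (\<lambda>y::'a. norm (gauss 1 y) * C)" 
      by (intro integrable_mult_left integrable_norm integrable_gauss) simp
    have "norm (\<Phi> n x) \<le> N" for n x
      unfolding \<Phi>_def N_def
    proof (rule Bochner_Integration.integral_norm_bound_integral[OF _ intN])
      show le: "norm (gauss 1 y * \<phi> (x + e n *\<^sub>R y)) \<le> norm (gauss 1 y) * C" for y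
        using \<phi>(3) by (auto simp: norm_mult intro!: mult_left_mono)
      show "integrable lborel (\<lambda>y. gauss 1 y * \<phi> (x + e n *\<^sub>R y))"
        by (rule Bochner_Integration.integrable_bound[OF intN])
          (auto intro!: AE_I2 order_trans[OF le])
    qed
    then show "AE x in lborel. norm (v x * \<Phi> n x) \<le> norm (v x) * N" for n
      by (auto simp: norm_mult intro!: mult_left_mono)
    show "integrable lborel (\<lambda>x. norm (v x) * N)" using v by simp
    show "AE x in lborel. (\<lambda>n. v x * \<Phi> n x) \<longlonglongrightarrow> v x * (of_real (sqrt pi ^ DIM('a)) * \<phi> x)"
      unfolding \<Phi>_def by (intro AE_I2 tendsto_intros gauss_average_tendsto[OF \<phi>(1,3) lim])
    show "(\<lambda>x. v x * \<Phi> n x) \<in> borel_measurable lborel" for n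
      unfolding \<Phi>_def by measurable
  qed measurable
  then have "(LINT x|lborel. v x * (of_real (sqrt pi ^ DIM('a)) * \<phi> x)) = 0"
    unfolding zero' by (simp add: LIMSEQ_const_iff)
  then show ?thesis
    unfolding mult.left_commute[of "v _"] integral_mult_right_zero by simp
qed

no_notation fps_nth (infixl "$" 75)

section \<open>Schwartz functions\<close>

definition rapid :: "('a::real_normed_vector \<Rightarrow> complex) \<Rightarrow> bool" where
  "rapid f \<longleftrightarrow> (\<forall>N. \<exists>C. \<forall>x. (1 + norm x) ^ N * norm (f x) \<le> C)"

lemma rapidI:
  assumes "\<And>N. \<exists>C. \<forall>x. (1 + norm x) ^ N * norm (f x) \<le> C"
  shows "rapid f"
  using assms by (simp add: rapid_def)

lemma rapidE:
  assumes "rapid f"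
  obtains C where "C \<ge> 0" "\<And>x. (1 + norm x) ^ N * norm (f x) \<le> C"
proof -
  obtain C where "\<And>x. (1 + norm x) ^ N * norm (f x) \<le> C"
    using assms by (auto simp: rapid_def)
  then show thesis
    by (intro that[of "max C 0"]) (auto intro: max.coboundedI1)
qed

lemma rapid_add:
  assumes "rapid f" "rapid g"
  shows "rapid (\<lambda>x. f x + g x)"
proof (rule rapidI)
  fix N
  obtain C where C: "\<And>x. (1 + norm x) ^ N * norm (f x) \<le> C" using rapidE[OF assms(1)] by blast
  obtain D where D: "\<And>x. (1 + norm x) ^ N * norm (g x) \<le> D" using rapidE[OF assms(2)] by blast
  have "(1 + norm x) ^ N * norm (f x + g x) \<le> C + D" for x
  proof -
    have "(1 + norm x) ^ N * norm (f x + g x) \<le> (1 + norm x) ^ N * (norm (f x) + norm (g x))"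
      by (intro mult_left_mono norm_triangle_ineq) auto
    then show ?thesis using C[of x] D[of x] by (simp add: ring_distribs)
  qed
  then show "\<exists>C. \<forall>x. (1 + norm x) ^ N * norm (f x + g x) \<le> C" by blast
qed

lemma rapid_poly_mult:
  assumes f: "rapid f" and g: "\<And>x. norm (g x) \<le> K * (1 + norm x) ^ n"
  shows "rapid (\<lambda>x. g x * f x)"
proof (rule rapidI)
  fix N
  obtain C where C: "C \<ge> 0" "\<And>x. (1 + norm x) ^ (n + N) * norm (f x) \<le> C"
    using rapidE[OF f] by blast
  have "K \<ge> 0" using order_trans[OF norm_ge_zero g[of 0]] by simp
  have "(1 + norm x) ^ N * norm (g x * f x) \<le> K * C" for x
  proof -
    have "(1 + norm x) ^ N * norm (g x * f x) \<le> (1 + norm x) ^ N * (K * (1 + norm x) ^ n * norm (f x))"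
      unfolding norm_mult by (intro mult_left_mono mult_right_mono g) auto
    also have "\<dots> = K * ((1 + norm x) ^ (n + N) * norm (f x))" by (simp add: power_add mult_ac)
    also have "\<dots> \<le> K * C" by (intro mult_left_mono C \<open>K \<ge> 0\<close>)
    finally show ?thesis .
  qed
  then show "\<exists>C. \<forall>x. (1 + norm x) ^ N * norm (g x * f x) \<le> C" by blast
qed

lemma rapid_bounded_mult:
  assumes "rapid f" "\<And>x. norm (g x) \<le> K"
  shows "rapid (\<lambda>x. g x * f x)"
  using assms by (intro rapid_poly_mult[where n = 0 and K = K]) auto

lemma rapid_scale:
  assumes f: "rapid f" and c: "c \<noteq> 0"
  shows "rapid (\<lambda>x. f (c *\<^sub>R x))"
proof (rule rapidI)
  fix N
  obtain C where C: "C \<ge> 0" "\<And>x. (1 + norm x) ^ N * norm (f x) \<le> C" using rapidE[OF f] by blast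
  have "(1 + norm x) ^ N * norm (f (c *\<^sub>R x)) \<le> (1 + 1 / \<bar>c\<bar>) ^ N * C" for x
  proof -
    have "1 + norm x \<le> (1 + 1 / \<bar>c\<bar>) * (1 + norm (c *\<^sub>R x))"
      using c by (simp add: field_simps)
    then have "(1 + norm x) ^ N \<le> ((1 + 1 / \<bar>c\<bar>) * (1 + norm (c *\<^sub>R x))) ^ N"
      by (intro power_mono) auto
    then have "(1 + norm x) ^ N * norm (f (c *\<^sub>R x)) \<le>
        (1 + 1 / \<bar>c\<bar>) ^ N * ((1 + norm (c *\<^sub>R x)) ^ N * norm (f (c *\<^sub>R x)))"
      by (simp add: mult_right_mono power_mult_distrib flip: mult.assoc)
    also have "\<dots> \<le> (1 + 1 / \<bar>c\<bar>) ^ N * C" by (intro mult_left_mono C) auto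
    finally show ?thesis .
  qed
  then show "\<exists>C. \<forall>x. (1 + norm x) ^ N * norm (f (c *\<^sub>R x)) \<le> C" by blast
qed

section \<open>Iterated derivatives and closure properties of the Schwartz class\<close>

lemma iter_deriv_simps [simp]:
  "iter_deriv [] f = f"
  "iter_deriv (j # js) f = partial_deriv j (iter_deriv js f)"
  "iter_deriv (js @ [j]) f = iter_deriv js (partial_deriv j f)"
  by (simp_all add: iter_deriv_def)

lemma schwartz_iff:
  "\<phi> \<in> schwartz \<longleftrightarrow> (\<forall>js. (\<forall>x. iter_deriv js \<phi> differentiable (at x)) \<and> rapid (iter_deriv js \<phi>))"
  by (auto simp: schwartz_def smooth_fun_def rapid_def)

text \<open>Stability under a single partial derivative carries over to all iterated ones. Closure
  proofs thus reduce to finding a stable class and applying one product rule, in place of a Leibniz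
  formula for higher derivatives.\<close>

lemma schwartz_coinduct:
  assumes "f \<in> A"
    and diff: "\<And>f x. f \<in> A \<Longrightarrow> f differentiable (at x)"
    and rapid: "\<And>f. f \<in> A \<Longrightarrow> rapid f"
    and deriv: "\<And>f j. f \<in> A \<Longrightarrow> partial_deriv j f \<in> A"
  shows "f \<in> schwartz"
proof -
  have "iter_deriv js f \<in> A" for js
    by (induction js) (use assms in auto)
  then show ?thesis using diff rapid by (auto simp: schwartz_iff)
qed

lemma schwartz_differentiable: "\<phi> \<in> schwartz \<Longrightarrow> \<phi> differentiable (at x)"
  unfolding schwartz_iff by (metis iter_deriv_simps(1))

lemma schwartz_rapid: "\<phi> \<in> schwartz \<Longrightarrow> rapid \<phi>"
  unfolding schwartz_iff by (metis iter_deriv_simps(1))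

lemma schwartz_partial_deriv: "\<phi> \<in> schwartz \<Longrightarrow> partial_deriv j \<phi> \<in> schwartz"
  unfolding schwartz_iff by (metis iter_deriv_simps(3))

lemma partial_deriv_eq: "(f has_derivative f') (at x) \<Longrightarrow> partial_deriv j f x = f' (axis j 1)"
  by (simp add: partial_deriv_def frechet_derivative_at[symmetric])

lemma partial_deriv_add:
  assumes "f differentiable (at x)" "g differentiable (at x)"
  shows "partial_deriv j (\<lambda>x. f x + g x) x = partial_deriv j f x + partial_deriv j g x"
  using has_derivative_add[OF assms[unfolded frechet_derivative_works]]
  by (subst partial_deriv_eq) (auto simp: partial_deriv_def)

lemma partial_deriv_mult:
  assumes "f differentiable (at x)" "g differentiable (at x)"
  shows "partial_deriv j (\<lambda>x. f x * g x) x = f x * partial_deriv j g x + partial_deriv j f x * g x"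
  using has_derivative_mult[OF assms[unfolded frechet_derivative_works]]
  by (subst partial_deriv_eq) (auto simp: partial_deriv_def)

lemma partial_deriv_const [simp]: "partial_deriv j (\<lambda>_. c) = (\<lambda>_. 0)"
  by (rule ext, subst partial_deriv_eq) (auto intro: has_derivative_const)

lemma has_derivative_coord:
  "((\<lambda>x. of_real (x $ k)) has_derivative (\<lambda>h. of_real (h $ k) :: complex)) (at x)"
  by (intro bounded_linear_imp_has_derivative bounded_linear_compose[OF bounded_linear_of_real]
      bounded_linear_vec_nth)

lemma coord_differentiable: "(\<lambda>x. of_real (x $ k) :: complex) differentiable (at x)"
  by (rule differentiableI[OF has_derivative_coord])

lemma partial_deriv_coord: "partial_deriv j (\<lambda>x. of_real (x $ k)) = (\<lambda>_. if j = k then 1 else 0)"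
  by (rule ext, subst partial_deriv_eq[OF has_derivative_coord]) (simp add: axis_def)

lemma has_derivative_gauss:
  fixes x :: "'a::real_inner"
  shows "(gauss a has_derivative (\<lambda>h. - 2 * a * of_real (x \<bullet> h) * gauss a x)) (at x)"
proof -
  have "((\<lambda>x. - a * of_real (x \<bullet> x)) has_derivative (\<lambda>h. - a * of_real (x \<bullet> h + h \<bullet> x))) (at x)"
    by (intro has_derivative_mult_right has_derivative_of_real has_derivative_inner has_derivative_ident)
  also have "(\<lambda>h. - a * of_real (x \<bullet> h + h \<bullet> x)) = (\<lambda>h. - 2 * a * of_real (x \<bullet> h))"
    by (auto simp: fun_eq_iff inner_commute)
  finally have "((\<lambda>x. - a * of_real (x \<bullet> x)) has_derivative (\<lambda>h. - 2 * a * of_real (x \<bullet> h))) (at x)" .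
  from has_derivative_compose[OF this DERIV_exp[unfolded has_field_derivative_def]] show ?thesis
    unfolding gauss_def[abs_def] by (simp only: mult.commute[of "exp _"])
qed

lemma gauss_differentiable: "gauss a differentiable (at x)"
  by (rule differentiableI[OF has_derivative_gauss])

lemma partial_deriv_gauss: "partial_deriv j (gauss a) x = - 2 * a * of_real (x $ j) * gauss a x"
  by (subst partial_deriv_eq[OF has_derivative_gauss]) (simp add: inner_axis)

lemma has_derivative_wave:
  fixes x :: "'a::real_inner"
  shows "(wave \<eta> has_derivative (\<lambda>h. - \<i> * of_real (\<eta> \<bullet> h) * wave \<eta> x)) (at x)"
proof -
  have "((\<lambda>x. - \<i> * of_real (\<eta> \<bullet> x)) has_derivative (\<lambda>h. - \<i> * of_real (\<eta> \<bullet> h))) (at x)"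
    by (intro has_derivative_mult_right has_derivative_of_real has_derivative_inner_right has_derivative_ident)
  from has_derivative_compose[OF this DERIV_exp[unfolded has_field_derivative_def]] show ?thesis
    unfolding wave_def[abs_def]
    by (simp only: mult.commute[of "exp _"])
qed

lemma wave_differentiable: "wave \<eta> differentiable (at x)"
  by (rule differentiableI[OF has_derivative_wave])

lemma partial_deriv_wave: "partial_deriv j (wave \<eta>) x = - \<i> * of_real (\<eta> $ j) * wave \<eta> x"
  by (subst partial_deriv_eq[OF has_derivative_wave]) (simp add: inner_axis)

lemma schwartz_add:
  assumes "\<phi> \<in> schwartz" "\<psi> \<in> schwartz"
  shows "(\<lambda>x. \<phi> x + \<psi> x) \<in> schwartz"
proof (rule schwartz_coinduct[where A = "{\<lambda>x. \<phi> x + \<psi> x | \<phi> \<psi>. \<phi> \<in> schwartz \<and> \<psi> \<in> schwartz}"])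
  fix f :: "real^'a \<Rightarrow> complex" and j 
  assume "f \<in> {\<lambda>x. \<phi> x + \<psi> x | \<phi> \<psi>. \<phi> \<in> schwartz \<and> \<psi> \<in> schwartz}"
  then obtain \<phi> \<psi> where f: "f = (\<lambda>x. \<phi> x + \<psi> x)" and s: "\<phi> \<in> schwartz" "\<psi> \<in> schwartz" by blast
  show "rapid f" unfolding f by (intro rapid_add schwartz_rapid s)
  show "f differentiable (at x)" for x
    unfolding f by (intro differentiable_add schwartz_differentiable s)
  have "partial_deriv j f = (\<lambda>x. partial_deriv j \<phi> x + partial_deriv j \<psi> x)"
    unfolding f by (rule ext) (intro partial_deriv_add schwartz_differentiable s)
  then show "partial_deriv j f \<in> {\<lambda>x. \<phi> x + \<psi> x | \<phi> \<psi>. \<phi> \<in> schwartz \<and> \<psi> \<in> schwartz}"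
    using s schwartz_partial_deriv by blast
qed (use assms in blast)

lemma schwartz_cmult:
  assumes "\<phi> \<in> schwartz"
  shows "(\<lambda>x. c * \<phi> x) \<in> schwartz"
proof (rule schwartz_coinduct[where A = "{\<lambda>x. c * \<phi> x | \<phi>. \<phi> \<in> schwartz}"])
  fix f :: "real^'a \<Rightarrow> complex" and j 
  assume "f \<in> {\<lambda>x. c * \<phi> x | \<phi>. \<phi> \<in> schwartz}"
  then obtain \<phi> where f: "f = (\<lambda>x. c * \<phi> x)" and s: "\<phi> \<in> schwartz" by blast
  show "rapid f" unfolding f by (intro rapid_bounded_mult[where K = "norm c"] schwartz_rapid s) simp
  show "f differentiable (at x)" for x
    unfolding f by (intro differentiable_mult differentiable_const schwartz_differentiable s)
  have "partial_deriv j f x = c * partial_deriv j \<phi> x" for x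
    unfolding f by (subst partial_deriv_mult) (auto intro: schwartz_differentiable s)
  then show "partial_deriv j f \<in> {\<lambda>x. c * \<phi> x | \<phi>. \<phi> \<in> schwartz}"
    using s schwartz_partial_deriv by (auto intro!: exI[of _ "partial_deriv j \<phi>"])
qed (use assms in blast)

lemma norm_coord_le: "norm (of_real (x $ k) :: complex) \<le> 1 * (1 + norm x) ^ 1"
  using component_le_norm_cart[of x k] by simp

lemma schwartz_coord_mult:
  assumes "\<phi> \<in> schwartz"
  shows "(\<lambda>x. of_real (x $ k) * \<phi> x) \<in> schwartz"
\<comment> \<open>The summand \<open>\<psi>\<close> makes the class stable: differentiating
  \<open>x $ k\<close> leaves an extra multiple of \<open>\<phi>\<close>.\<close>
proof (rule schwartz_coinduct[where A = "{\<lambda>x. of_real (x $ k) * \<phi> x + \<psi> x | \<phi> \<psi>. \<phi> \<in> schwartz \<and> \<psi> \<in> schwartz}"])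
  fix f :: "real^'a \<Rightarrow> complex" and j 
  assume "f \<in> {\<lambda>x. of_real (x $ k) * \<phi> x + \<psi> x | \<phi> \<psi>. \<phi> \<in> schwartz \<and> \<psi> \<in> schwartz}"
  then obtain \<phi> \<psi> where f: "f = (\<lambda>x. of_real (x $ k) * \<phi> x + \<psi> x)" and s: "\<phi> \<in> schwartz" "\<psi> \<in> schwartz" by blast
  note diff = schwartz_differentiable[OF s(1)] schwartz_differentiable[OF s(2)] coord_differentiable
  show "rapid f"
    unfolding f by (intro rapid_add rapid_poly_mult[OF _ norm_coord_le] schwartz_rapid s)
  show "f differentiable (at x)" for x
    unfolding f by (intro differentiable_add differentiable_mult diff)
  have eq: "partial_deriv j f = (\<lambda>x. of_real (x $ k) * partial_deriv j \<phi> x +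
      ((if j = k then 1 else 0) * \<phi> x + partial_deriv j \<psi> x))"
    unfolding f by (rule ext, subst partial_deriv_add, intro differentiable_mult diff, rule diff,
        subst partial_deriv_mult, rule diff, rule diff) (simp add: partial_deriv_coord)
  have memb: "(\<lambda>x. of_real (x $ k) * \<phi> x + \<psi> x) \<in> {\<lambda>x. of_real (x $ k) * \<phi> x + \<psi> x | \<phi> \<psi>. \<phi> \<in> schwartz \<and> \<psi> \<in> schwartz}"
    if "\<phi> \<in> schwartz" "\<psi> \<in> schwartz" for \<phi> \<psi> :: "real^'a \<Rightarrow> complex" using that by blast
  have "(\<lambda>x. (if j = k then 1 else 0) * \<phi> x + partial_deriv j \<psi> x) \<in> schwartz"
    by (intro schwartz_add schwartz_cmult schwartz_partial_deriv s)
  then show "partial_deriv j f \<in> {\<lambda>x. of_real (x $ k) * \<phi> x + \<psi> x | \<phi> \<psi>. \<phi> \<in> schwartz \<and> \<psi> \<in> schwartz}"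
    unfolding eq by (rule memb[OF schwartz_partial_deriv[OF s(1)]])
next
  have "(\<lambda>x. 0 * \<phi> x) \<in> schwartz" by (rule schwartz_cmult[OF assms])
  then show "(\<lambda>x. of_real (x $ k) * \<phi> x) \<in> {\<lambda>x. of_real (x $ k) * \<phi> x + \<psi> x | \<phi> \<psi>. \<phi> \<in> schwartz \<and> \<psi> \<in> schwartz}"
    using assms by (intro CollectI exI[of _ \<phi>] exI[of _ "\<lambda>_. 0"]) simp
qed

text \<open>If the logarithmic derivatives of \<open>g\<close> are affine in the coordinates, then a
  derivative of \<open>g \<phi>\<close> is again \<open>g\<close> times a Schwartz function.
  Gaussians (chirps included) and waves are the instances.\<close>

lemma schwartz_exp_mult:
  fixes g :: "real^'m::finite \<Rightarrow> complex"
  assumes \<phi>: "\<phi> \<in> schwartz" and diff: "\<And>x. g differentiable (at x)" and bd: "\<And>x. norm (g x) \<le> K"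
    and deriv: "\<And>j x. partial_deriv j g x = (a j * of_real (x $ j) + b j) * g x"
  shows "(\<lambda>x. g x * \<phi> x) \<in> schwartz"
proof (rule schwartz_coinduct[where A = "{\<lambda>x. g x * \<phi> x | \<phi>. \<phi> \<in> schwartz}"])
  fix f :: "real^'m \<Rightarrow> complex" and j 
  assume "f \<in> {\<lambda>x. g x * \<phi> x | \<phi>. \<phi> \<in> schwartz}"
  then obtain \<phi> where f: "f = (\<lambda>x. g x * \<phi> x)" and s: "\<phi> \<in> schwartz" by blast
  show "rapid f" unfolding f by (intro rapid_bounded_mult[OF _ bd] schwartz_rapid s)
  show "f differentiable (at x)" for x
    unfolding f by (intro differentiable_mult diff schwartz_differentiable s)
  have "partial_deriv j f = (\<lambda>x. g x * (partial_deriv j \<phi> x + (a j * (of_real (x $ j) * \<phi> x) + b j * \<phi> x)))"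
    unfolding f by (rule ext, subst partial_deriv_mult, rule diff, rule schwartz_differentiable[OF s])
      (simp add: deriv algebra_simps)
  moreover have "(\<lambda>x. partial_deriv j \<phi> x + (a j * (of_real (x $ j) * \<phi> x) + b j * \<phi> x)) \<in> schwartz"
    by (intro schwartz_add schwartz_cmult schwartz_partial_deriv schwartz_coord_mult s)
  ultimately show "partial_deriv j f \<in> {\<lambda>x. g x * \<phi> x | \<phi>. \<phi> \<in> schwartz}"
    by (auto intro!: exI[of _ "\<lambda>x. partial_deriv j \<phi> x + (a j * (of_real (x $ j) * \<phi> x) + b j * \<phi> x)"])
qed (use \<phi> in blast)

lemma schwartz_gauss_mult:
  assumes "\<phi> \<in> schwartz" "Re a \<ge> 0"
  shows "(\<lambda>x. gauss a x * \<phi> x) \<in> schwartz"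
  by (rule schwartz_exp_mult[where a = "\<lambda>_. - 2 * a" and b = "\<lambda>_. 0" and K = 1])
    (use assms in \<open>auto simp: gauss_differentiable partial_deriv_gauss norm_gauss\<close>)

lemma schwartz_wave_mult:
  assumes "\<phi> \<in> schwartz"
  shows "(\<lambda>x. wave \<eta> x * \<phi> x) \<in> schwartz"
  by (rule schwartz_exp_mult[where a = "\<lambda>_. 0" and b = "\<lambda>j. - \<i> * of_real (\<eta> $ j)" and K = 1])
    (use assms in \<open>auto simp: wave_differentiable partial_deriv_wave\<close>)

lemma schwartz_scale:
  assumes "\<phi> \<in> schwartz" and c: "c \<noteq> 0"
  shows "(\<lambda>x. \<phi> (c *\<^sub>R x)) \<in> schwartz"
proof (rule schwartz_coinduct[where A = "{\<lambda>x. \<phi> (c *\<^sub>R x) | \<phi>. \<phi> \<in> schwartz}"])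
  fix f :: "real^'a \<Rightarrow> complex" and j 
  assume "f \<in> {\<lambda>x. \<phi> (c *\<^sub>R x) | \<phi>. \<phi> \<in> schwartz}"
  then obtain \<phi> where f: "f = (\<lambda>x. \<phi> (c *\<^sub>R x))" and s: "\<phi> \<in> schwartz" by blast
  show "rapid f" unfolding f by (intro rapid_scale schwartz_rapid s c)
  have der: "(f has_derivative (\<lambda>h. frechet_derivative \<phi> (at (c *\<^sub>R x)) (c *\<^sub>R h))) (at x)" for x
    unfolding f
    by (rule has_derivative_compose[of "\<lambda>x. c *\<^sub>R x", where g = \<phi>])
      (auto intro!: derivative_eq_intros schwartz_differentiable[OF s, unfolded frechet_derivative_works])
  then show "f differentiable (at x)" for x using differentiable_def by blast
  have "partial_deriv j f x = of_real c * partial_deriv j \<phi> (c *\<^sub>R x)" for x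
    using partial_deriv_eq[OF der[of x], of j]
      linear_cmul[OF linear_frechet_derivative[OF schwartz_differentiable[OF s]]]
    by (simp add: partial_deriv_def[of j \<phi>] scaleR_conv_of_real[of c "_::complex"])
  then have eq: "partial_deriv j f = (\<lambda>x. (\<lambda>y. of_real c * partial_deriv j \<phi> y) (c *\<^sub>R x))" by auto
  have "(\<lambda>y. of_real c * partial_deriv j \<phi> y) \<in> schwartz"
    by (intro schwartz_cmult schwartz_partial_deriv s)
  then show "partial_deriv j f \<in> {\<lambda>x. \<phi> (c *\<^sub>R x) | \<phi>. \<phi> \<in> schwartz}"
    unfolding eq by (intro CollectI exI[of _ "\<lambda>y. of_real c * partial_deriv j \<phi> y"]) simp
qed (use assms in blast)

section \<open>Polynomials times Gaussians\<close>

inductive_set polynomials :: "(real^'m::finite \<Rightarrow> complex) set" where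
  const: "(\<lambda>_. c) \<in> polynomials"
| coord: "p \<in> polynomials \<Longrightarrow> (\<lambda>x. c * of_real (x $ k) * p x) \<in> polynomials"
| add: "p \<in> polynomials \<Longrightarrow> q \<in> polynomials \<Longrightarrow> (\<lambda>x. p x + q x) \<in> polynomials"

lemma polynomials_properties:
  assumes "p \<in> polynomials"
  shows "(\<forall>x. p differentiable (at x)) \<and> (\<forall>j. partial_deriv j p \<in> polynomials) \<and>
    (\<exists>K n. \<forall>x. norm (p x) \<le> K * (1 + norm x) ^ n)"
  using assms
proof induction
  case (const c)
  then show ?case
    using polynomials.const[of 0] by (auto intro!: exI[of _ "norm c"] exI[of _ "0::nat"])
next
  case (coord p c k)
  then obtain K n where K: "\<And>x. norm (p x) \<le> K * (1 + norm x) ^ n"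
    and dp: "\<And>x. p differentiable (at x)" "\<And>j. partial_deriv j p \<in> polynomials" by blast
  have d: "(\<lambda>x. c * of_real (x $ k)) differentiable (at x)" for x
    by (intro differentiable_mult differentiable_const coord_differentiable)
  have cf: "partial_deriv j (\<lambda>x. c * of_real (x $ k)) x = c * (if j = k then 1 else 0)" for j x
    by (subst partial_deriv_mult) (auto simp: coord_differentiable partial_deriv_coord)
  have "partial_deriv j (\<lambda>x. c * of_real (x $ k) * p x) =
      (\<lambda>x. c * of_real (x $ k) * partial_deriv j p x + (if j = k then c else 0) * p x)" for j
    by (rule ext, subst partial_deriv_mult[OF d dp(1)]) (auto simp: cf)
  \<comment> \<open>The derivative of the coordinate factor is a constant. Multiplication by
    constants is not a constructor, whence the nested induction.\<close>
  moreover have "(\<lambda>x. b * p x) \<in> polynomials" for b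
    using coord.hyps
  proof induction
    case (coord p c k)
    have "(\<lambda>x. b * c * of_real (x $ k) * p x) \<in> polynomials" by (rule polynomials.coord) fact
    then show ?case by (simp add: mult_ac)
  next
    case (add p q)
    then show ?case using polynomials.add[OF add.IH] by (simp add: algebra_simps)
  qed (auto intro: polynomials.const)
  ultimately have "partial_deriv j (\<lambda>x. c * of_real (x $ k) * p x) \<in> polynomials" for j
    using dp by (auto intro!: polynomials.coord polynomials.add simp del: if_split)
  moreover have "norm (c * of_real (x $ k) * p x) \<le> norm c * K * (1 + norm x) ^ Suc n" for x
  proof -
    have "norm (c * of_real (x $ k) * p x) \<le> norm c * (1 + norm x) * (K * (1 + norm x) ^ n)"
      unfolding norm_mult using component_le_norm_cart[of x k] K[of x]
      by (intro mult_mono) auto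
    then show ?thesis by (simp add: mult_ac)
  qed
  ultimately show ?case using d dp differentiable_mult by blast
next
  case (add p q)
  then obtain K n L m where K: "\<And>x. norm (p x) \<le> K * (1 + norm x) ^ n" and L: "\<And>x. norm (q x) \<le> L * (1 + norm x) ^ m"
    and d: "\<And>x. p differentiable (at x)" "\<And>x. q differentiable (at x)"
    and dd: "\<And>j. partial_deriv j p \<in> polynomials" "\<And>j. partial_deriv j q \<in> polynomials" by blast
  have "K \<ge> 0" "L \<ge> 0" using order_trans[OF norm_ge_zero K[of 0]] order_trans[OF norm_ge_zero L[of 0]] by auto
  have "norm (p x + q x) \<le> (K + L) * (1 + norm x) ^ (n + m)" for x
  proof -
    have "norm (p x + q x) \<le> K * (1 + norm x) ^ n + L * (1 + norm x) ^ m"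
      using K[of x] L[of x] norm_triangle_ineq[of "p x" "q x"] by linarith
    also have "\<dots> \<le> K * (1 + norm x) ^ (n + m) + L * (1 + norm x) ^ (n + m)"
      using \<open>K \<ge> 0\<close> \<open>L \<ge> 0\<close> by (intro add_mono mult_left_mono power_increasing) auto
    finally show ?thesis by (simp add: algebra_simps)
  qed
  moreover have "partial_deriv j (\<lambda>x. p x + q x) = (\<lambda>x. partial_deriv j p x + partial_deriv j q x)" for j
    by (rule ext) (intro partial_deriv_add d)
  ultimately show ?case
    using polynomials.add[OF dd] d by (auto intro!: differentiable_add)
qed

text \<open>The weight is absorbed through \<open>(y / K) ^ K \<le> exp y\<close>, where
  \<open>y\<close> is a multiple of \<open>1 + s\<^sup>2\<close> and therefore controls
  \<open>1 + s\<close>.\<close>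

lemma rapid_gauss:
  fixes a :: complex
  assumes a: "Re a > 0"
  shows "rapid (gauss a :: 'a::real_inner \<Rightarrow> complex)"
proof (rule rapidI)
  fix N :: nat
  \<comment> \<open>The successor keeps the divisor positive for \<open>N = 0\<close>.\<close>
  define K where "K = Suc N"
  have "(1 + norm x) ^ N * norm (gauss a x) \<le> (2 * real K / Re a) ^ K * exp (Re a)" for x :: 'a
  proof -
    define s where "s = norm x"
    define y where "y = Re a * (1 + s\<^sup>2)"
    have y: "y \<ge> 0" using a by (simp add: y_def)
    have "(y / K) ^ K \<le> (1 + y / K) ^ K" using y by (intro power_mono) auto
    also have "\<dots> \<le> exp y" using y by (intro exp_ge_one_plus_x_over_n_power_n) (auto simp: K_def)
    finally have "(y / K) ^ K * exp (- y) \<le> exp y * exp (- y)" by (intro mult_right_mono) auto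
    then have "(y / K) ^ K * exp (- y) \<le> 1" by (simp flip: exp_add)
    have "1 + s \<le> 2 * (1 + s\<^sup>2)"
    proof -
      have "0 \<le> (s - 1)\<^sup>2" by simp
      then have "2 * s \<le> s\<^sup>2 + 1" by (simp add: power2_diff)
      moreover have "0 \<le> s\<^sup>2" by simp
      ultimately have "1 + s \<le> 2 + 2 * s\<^sup>2" by linarith
      then show ?thesis by simp
    qed
    then have "(1 + s) ^ K \<le> (2 * (1 + s\<^sup>2)) ^ K" by (intro power_mono) (auto simp: s_def)
    also have "2 * (1 + s\<^sup>2) = (2 * real K / Re a) * (y / K)"
    proof -
      have "real K \<noteq> 0" by (simp add: K_def)
      then show ?thesis using a by (simp add: y_def)
    qed
    also note power_mult_distrib
    finally have "(1 + s) ^ K * exp (- y) \<le> (2 * real K / Re a) ^ K * (y / K) ^ K * exp (- y)"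
      by (intro mult_right_mono) auto
    also have "\<dots> \<le> (2 * real K / Re a) ^ K * 1"
      unfolding mult.assoc using a by (intro mult_left_mono \<open>(y / K) ^ K * exp (- y) \<le> 1\<close>) auto
    finally have *: "(1 + s) ^ K * exp (- y) \<le> (2 * real K / Re a) ^ K" by simp
    have "(1 + s) ^ N * exp (- Re a * s\<^sup>2) \<le> (1 + s) ^ K * exp (- Re a * s\<^sup>2)"
      by (intro mult_right_mono power_increasing) (auto simp: s_def K_def)
    also have "\<dots> = (1 + s) ^ K * (exp (- y) * exp (Re a))"
      by (simp add: y_def algebra_simps flip: exp_add)
    also have "(1 + s) ^ K * (exp (- y) * exp (Re a)) \<le> (2 * real K / Re a) ^ K * exp (Re a)"
      using mult_right_mono[OF *, of "exp (Re a)"] by (simp add: mult.assoc)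
    finally show ?thesis
      by (simp add: norm_gauss s_def power2_norm_eq_inner)
  qed
  then show "\<exists>C. \<forall>x::'a. (1 + norm x) ^ N * norm (gauss a x) \<le> C" by blast
qed

lemma gauss_schwartz:
  assumes a: "Re a > 0"
  shows "gauss a \<in> schwartz"
proof (rule schwartz_coinduct[where A = "{\<lambda>x. p x * gauss a x | p. p \<in> polynomials}"])
  fix f :: "real^'a \<Rightarrow> complex" and j 
  assume "f \<in> {\<lambda>x. p x * gauss a x | p. p \<in> polynomials}"
  then obtain p where f: "f = (\<lambda>x. p x * gauss a x)" and p: "p \<in> polynomials" by blast
  obtain K n where K: "\<And>x. norm (p x) \<le> K * (1 + norm x) ^ n" using polynomials_properties[OF p] by blast
  have dp: "p differentiable (at x)" "partial_deriv j p \<in> polynomials" for x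
    using polynomials_properties[OF p] by blast+
  show "rapid f" unfolding f by (intro rapid_poly_mult[OF _ K] rapid_gauss a)
  show "f differentiable (at x)" for x
    unfolding f by (intro differentiable_mult dp gauss_differentiable)
  have eq: "partial_deriv j f = (\<lambda>x. (partial_deriv j p x + - 2 * a * of_real (x $ j) * p x) * gauss a x)"
    unfolding f by (rule ext, subst partial_deriv_mult, rule dp, rule gauss_differentiable)
      (simp add: partial_deriv_gauss algebra_simps)
  have memb: "(\<lambda>x. p x * gauss a x) \<in> {\<lambda>x. p x * gauss a x | p. p \<in> polynomials}"
    if "p \<in> polynomials" for p :: "real^'a \<Rightarrow> complex" using that by blast
  show "partial_deriv j f \<in> {\<lambda>x. p x * gauss a x | p. p \<in> polynomials}"
    unfolding eq by (rule memb) (intro polynomials.add dp polynomials.coord p)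
next
  show "gauss a \<in> {\<lambda>x. p x * gauss a x | p. p \<in> polynomials}"
    using polynomials.const[of 1] by (auto intro!: exI[of _ "\<lambda>_. 1"])
qed

section \<open>Integrability of rapidly decreasing functions\<close>

lemma schwartz_continuous: "\<phi> \<in> schwartz \<Longrightarrow> continuous_on UNIV \<phi>"
  by (simp add: continuous_at_imp_continuous_on differentiable_imp_continuous_within schwartz_differentiable)

lemma schwartz_measurable: "\<phi> \<in> schwartz \<Longrightarrow> \<phi> \<in> borel_measurable borel"
  by (intro borel_measurable_continuous_onI schwartz_continuous)

lemma schwartz_bounded:
  assumes "\<phi> \<in> schwartz"
  obtains C where "\<And>x. norm (\<phi> x) \<le> C"
  using rapidE[OF schwartz_rapid[OF assms], of 0] by auto

text \<open>Each \<open>1 + (x \<bullet> b)\<^sup>2\<close> is at most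
  \<open>(1 + norm x)\<^sup>2\<close>, so a product of one-dimensional Cauchy profiles is a
  majorant; this is the origin of the exponent \<open>2 * DIM('a)\<close>.\<close>

lemma integrable_inverse_power_norm:
  "integrable lborel (\<lambda>x::'a::euclidean_space. 1 / (1 + norm x) ^ (2 * DIM('a)))"
proof -
  have "integrable lborel (\<lambda>s::real. inverse (1 + s\<^sup>2))"
    using integrable_inverse_1_plus_square by (simp add: set_integrable_def einterval_eq)
  then have "integrable lborel (\<lambda>s::real. complex_of_real (inverse (1 + s\<^sup>2)))"
    by (rule integrable_of_real)
  then have "integrable lborel (\<lambda>x::'a. (\<Prod>b\<in>Basis. complex_of_real (inverse (1 + (x \<bullet> b)\<^sup>2))))"
    by (rule integrable_lborel_prod)
  then show ?thesis
  proof (rule Bochner_Integration.integrable_bound)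
    show "AE x::'a in lborel. norm (1 / (1 + norm x) ^ (2 * DIM('a))) \<le>
        norm (\<Prod>b\<in>Basis. complex_of_real (inverse (1 + (x \<bullet> b)\<^sup>2)))"
    proof (rule AE_I2)
      fix x :: 'a
      have "1 + (x \<bullet> b)\<^sup>2 \<le> (1 + norm x)\<^sup>2" if "b \<in> Basis" for b
      proof -
        have "(x \<bullet> b)\<^sup>2 \<le> (norm x)\<^sup>2"
          using Basis_le_norm[OF that, of x] by (metis abs_ge_zero power2_abs power_mono)
        moreover have "(1 + norm x)\<^sup>2 = 1 + 2 * norm x + (norm x)\<^sup>2" by (simp add: power2_sum)
        ultimately show ?thesis using norm_ge_zero[of x] by linarith
      qed
      then have "(\<Prod>b\<in>(Basis::'a set). 1 + (x \<bullet> b)\<^sup>2) \<le> (\<Prod>b\<in>(Basis::'a set). (1 + norm x)\<^sup>2)"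
        by (intro prod_mono) auto
      also have "\<dots> = (1 + norm x) ^ (2 * DIM('a))" by (simp add: power_mult)
      finally have "1 / (1 + norm x) ^ (2 * DIM('a)) \<le> 1 / (\<Prod>b\<in>Basis. 1 + (x \<bullet> b)\<^sup>2)"
        by (intro divide_left_mono) (auto intro!: mult_pos_pos prod_pos add_pos_nonneg zero_less_power)
      also have "\<dots> = (\<Prod>b\<in>Basis. inverse (1 + (x \<bullet> b)\<^sup>2))"
        by (simp add: inverse_eq_divide prod_dividef)
      also have "\<dots> = norm (\<Prod>b\<in>Basis. complex_of_real (inverse (1 + (x \<bullet> b)\<^sup>2)))"
        unfolding of_real_prod[symmetric] norm_of_real
        by (intro abs_of_nonneg[symmetric] prod_nonneg) auto
      finally show "norm (1 / (1 + norm x) ^ (2 * DIM('a))) \<le> norm (\<Prod>b\<in>Basis. complex_of_real (inverse (1 + (x \<bullet> b)\<^sup>2)))"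
        by simp
    qed
  qed simp
qed

lemma rapid_integrable:
  fixes f :: "'a::euclidean_space \<Rightarrow> complex"
  assumes "rapid f" and [measurable]: "f \<in> borel_measurable borel"
  shows "integrable lborel f"
proof -
  obtain C where C: "C \<ge> 0" "\<And>x. (1 + norm x) ^ (2 * DIM('a)) * norm (f x) \<le> C"
    using rapidE[OF assms(1)] by blast
  show ?thesis
  proof (rule Bochner_Integration.integrable_bound)
    show "integrable lborel (\<lambda>x::'a. C * (1 / (1 + norm x) ^ (2 * DIM('a))))"
      by (intro integrable_mult_right integrable_inverse_power_norm)
    show "AE x in lborel. norm (f x) \<le> norm (C * (1 / (1 + norm x) ^ (2 * DIM('a))))"
    proof (rule AE_I2)
      fix x :: 'a
      have "(1 + norm x) ^ (2 * DIM('a)) > 0" by (intro zero_less_power add_pos_nonneg) auto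
      then show "norm (f x) \<le> norm (C * (1 / (1 + norm x) ^ (2 * DIM('a))))"
        using C(2)[of x] C(1) by (simp add: field_simps)
    qed
  qed simp
qed

lemma schwartz_integrable: "\<phi> \<in> schwartz \<Longrightarrow> integrable lborel \<phi>"
  by (intro rapid_integrable schwartz_rapid schwartz_measurable)

section \<open>The Fourier transform\<close>

text \<open>Unnormalised and taken over \<open>lborel\<close>; \<open>fourier_eq_ft\<close> restores
  the power of 2 pi.\<close>

definition ft :: "('a::euclidean_space \<Rightarrow> complex) \<Rightarrow> 'a \<Rightarrow> complex" where
  "ft f \<eta> = (LINT x|lborel. f x * wave \<eta> x)"

lemma wave_commute: "wave \<eta> x = wave x \<eta>"
  by (simp add: wave_def inner_commute)

lemma wave_add_left: "wave (\<eta> + \<xi>) x = wave \<eta> x * wave \<xi> x"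
  by (simp add: wave_def inner_add_left algebra_simps flip: exp_add)

lemma integrable_bounded_mult:
  fixes f g :: "'a \<Rightarrow> complex"
  assumes "integrable M f" and [measurable]: "g \<in> borel_measurable M" and g: "\<And>x. norm (g x) \<le> C"
  shows "integrable M (\<lambda>x. f x * g x)"
proof (rule Bochner_Integration.integrable_bound)
  show "integrable M (\<lambda>x. norm (f x) * C)" using assms by simp
  show "AE x in M. norm (f x * g x) \<le> norm (norm (f x) * C)"
  proof (rule AE_I2)
    fix x
    show "norm (f x * g x) \<le> norm (norm (f x) * C)"
      using mult_left_mono[OF g[of x], of "norm (f x)"] by (simp add: norm_mult abs_mult) (meson abs_ge_self mult_left_mono norm_ge_zero order_trans)
  qed
  show "(\<lambda>x. f x * g x) \<in> borel_measurable M"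
    using borel_measurable_integrable[OF assms(1)] by measurable
qed

lemma integrable_mult_wave:
  assumes "integrable lborel f"
  shows "integrable lborel (\<lambda>x. f x * wave \<eta> x)"
  using assms by (rule integrable_bounded_mult[where C = 1]) auto

lemma norm_ft_le:
  assumes "integrable lborel f"
  shows "norm (ft f \<eta>) \<le> (LINT x|lborel. norm (f x))"
proof -
  have "norm (ft f \<eta>) \<le> (LINT x|lborel. norm (f x * wave \<eta> x))"
    unfolding ft_def by (rule integral_norm_bound)
  then show ?thesis by (simp add: norm_mult)
qed

lemma ft_continuous:
  assumes f: "integrable lborel f"
  shows "continuous_on UNIV (ft f)"
proof (rule continuous_at_imp_continuous_on, intro ballI)
  fix \<eta> :: 'a
  have [measurable]: "f \<in> borel_measurable borel" using borel_measurable_integrable[OF f] by simp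
  show "isCont (ft f) \<eta>"
    unfolding continuous_at_sequentially comp_def ft_def
  proof (intro allI impI integral_dominated_convergence)
    fix \<xi> :: "nat \<Rightarrow> 'a" assume \<xi>: "\<xi> \<longlonglongrightarrow> \<eta>"
    show "integrable lborel (\<lambda>x. norm (f x))" using f by simp
    show "AE x in lborel. (\<lambda>n. f x * wave (\<xi> n) x) \<longlonglongrightarrow> f x * wave \<eta> x"
      unfolding wave_def by (intro AE_I2 tendsto_intros \<xi>)
  qed (auto simp: norm_mult)
qed

text \<open>The kernel is symmetric. Through this identity the distributional transform of an
  integrable function is given by its ordinary one.\<close>

lemma ft_mult_formula:
  assumes f: "integrable lborel f" and g: "integrable lborel g"
  shows "(LINT x|lborel. f x * ft g x) = (LINT x|lborel. g x * ft f x)"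
  unfolding ft_def
proof (subst fubini_kernel[OF f g])
  show "(\<lambda>(x, y). wave x y) \<in> borel_measurable (borel \<Otimes>\<^sub>M (borel :: 'a measure))"
    unfolding wave_def by measurable
  show "norm (wave x y) \<le> 1" for x y :: 'a by simp
qed (simp only: wave_commute)

lemma norm_wave_minus_one: "norm (wave h x - 1 + \<i> * of_real (h \<bullet> x)) \<le> (norm h)\<^sup>2 * (norm x)\<^sup>2"
proof -
  have "norm (wave h x - 1 + \<i> * of_real (h \<bullet> x)) \<le> \<bar>h \<bullet> x\<bar>\<^sup>2"
    using Taylor_exp[of "- \<i> * of_real (h \<bullet> x)" 1]
    by (simp add: wave_def power2_eq_square norm_mult algebra_simps)
  also have "\<dots> \<le> (norm h * norm x)\<^sup>2"
    by (intro power_mono Cauchy_Schwarz_ineq2) auto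
  finally show ?thesis by (simp add: power_mult_distrib)
qed

text \<open>The second-order remainder of the kernel is at most
  \<open>(norm h)\<^sup>2 * (norm x)\<^sup>2\<close>, and \<open>\<phi>\<close> has a finite second
  moment. The total derivative is computed because \<open>smooth_fun\<close> asks for
  differentiability, not just for partial derivatives.\<close>

lemma has_derivative_ft:
  assumes \<phi>: "\<phi> \<in> schwartz"
  shows "(ft \<phi> has_derivative (\<lambda>h. \<Sum>k\<in>UNIV. of_real (h $ k) * ft (\<lambda>x. - \<i> * (of_real (x $ k) * \<phi> x)) \<eta>)) (at \<eta>)"
    (is "(_ has_derivative ?L) _")
proof (rule has_derivativeI_sandwich[where e = 1])
  have xk: "(\<lambda>x. - \<i> * (of_real (x $ k) * \<phi> x)) \<in> schwartz" for k
    by (intro schwartz_cmult schwartz_coord_mult \<phi>)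
  show "bounded_linear ?L"
    by (intro bounded_linear_sum bounded_linear_mult_const bounded_linear_compose[OF bounded_linear_of_real] bounded_linear_vec_nth)
  have "rapid (\<lambda>x. of_real ((norm x)\<^sup>2) * \<phi> x)"
  proof (rule rapid_poly_mult[OF schwartz_rapid[OF \<phi>]])
    show "norm (complex_of_real ((norm x)\<^sup>2)) \<le> 1 * (1 + norm x) ^ 2" for x :: "real^'a"
      by (simp add: norm_power power_mono)
  qed
  then have "integrable lborel (\<lambda>x. of_real ((norm x)\<^sup>2) * \<phi> x)"
    using schwartz_measurable[OF \<phi>] by (intro rapid_integrable) auto
  from integrable_norm[OF this] have int2: "integrable lborel (\<lambda>x. (norm x)\<^sup>2 * norm (\<phi> x))"
    by (simp add: norm_mult norm_power)
  define K where "K = (LINT x|lborel. (norm x)\<^sup>2 * norm (\<phi> x))"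
  fix y :: "real^'a" assume "y \<noteq> \<eta>"
  define h where "h = y - \<eta>"
  have "?L h = (\<Sum>k\<in>UNIV. LINT x|lborel. of_real (h $ k) * ((- \<i> * (of_real (x $ k) * \<phi> x)) * wave \<eta> x))"
    by (simp only: ft_def integral_mult_right_zero)
  also have "\<dots> = (LINT x|lborel. (\<Sum>k\<in>UNIV. of_real (h $ k) * ((- \<i> * (of_real (x $ k) * \<phi> x)) * wave \<eta> x)))"
    by (intro Bochner_Integration.integral_sum[symmetric] integrable_mult_right integrable_mult_wave schwartz_integrable xk)
  also have "\<dots> = (LINT x|lborel. (- \<i> * of_real (h \<bullet> x) * \<phi> x) * wave \<eta> x)"
    by (simp add: inner_vec_def sum_distrib_left sum_distrib_right sum_negf mult_ac)
  finally have L: "?L h = (LINT x|lborel. (- \<i> * of_real (h \<bullet> x) * \<phi> x) * wave \<eta> x)" .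
  have int3: "integrable lborel (\<lambda>x. (- \<i> * of_real (h \<bullet> x) * \<phi> x) * wave \<eta> x)"
  proof (rule integrable_mult_wave)
    have "rapid (\<lambda>x. (- \<i> * of_real (h \<bullet> x)) * \<phi> x)"
    proof (rule rapid_poly_mult[OF schwartz_rapid[OF \<phi>]])
      show "norm (- \<i> * complex_of_real (h \<bullet> x)) \<le> norm h * (1 + norm x) ^ 1" for x
        using Cauchy_Schwarz_ineq2[of h x] by (simp add: norm_mult algebra_simps) (smt (verit) norm_ge_zero)
    qed
    then show "integrable lborel (\<lambda>x. - \<i> * of_real (h \<bullet> x) * \<phi> x)"
      using schwartz_measurable[OF \<phi>] by (intro rapid_integrable) auto
  qed
  have "ft \<phi> y - ft \<phi> \<eta> - ?L h =
      (LINT x|lborel. \<phi> x * wave y x - \<phi> x * wave \<eta> x - (- \<i> * of_real (h \<bullet> x) * \<phi> x) * wave \<eta> x)"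
    unfolding ft_def[of \<phi>] L using int3 integrable_mult_wave[OF schwartz_integrable[OF \<phi>]] by simp
  also have "norm \<dots> \<le> (LINT x|lborel. (norm h)\<^sup>2 * ((norm x)\<^sup>2 * norm (\<phi> x)))"
  proof (rule Bochner_Integration.integral_norm_bound_integral)
    show "integrable lborel (\<lambda>x. \<phi> x * wave y x - \<phi> x * wave \<eta> x - (- \<i> * of_real (h \<bullet> x) * \<phi> x) * wave \<eta> x)"
      by (intro Bochner_Integration.integrable_diff int3 integrable_mult_wave schwartz_integrable \<phi>)
    show "integrable lborel (\<lambda>x. (norm h)\<^sup>2 * ((norm x)\<^sup>2 * norm (\<phi> x)))" using int2 by simp
    fix x
    have "wave y x = wave \<eta> x * wave h x" using wave_add_left[of \<eta> h x] by (simp add: h_def)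
    then have "\<phi> x * wave y x - \<phi> x * wave \<eta> x - (- \<i> * of_real (h \<bullet> x) * \<phi> x) * wave \<eta> x =
        \<phi> x * wave \<eta> x * (wave h x - 1 + \<i> * of_real (h \<bullet> x))"
      by (simp add: algebra_simps)
    then show "norm (\<phi> x * wave y x - \<phi> x * wave \<eta> x - (- \<i> * of_real (h \<bullet> x) * \<phi> x) * wave \<eta> x) \<le>
        (norm h)\<^sup>2 * ((norm x)\<^sup>2 * norm (\<phi> x))"
      using mult_left_mono[OF norm_wave_minus_one[of h x], of "norm (\<phi> x)"] by (simp add: norm_mult mult_ac)
  qed
  also have "\<dots> = (norm h)\<^sup>2 * K" by (simp add: K_def)
  finally have "norm (ft \<phi> y - ft \<phi> \<eta> - ?L h) \<le> (norm h)\<^sup>2 * K" .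
  then show "norm (ft \<phi> y - ft \<phi> \<eta> - ?L (y - \<eta>)) / norm (y - \<eta>) \<le> norm (y - \<eta>) * K"
    using \<open>y \<noteq> \<eta>\<close> unfolding h_def[symmetric] by (simp add: h_def power2_eq_square divide_simps mult_ac)
next
  show "((\<lambda>y. norm (y - \<eta>) * K) \<longlongrightarrow> 0) (at \<eta>)" for K
    by (auto intro!: tendsto_eq_intros)
qed simp

lemma partial_deriv_ft:
  assumes \<phi>: "\<phi> \<in> schwartz"
  shows "partial_deriv j (ft \<phi>) = ft (\<lambda>x. - \<i> * (of_real (x $ j) * \<phi> x))"
  by (rule ext, subst partial_deriv_eq[OF has_derivative_ft[OF \<phi>]])
    (simp add: axis_def if_distrib[of of_real] mult_delta_left cong: if_cong)

text \<open>By translation invariance every difference quotient in the direction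
  \<open>axis j 1\<close> has integral 0, and the quotients converge dominatedly to the partial
  derivative.\<close>

lemma integral_partial_deriv_zero:
  assumes \<psi>: "\<psi> \<in> schwartz"
  shows "(LINT x|lborel. partial_deriv j \<psi> x) = 0"
proof -
  define D where "D = partial_deriv j \<psi>"
  define v :: "real^'a" where "v = axis j 1"
  have v: "norm v = 1" by (simp add: v_def)
  have D: "D \<in> schwartz" unfolding D_def by (rule schwartz_partial_deriv[OF \<psi>])
  have der: "((\<lambda>t. \<psi> (x + t *\<^sub>R v)) has_derivative (\<lambda>h. h *\<^sub>R D (x + t *\<^sub>R v))) (at t)" for x t
  proof -
    define F where "F = frechet_derivative \<psi> (at (x + t *\<^sub>R v))"
    have F: "(\<psi> has_derivative F) (at (x + t *\<^sub>R v))"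
      unfolding F_def using schwartz_differentiable[OF \<psi>] frechet_derivative_works by blast
    have "((\<lambda>t. x + t *\<^sub>R v) has_derivative (\<lambda>h. h *\<^sub>R v)) (at t)"
      by (auto intro!: derivative_eq_intros)
    from has_derivative_compose[OF this F]
    have "((\<lambda>t. \<psi> (x + t *\<^sub>R v)) has_derivative (\<lambda>h. F (h *\<^sub>R v))) (at t)" .
    moreover have "F (h *\<^sub>R v) = h *\<^sub>R D (x + t *\<^sub>R v)" for h
      using linear_cmul[OF has_derivative_linear[OF F]] by (simp add: D_def v_def F_def partial_deriv_def)
    ultimately show ?thesis by simp
  qed
  define m where "m = 2 * DIM(real^'a)"
  obtain C where C: "C \<ge> 0" "\<And>x. (1 + norm x) ^ m * norm (D x) \<le> C"
    using rapidE[OF schwartz_rapid[OF D]] by blast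
  \<comment> \<open>Along a segment of length at most 1 the weight \<open>1 + norm x\<close> changes
    by a factor of at most 2, which gives \<open>2 ^ m\<close>; the choice of \<open>m\<close> makes
    \<open>w\<close> integrable.\<close>
  define w where "w = (\<lambda>x::real^'a. 2 ^ m * C * (1 / (1 + norm x) ^ m))"
  have bound: "norm (D (x + t *\<^sub>R v)) \<le> w x" if t: "0 \<le> t" "t \<le> 1" for x t
  proof -
    define y where "y = x + t *\<^sub>R v"
    have "norm x \<le> norm y + norm (t *\<^sub>R v)"
      using norm_triangle_ineq4[of y "t *\<^sub>R v"] by (simp add: y_def)
    moreover have "norm (t *\<^sub>R v) \<le> 1" using t v by simp
    ultimately have "1 + norm x \<le> 2 + 2 * norm y" using norm_ge_zero[of y] by linarith
    then have "1 + norm x \<le> 2 * (1 + norm y)" by simp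
    then have "(1 + norm x) ^ m \<le> (2 * (1 + norm y)) ^ m" by (intro power_mono) auto
    then have "(1 + norm x) ^ m * norm (D y) \<le> (2 * (1 + norm y)) ^ m * norm (D y)"
      by (intro mult_right_mono) auto
    also have "\<dots> = 2 ^ m * ((1 + norm y) ^ m * norm (D y))"
      by (simp only: power_mult_distrib mult.assoc)
    also have "\<dots> \<le> 2 ^ m * C" by (intro mult_left_mono C) auto
    finally have "norm (D y) * (1 + norm x) ^ m \<le> 2 ^ m * C" by (simp add: mult.commute)
    moreover have "(1 + norm x) ^ m > 0" by (intro zero_less_power add_pos_nonneg) auto
    ultimately show ?thesis unfolding w_def y_def[symmetric] by (simp add: pos_le_divide_eq)
  qed
  define e where "e = (\<lambda>n. 1 / real (Suc n))"
  have e: "e n > 0" "e n \<le> 1" for n by (auto simp: e_def)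
  have lim: "e \<longlonglongrightarrow> 0" unfolding e_def by (rule LIMSEQ_Suc[OF lim_1_over_n])
  define s where "s = (\<lambda>n x. (\<psi> (x + e n *\<^sub>R v) - \<psi> x) / of_real (e n))"
  have [measurable]: "\<psi> \<in> borel_measurable borel" "D \<in> borel_measurable borel"
    by (intro schwartz_measurable \<psi> D)+
  have "(LINT x|lborel. s n x) = 0" for n
  proof -
    have "integrable lborel (\<lambda>x. \<psi> (e n *\<^sub>R v + 1 *\<^sub>R x))"
      by (subst lborel_integrable_affine) (auto intro: schwartz_integrable \<psi>)
    moreover have "(LINT x|lborel. \<psi> x) = (LINT x|lborel. \<psi> (e n *\<^sub>R v + 1 *\<^sub>R x))"
      by (subst lborel_integral_affine[of 1 \<psi> "e n *\<^sub>R v"]) auto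
    ultimately show ?thesis
      using schwartz_integrable[OF \<psi>] by (simp add: s_def add.commute)
  qed
  moreover have "(\<lambda>n. LINT x|lborel. s n x) \<longlonglongrightarrow> (LINT x|lborel. D x)"
  proof (rule integral_dominated_convergence)
    show "integrable lborel w"
      unfolding w_def m_def by (intro integrable_mult_right integrable_inverse_power_norm)
    show "AE x in lborel. (\<lambda>n. s n x) \<longlonglongrightarrow> D x"
    proof (rule AE_I2)
      fix x
      have "((\<lambda>h. norm (\<psi> (x + h *\<^sub>R v) - \<psi> x - h *\<^sub>R D x) / norm h) \<longlongrightarrow> 0) (at 0)"
        using der[of x 0] by (simp add: has_derivative_at)
      moreover have "filterlim e (at 0) sequentially"
        unfolding filterlim_at using lim e(1) by (auto intro!: always_eventually simp: less_imp_neq[symmetric])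
      ultimately have "(\<lambda>n. norm (\<psi> (x + e n *\<^sub>R v) - \<psi> x - e n *\<^sub>R D x) / norm (e n)) \<longlonglongrightarrow> 0"
        by (rule filterlim_compose)
      moreover have "norm (\<psi> (x + e n *\<^sub>R v) - \<psi> x - e n *\<^sub>R D x) / norm (e n) = norm (s n x - D x)" for n
      proof -
        have "s n x - D x = (\<psi> (x + e n *\<^sub>R v) - \<psi> x - e n *\<^sub>R D x) / of_real (e n)"
          using e(1)[of n] by (simp add: s_def scaleR_conv_of_real diff_divide_distrib)
        then show ?thesis by (simp add: norm_divide)
      qed
      ultimately show "(\<lambda>n. s n x) \<longlonglongrightarrow> D x"
        by (simp add: tendsto_norm_zero_iff LIM_zero_iff)
    qed
    show "AE x in lborel. norm (s n x) \<le> w x" for n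
    proof (rule AE_I2)
      fix x
      have "norm (\<psi> (x + e n *\<^sub>R v) - \<psi> (x + 0 *\<^sub>R v)) \<le> w x * norm (e n - 0)"
      proof (rule differentiable_bound[where S = "{0..e n}" and f = "\<lambda>t. \<psi> (x + t *\<^sub>R v)"])
        fix t assume "t \<in> {0..e n}"
        then have "norm (D (x + t *\<^sub>R v)) \<le> w x" using e[of n] by (intro bound) auto
        then show "onorm (\<lambda>h. h *\<^sub>R D (x + t *\<^sub>R v)) \<le> w x"
          by (intro onorm_le) (simp add: mult.commute[of "w x"] mult_left_mono)
        show "((\<lambda>t. \<psi> (x + t *\<^sub>R v)) has_derivative (\<lambda>h. h *\<^sub>R D (x + t *\<^sub>R v))) (at t within {0..e n})"
          by (rule has_derivative_at_withinI[OF der])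
      qed (use e[of n] in auto)
      then show "norm (s n x) \<le> w x"
        using e[of n] by (simp add: s_def norm_divide divide_simps)
    qed
  qed (auto simp: s_def)
  ultimately show ?thesis by (simp add: LIMSEQ_const_iff D_def)
qed

lemma ft_partial_deriv:
  assumes \<phi>: "\<phi> \<in> schwartz"
  shows "ft (partial_deriv j \<phi>) \<eta> = \<i> * of_real (\<eta> $ j) * ft \<phi> \<eta>"
proof -
  have "partial_deriv j (\<lambda>x. wave \<eta> x * \<phi> x) x =
      partial_deriv j \<phi> x * wave \<eta> x - \<i> * of_real (\<eta> $ j) * (\<phi> x * wave \<eta> x)" for x
    by (subst partial_deriv_mult[OF wave_differentiable schwartz_differentiable[OF \<phi>]])
      (simp add: partial_deriv_wave)
  then have "(LINT x|lborel. partial_deriv j \<phi> x * wave \<eta> x - \<i> * of_real (\<eta> $ j) * (\<phi> x * wave \<eta> x)) = 0"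
    using integral_partial_deriv_zero[OF schwartz_wave_mult[OF \<phi>], of j \<eta>] by simp
  moreover have "integrable lborel (\<lambda>x. partial_deriv j \<phi> x * wave \<eta> x)" "integrable lborel (\<lambda>x. \<phi> x * wave \<eta> x)"
    by (intro integrable_mult_wave schwartz_integrable schwartz_partial_deriv \<phi>)+
  ultimately show ?thesis by (simp add: ft_def)
qed

text \<open>Each factor \<open>1 + norm \<eta>\<close> is paid for with one derivative, because
  \<open>norm \<eta>\<close> is at most the sum of the \<open>\<bar>\<eta> $ j\<bar>\<close>. The
  induction therefore runs over all Schwartz functions at once.\<close>

lemma rapid_ft:
  assumes "\<phi> \<in> schwartz"
  shows "rapid (ft \<phi>)"
proof (rule rapidI)
  fix N
  show "\<exists>C. \<forall>\<eta>. (1 + norm \<eta>) ^ N * norm (ft \<phi> \<eta>) \<le> C"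
    using assms
  proof (induction N arbitrary: \<phi>)
    case 0
    then show ?case using norm_ft_le[OF schwartz_integrable] by auto
  next
    case (Suc N)
    obtain C where C: "\<And>\<eta>. (1 + norm \<eta>) ^ N * norm (ft \<phi> \<eta>) \<le> C" using Suc by blast
    have "\<forall>j. \<exists>C. \<forall>\<eta>. (1 + norm \<eta>) ^ N * norm (ft (partial_deriv j \<phi>) \<eta>) \<le> C"
      using Suc schwartz_partial_deriv by blast
    then obtain D where D: "\<And>j \<eta>. (1 + norm \<eta>) ^ N * norm (ft (partial_deriv j \<phi>) \<eta>) \<le> D j"
      by metis
    have "(1 + norm \<eta>) ^ Suc N * norm (ft \<phi> \<eta>) \<le> C + (\<Sum>j\<in>UNIV. D j)" for \<eta>
    proof -
      have "(1 + norm \<eta>) ^ Suc N * norm (ft \<phi> \<eta>) \<le> (1 + (\<Sum>j\<in>UNIV. \<bar>\<eta> $ j\<bar>)) * ((1 + norm \<eta>) ^ N * norm (ft \<phi> \<eta>))"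
        unfolding power_Suc mult.assoc using norm_le_l1_cart[of \<eta>] by (intro mult_right_mono) auto
      also have "\<dots> = (1 + norm \<eta>) ^ N * norm (ft \<phi> \<eta>) +
          (\<Sum>j\<in>UNIV. (1 + norm \<eta>) ^ N * norm (ft (partial_deriv j \<phi>) \<eta>))"
        by (simp add: ft_partial_deriv[OF Suc.prems] norm_mult sum_distrib_right sum_distrib_left ring_distribs mult_ac)
      also have "\<dots> \<le> C + (\<Sum>j\<in>UNIV. D j)" by (intro add_mono sum_mono C D)
      finally show ?thesis .
    qed
    then show ?case by blast
  qed
qed

theorem ft_schwartz:
  assumes "\<phi> \<in> schwartz"
  shows "ft \<phi> \<in> schwartz"
proof (rule schwartz_coinduct[where A = "ft ` schwartz"])
  fix f :: "real^'a \<Rightarrow> complex" and j assume "f \<in> ft ` schwartz"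
  then obtain \<phi> where \<phi>: "\<phi> \<in> schwartz" "f = ft \<phi>" by blast
  show "rapid f" unfolding \<phi> by (rule rapid_ft[OF \<phi>(1)])
  show "f differentiable (at x)" for x unfolding \<phi> by (rule differentiableI[OF has_derivative_ft[OF \<phi>(1)]])
  show "partial_deriv j f \<in> ft ` schwartz"
    unfolding \<phi>(2) partial_deriv_ft[OF \<phi>(1)] by (intro imageI schwartz_cmult schwartz_coord_mult \<phi>(1))
qed (use assms in blast)

section \<open>Transforms of Gaussians up to the imaginary axis\<close>

lemma gauss_continuous_on: "continuous_on A (gauss a)"
  unfolding gauss_def[abs_def] by (intro continuous_intros)

lemma norm_gauss_le_1: "Re a \<ge> 0 \<Longrightarrow> norm (gauss a x) \<le> 1"
  by (simp add: norm_gauss)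

lemma Re_inverse_nonneg: "Re a \<ge> 0 \<Longrightarrow> Re (1 / (4 * a)) \<ge> 0"
  by (auto simp: Re_divide)

text \<open>For purely imaginary \<open>a\<close> the Gaussian is not integrable and the identity is one between
  tempered distributions; it is the limit of the case \<open>Re a > 0\<close>.\<close>

lemma gauss_ft_pairing:
  fixes \<rho> :: "'a::euclidean_space \<Rightarrow> complex"
  assumes a: "Re a \<ge> 0" "a \<noteq> 0" and \<rho>: "integrable lborel \<rho>" and ft: "integrable lborel (ft \<rho>)"
  shows "(LINT x|lborel. gauss a x * ft \<rho> x) =
    csqrt (of_real pi / a) ^ DIM('a) * (LINT y|lborel. \<rho> y * gauss (1 / (4 * a)) y)"
proof -
  define b where "b = (\<lambda>n. a + of_real (1 / real (Suc n)))"
  have b: "Re (b n) > 0" for n using a by (auto simp: b_def intro: add_nonneg_pos)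
  have "(\<lambda>n. complex_of_real (1 / real (Suc n))) \<longlonglongrightarrow> of_real 0"
    by (intro tendsto_of_real LIMSEQ_Suc[OF lim_1_over_n])
  then have lim: "b \<longlonglongrightarrow> a" unfolding b_def by (auto intro: tendsto_eq_intros)
  have [measurable]: "\<rho> \<in> borel_measurable borel" "ft \<rho> \<in> borel_measurable borel"
    using borel_measurable_integrable[OF \<rho>] borel_measurable_integrable[OF ft] by simp_all
  have eq: "(LINT x|lborel. gauss (b n) x * ft \<rho> x) =
      csqrt (of_real pi / b n) ^ DIM('a) * (LINT y|lborel. \<rho> y * gauss (1 / (4 * b n)) y)" for n
    unfolding ft_mult_formula[OF integrable_gauss[OF b] \<rho>]
    by (simp only: ft_def[of "gauss _"] gauss_fourier[OF b] mult.left_commute[of "\<rho> _"] integral_mult_right_zero)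
  have "(\<lambda>n. LINT x|lborel. gauss (b n) x * ft \<rho> x) \<longlonglongrightarrow> (LINT x|lborel. gauss a x * ft \<rho> x)"
  proof (rule integral_dominated_convergence)
    show "integrable lborel (\<lambda>x. norm (ft \<rho> x))" using ft by simp
    show "AE x in lborel. (\<lambda>n. gauss (b n) x * ft \<rho> x) \<longlonglongrightarrow> gauss a x * ft \<rho> x"
      unfolding gauss_def by (intro AE_I2 tendsto_intros lim)
    show "AE x in lborel. norm (gauss (b n) x * ft \<rho> x) \<le> norm (ft \<rho> x)" for n
      using b[of n] by (auto simp: norm_mult intro!: mult_left_le_one_le norm_gauss_le_1)
  qed auto
  moreover have "(\<lambda>n. csqrt (of_real pi / b n) ^ DIM('a) * (LINT y|lborel. \<rho> y * gauss (1 / (4 * b n)) y))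
      \<longlonglongrightarrow> csqrt (of_real pi / a) ^ DIM('a) * (LINT y|lborel. \<rho> y * gauss (1 / (4 * a)) y)"
  proof (intro tendsto_mult tendsto_power integral_dominated_convergence)
    \<comment> \<open>The limit has to avoid the cut of \<open>csqrt\<close>; with
      \<open>Re a \<ge> 0\<close> and \<open>a \<noteq> 0\<close> it does, even for imaginary
      \<open>a\<close>.\<close>
    have "of_real pi / a \<notin> \<real>\<^sub>\<le>\<^sub>0"
    proof
      assume "of_real pi / a \<in> \<real>\<^sub>\<le>\<^sub>0"
      then obtain r where r: "r \<le> 0" "of_real pi / a = of_real r" by (auto elim: nonpos_Reals_cases)
      then have "of_real pi = of_real r * a" using a by (simp add: field_simps)
      from arg_cong[OF this, of Re] have "pi = r * Re a" by simp
      then show False using r a pi_gt_zero mult_nonpos_nonneg[of r "Re a"] by linarith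
    qed
    then show "(\<lambda>n. csqrt (of_real pi / b n)) \<longlonglongrightarrow> csqrt (of_real pi / a)"
      using a(2) by (intro isCont_tendsto_compose[OF continuous_at_csqrt] tendsto_intros lim)
    show "integrable lborel (\<lambda>x. norm (\<rho> x))" using \<rho> by simp
    show "AE y in lborel. (\<lambda>n. \<rho> y * gauss (1 / (4 * b n)) y) \<longlonglongrightarrow> \<rho> y * gauss (1 / (4 * a)) y"
      unfolding gauss_def using a by (intro AE_I2 tendsto_intros lim) auto
    show "AE y in lborel. norm (\<rho> y * gauss (1 / (4 * b n)) y) \<le> norm (\<rho> y)" for n
      using b[of n] by (auto simp: norm_mult intro!: mult_right_le_one_le norm_gauss_le_1 Re_inverse_nonneg)
  qed auto
  ultimately show ?thesis unfolding eq by (rule LIMSEQ_unique)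
qed

section \<open>Tempered functions and Fresnel propagation\<close>

lemma LINT_lebesgue_eq_lborel:
  fixes f :: "'a::euclidean_space \<Rightarrow> complex"
  shows "f \<in> borel_measurable borel \<Longrightarrow> (LINT x|lebesgue. f x) = (LINT x|lborel. f x)"
  by (simp add: integral_completion)

lemma fourier_eq_ft:
  fixes \<phi> :: "real^'m::finite \<Rightarrow> complex"
  assumes "\<phi> \<in> schwartz"
  shows "fourier \<phi> = (\<lambda>\<eta>. of_real ((2 * pi) powr (- real CARD('m) / 2)) * ft \<phi> \<eta>)"
proof
  fix \<eta>
  have [measurable]: "\<phi> \<in> borel_measurable borel" by (rule schwartz_measurable[OF assms])
  have "(LINT x|lebesgue. \<phi> x * wave \<eta> x) = ft \<phi> \<eta>"
    unfolding ft_def by (rule LINT_lebesgue_eq_lborel) measurable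
  then show "fourier \<phi> \<eta> = of_real ((2 * pi) powr (- real CARD('m) / 2)) * ft \<phi> \<eta>"
    by (simp add: fourier_def wave_def)
qed

lemma fourier_schwartz: "\<phi> \<in> schwartz \<Longrightarrow> fourier \<phi> \<in> schwartz"
  by (simp add: fourier_eq_ft schwartz_cmult ft_schwartz)

lemma chirp_eq_gauss: "chirp k d = gauss (- \<i> * of_real (k / d) / 2)"
  by (simp add: chirp_def gauss_def fun_eq_iff field_simps)

lemma dist_of_fun_apply:
  assumes "\<phi> \<in> schwartz" and [measurable]: "f \<in> borel_measurable borel"
  shows "dist_of_fun f \<phi> = (LINT x|lborel. f x * \<phi> x)"
proof -
  have [measurable]: "\<phi> \<in> borel_measurable borel" by (rule schwartz_measurable[OF assms(1)])
  show ?thesis using assms(1) by (simp add: dist_of_fun_def LINT_lebesgue_eq_lborel)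
qed

lemma dist_of_fun_eqI:
  assumes "T \<in> extensional schwartz" "f \<in> borel_measurable borel"
    and "\<And>\<phi>. \<phi> \<in> schwartz \<Longrightarrow> T \<phi> = (LINT x|lborel. f x * \<phi> x)"
  shows "T = dist_of_fun f"
proof (rule extensionalityI[OF assms(1)])
  show "dist_of_fun f \<in> extensional schwartz" by (simp add: dist_of_fun_def)
qed (simp add: assms dist_of_fun_apply)

definition fresnel_const :: "real \<Rightarrow> real \<Rightarrow> 'm::finite itself \<Rightarrow> complex" where
  "fresnel_const k d _ = exp (\<i> * of_real (k * d - real CARD('m) * pi / 4)) *
     of_real ((k / d) powr (real CARD('m) / 2))"

text \<open>The transpose of the rescaling and the outer factors of the Fresnel propagator; the factor
  \<open>(k / d) powr (- m)\<close> is left out.\<close>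

definition fresnel_pullback :: "real \<Rightarrow> real \<Rightarrow> (real^'m::finite \<Rightarrow> complex) \<Rightarrow> real^'m \<Rightarrow> complex" where
  "fresnel_pullback k d \<phi> y = fresnel_const k d TYPE('m) *
     (chirp k d ((1 / (k / d)) *\<^sub>R y) * \<phi> ((1 / (k / d)) *\<^sub>R y))"

lemma fresnel_const_nonzero: "k > 0 \<Longrightarrow> d > 0 \<Longrightarrow> fresnel_const k d TYPE('m::finite) \<noteq> 0"
  by (simp add: fresnel_const_def)

lemma schwartz_chirp_mult: "\<phi> \<in> schwartz \<Longrightarrow> (\<lambda>x. chirp k d x * \<phi> x) \<in> schwartz"
  unfolding chirp_eq_gauss by (rule schwartz_gauss_mult) (simp_all del: of_real_divide)

lemma fresnel_pullback_schwartz: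
  assumes "k > 0" "d > 0" "\<phi> \<in> schwartz"
  shows "fresnel_pullback k d \<phi> \<in> schwartz"
  unfolding fresnel_pullback_def[abs_def]
  using assms by (intro schwartz_cmult schwartz_scale[of "\<lambda>x. chirp k d x * \<phi> x"] schwartz_chirp_mult) auto

text \<open>All constituents of \<open>fresnel\<close> are restricted to \<open>schwartz\<close>, so
  they can be moved onto the test function only because every intermediate test function is again
  Schwartz.\<close>

lemma fresnel_apply:
  fixes T :: "'m::finite functional"
  assumes k: "k > 0" "d > 0" and \<phi>: "\<phi> \<in> schwartz"
  shows "fresnel k d T \<phi> = of_real ((k / d) powr (- real CARD('m))) *
    T (\<lambda>x. chirp k d x * fourier (fresnel_pullback k d \<phi>) x)"
proof -
  define c where "c = fresnel_const k d TYPE('m)"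
  have 1: "(\<lambda>x. c * chirp k d x * \<phi> x) \<in> schwartz"
    using schwartz_cmult[OF schwartz_chirp_mult[OF \<phi>]] by (simp add: mult.assoc)
  have 2: "(\<lambda>y. c * chirp k d ((1 / (k / d)) *\<^sub>R y) * \<phi> ((1 / (k / d)) *\<^sub>R y)) = fresnel_pullback k d \<phi>"
    by (simp add: fresnel_pullback_def c_def fun_eq_iff mult.assoc)
  have 3: "fresnel_pullback k d \<phi> \<in> schwartz" by (rule fresnel_pullback_schwartz[OF k \<phi>])
  have c: "exp (\<i> * of_real (k * d - real CARD('m) * pi / 4)) * of_real ((k / d) powr (real CARD('m) / 2)) = c"
    by (simp add: c_def fresnel_const_def)
  show ?thesis
    unfolding fresnel_def c
    using \<phi> 1 3 fourier_schwartz[OF 3]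
    by (simp only: dist_mult_def dist_scale_def dist_fourier_def restrict_apply if_True 2)
qed

lemma fresnel_extensional: "fresnel k d T \<in> extensional schwartz"
  by (simp add: fresnel_def dist_mult_def)

text \<open>The content is uniqueness against continuous competitors that may be unbounded. A
  Gaussian weight makes the difference integrable, and modulated Gaussians as test functions show
  that its Fourier transform vanishes.\<close>

lemma dist_density_eq:
  fixes f :: "real^'m::finite \<Rightarrow> complex"
  assumes cont: "continuous_on UNIV f" and bd: "\<And>x. norm (f x) \<le> C"
  shows "dist_density (dist_of_fun f) = f"
  unfolding dist_density_def
proof (rule the_equality)
  have int_f: "integrable lebesgue (\<lambda>x. f x * \<phi> x)" if \<phi>: "\<phi> \<in> schwartz" for \<phi>
  proof -
    have [measurable]: "f \<in> borel_measurable borel" "\<phi> \<in> borel_measurable borel"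
      using borel_measurable_continuous_onI[OF cont] schwartz_measurable[OF \<phi>] .
    have "integrable lborel (\<lambda>x. \<phi> x * f x)"
      using bd by (intro integrable_bounded_mult[where C = C] schwartz_integrable \<phi>) auto
    then show ?thesis by (subst integrable_completion) (auto simp: mult.commute)
  qed
  then show "continuous_on UNIV f \<and> (\<forall>\<phi>\<in>schwartz. integrable lebesgue (\<lambda>x. f x * \<phi> x)) \<and> dist_of_fun f = dist_of_fun f"
    using cont by blast
  fix g assume g: "continuous_on UNIV g \<and> (\<forall>\<phi>\<in>schwartz. integrable lebesgue (\<lambda>x. g x * \<phi> x)) \<and> dist_of_fun f = dist_of_fun g"
  define v where "v = (\<lambda>x. (f x - g x) * gauss 1 x)"
  have contv: "continuous_on UNIV v" unfolding v_def using cont g by (intro continuous_intros gauss_continuous_on) auto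
  have [measurable]: "f \<in> borel_measurable borel" "g \<in> borel_measurable borel" "v \<in> borel_measurable borel"
    using cont g contv by (auto intro: borel_measurable_continuous_onI)
  have diff: "integrable lborel (\<lambda>x. (f x - g x) * \<phi> x) \<and> (LINT x|lborel. (f x - g x) * \<phi> x) = 0" if \<phi>: "\<phi> \<in> schwartz" for \<phi>
  proof -
    have [measurable]: "\<phi> \<in> borel_measurable borel" by (rule schwartz_measurable[OF \<phi>])
    have "integrable lborel (\<lambda>x. f x * \<phi> x)" "integrable lborel (\<lambda>x. g x * \<phi> x)"
      using int_f[OF \<phi>] g \<phi> by (auto simp: integrable_completion)
    moreover have "(LINT x|lborel. f x * \<phi> x) = (LINT x|lborel. g x * \<phi> x)"
      using dist_of_fun_apply[OF \<phi>, of f] dist_of_fun_apply[OF \<phi>, of g] g by simp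
    ultimately show ?thesis by (simp add: ring_distribs)
  qed
  have v: "integrable lborel v" using diff[OF gauss_schwartz[of 1]] by (simp add: v_def)
  have zero: "(LINT x|lborel. v x * wave \<eta> x) = 0" for \<eta>
    using diff[OF schwartz_wave_mult[OF gauss_schwartz[of 1], of \<eta>]] by (simp add: v_def mult_ac)
  \<comment> \<open>A bounded, integrable and continuous substitute for \<open>cnj v\<close>, as
    \<open>fourier_uniqueness\<close> demands; \<open>v x * \<phi> x\<close> is still nonnegative
    and vanishes only where \<open>v\<close> does.\<close>
  define \<phi> where "\<phi> = (\<lambda>x. cnj (v x) * of_real (1 / (1 + norm (v x))))"
  have le: "norm (\<phi> x) \<le> norm (v x)" "norm (\<phi> x) \<le> 1" for x
  proof -
    have eq: "norm (\<phi> x) = norm (v x) / (1 + norm (v x))"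
      by (simp add: \<phi>_def norm_mult del: of_real_divide of_real_add) 
    have "1 + norm (v x) > 0" by (simp add: add_pos_nonneg)
    then show "norm (\<phi> x) \<le> norm (v x)" "norm (\<phi> x) \<le> 1"
      unfolding eq by (auto simp: divide_simps mult_le_cancel_left1)
  qed
  have "(LINT x|lborel. v x * \<phi> x) = 0"
  proof (rule fourier_uniqueness[OF v zero])
    show contp: "continuous_on UNIV \<phi>"
      unfolding \<phi>_def by (intro continuous_intros contv) (smt (verit) norm_ge_zero)
    have "\<phi> \<in> borel_measurable borel" using contp by (rule borel_measurable_continuous_onI)
    then show "integrable lborel \<phi>"
      by (intro Bochner_Integration.integrable_bound[OF v]) (auto intro: le)
    show "norm (\<phi> x) \<le> 1" for x by (rule le)
  qed
  moreover have "v x * \<phi> x = of_real ((norm (v x))\<^sup>2 / (1 + norm (v x)))" for x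
  proof -
    have "v x * \<phi> x = (v x * cnj (v x)) * of_real (1 / (1 + norm (v x)))" by (simp add: \<phi>_def)
    then show ?thesis unfolding complex_norm_square[symmetric] by simp
  qed
  ultimately have "(LINT x|lborel. (norm (v x))\<^sup>2 / (1 + norm (v x))) = 0" by (simp del: of_real_divide of_real_power)
  moreover have "integrable lborel (\<lambda>x. (norm (v x))\<^sup>2 / (1 + norm (v x)))"
  proof (rule Bochner_Integration.integrable_bound[OF v])
    show "AE x in lborel. norm ((norm (v x))\<^sup>2 / (1 + norm (v x))) \<le> norm (v x)"
    proof (rule AE_I2)
      fix x
      have "1 + norm (v x) > 0" by (simp add: add_pos_nonneg)
      then show "norm ((norm (v x))\<^sup>2 / (1 + norm (v x))) \<le> norm (v x)"
        by (simp add: divide_simps power2_eq_square mult_left_mono)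
    qed
  qed measurable
  ultimately have "AE x in lborel. (norm (v x))\<^sup>2 / (1 + norm (v x)) = 0"
    by (subst (asm) integral_nonneg_eq_0_iff_AE) auto
  then have "AE x in lborel. v x = 0"
    by eventually_elim (smt (verit) divide_eq_0_iff norm_ge_zero norm_eq_zero power_eq_0_iff)
  then have null: "{x. v x \<noteq> 0} \<in> null_sets lborel"
    by (subst AE_iff_null_sets) auto
  have "v x = 0" for x
  proof (rule ccontr)
    assume "v x \<noteq> 0"
    have op: "open {x. v x \<noteq> 0}" using contv by (intro open_Collect_neq continuous_intros)
    then obtain e where e: "e > 0" "ball x e \<subseteq> {x. v x \<noteq> 0}" using \<open>v x \<noteq> 0\<close> openE by blast
    have "ball x e \<in> null_sets lborel" using null_sets_subset[OF null _ e(2)] by simp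
    then have "measure lborel (ball x e) = 0" by (simp add: null_sets_def measure_def)
    then show False using content_ball_pos[OF e(1), of x] by simp
  qed
  then show "g = f" by (auto simp: v_def gauss_def fun_eq_iff)
qed

text \<open>\<open>G\<close> stands for the transform of chirp times field. It is left arbitrary
  since for a plane wave that transform is a function only in the distributional sense.\<close>

definition fresnel_density :: "real \<Rightarrow> real \<Rightarrow> (real^'m::finite \<Rightarrow> complex) \<Rightarrow> real^'m \<Rightarrow> complex" where
  "fresnel_density k d G x = of_real ((2 * pi) powr (- real CARD('m) / 2)) * fresnel_const k d TYPE('m) *
     (chirp k d x * G ((k / d) *\<^sub>R x))"

lemma norm_chirp [simp]: "norm (chirp k d x) = 1"
  by (simp add: chirp_def)

lemma chirp_measurable [measurable]: "chirp k d \<in> borel_measurable borel"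
  by (simp add: chirp_eq_gauss)

lemma chirp_continuous: "continuous_on A (chirp k d)"
  unfolding chirp_eq_gauss by (rule gauss_continuous_on)

lemma gauss_add: "gauss a x * gauss b x = gauss (a + b) x"
  by (simp add: gauss_def algebra_simps flip: exp_add)

lemma gauss_scale: "gauss a (c *\<^sub>R x) = gauss (a * of_real (c\<^sup>2)) x"
  by (simp add: gauss_def power2_eq_square algebra_simps)

lemma gauss_0 [simp]: "gauss 0 x = 1"
  by (simp add: gauss_def)

lemma powr_mult_power:
  "c > 0 \<Longrightarrow> complex_of_real (c powr (- real n)) * of_real (c ^ n) = 1"
  by (simp add: powr_minus powr_realpow flip: of_real_mult)

text \<open>The transposition identity is assumed of \<open>G\<close> in order to treat integrable
  fields and constant probes together. The Jacobian of the rescaling cancels the power of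
  \<open>k / d\<close> in \<open>dist_scale\<close>.\<close>

lemma fresnel_pairing:
  fixes F G :: "real^'m::finite \<Rightarrow> complex"
  assumes k: "k > 0" "d > 0" and \<phi>: "\<phi> \<in> schwartz"
    and T: "\<And>\<omega>. \<omega> \<in> schwartz \<Longrightarrow> T \<omega> = (LINT x|lborel. F x * \<omega> x)"
    and [measurable]: "G \<in> borel_measurable borel"
    and G: "\<And>\<psi>. \<psi> \<in> schwartz \<Longrightarrow> (LINT x|lborel. (chirp k d x * F x) * ft \<psi> x) = (LINT y|lborel. \<psi> y * G y)"
  shows "fresnel k d T \<phi> = (LINT x|lborel. fresnel_density k d G x * \<phi> x)"
proof -
  define \<kappa> where "\<kappa> = k / d"
  have \<kappa>: "\<kappa> > 0" using k by (simp add: \<kappa>_def)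
  define N where "N = complex_of_real ((2 * pi) powr (- real CARD('m) / 2))"
  define c where "c = fresnel_const k d TYPE('m)"
  define \<psi> where "\<psi> = fresnel_pullback k d \<phi>"
  have \<psi>: "\<psi> \<in> schwartz" unfolding \<psi>_def by (rule fresnel_pullback_schwartz[OF k \<phi>])
  have [measurable]: "\<phi> \<in> borel_measurable borel" "\<psi> \<in> borel_measurable borel"
    by (intro schwartz_measurable \<phi> \<psi>)+
  have "fresnel k d T \<phi> = of_real (\<kappa> powr (- real CARD('m))) * T (\<lambda>x. chirp k d x * fourier \<psi> x)"
    unfolding fresnel_apply[OF k \<phi>] \<psi>_def \<kappa>_def ..
  also have "T (\<lambda>x. chirp k d x * fourier \<psi> x) = (LINT x|lborel. N * ((chirp k d x * F x) * ft \<psi> x))"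
    by (subst T[OF schwartz_chirp_mult[OF fourier_schwartz[OF \<psi>]]])
      (simp add: fourier_eq_ft[OF \<psi>] N_def mult_ac)
  also have "\<dots> = N * (LINT y|lborel. \<psi> y * G y)" by (simp only: integral_mult_right_zero G[OF \<psi>])
  also have "(LINT y|lborel. \<psi> y * G y) = of_real (\<bar>\<kappa>\<bar> ^ DIM(real^'m)) * (LINT x|lborel. \<psi> (0 + \<kappa> *\<^sub>R x) * G (0 + \<kappa> *\<^sub>R x))"
    using \<kappa> by (intro lborel_integral_affine) auto
  also have "(\<lambda>x. \<psi> (0 + \<kappa> *\<^sub>R x) * G (0 + \<kappa> *\<^sub>R x)) = (\<lambda>x. (c * (chirp k d x * G (\<kappa> *\<^sub>R x))) * \<phi> x)"
    using \<kappa> by (auto simp: \<psi>_def fresnel_pullback_def c_def fun_eq_iff mult_ac simp flip: \<kappa>_def)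
  finally have "fresnel k d T \<phi> = (of_real (\<kappa> powr (- real CARD('m))) * of_real (\<kappa> ^ CARD('m))) *
      (N * (LINT x|lborel. (c * (chirp k d x * G (\<kappa> *\<^sub>R x))) * \<phi> x))"
    using \<kappa> by (simp add: mult_ac)
  also have "\<dots> = (LINT x|lborel. N * ((c * (chirp k d x * G (\<kappa> *\<^sub>R x))) * \<phi> x))"
    unfolding powr_mult_power[OF \<kappa>] by simp
  also have "\<dots> = (LINT x|lborel. fresnel_density k d G x * \<phi> x)"
    by (simp add: fresnel_density_def N_def c_def \<kappa>_def mult.assoc)
  finally show ?thesis .
qed

lemma integrable_chirp_mult:
  assumes "integrable lborel F"
  shows "integrable lborel (\<lambda>x. chirp k d x * F x)"
  using integrable_bounded_mult[OF assms, of "chirp k d" 1] by (simp add: mult.commute)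

lemma fresnel_integrable:
  assumes "k > 0" "d > 0" "\<phi> \<in> schwartz"
    and "\<And>\<omega>. \<omega> \<in> schwartz \<Longrightarrow> T \<omega> = (LINT x|lborel. F x * \<omega> x)" and F: "integrable lborel F"
  shows "fresnel k d T \<phi> = (LINT x|lborel. fresnel_density k d (ft (\<lambda>x. chirp k d x * F x)) x * \<phi> x)"
proof (rule fresnel_pairing[OF assms(1-4)])
  show "ft (\<lambda>x. chirp k d x * F x) \<in> borel_measurable borel"
    by (intro borel_measurable_continuous_onI ft_continuous integrable_chirp_mult F)
  show "(LINT x|lborel. chirp k d x * F x * ft \<psi> x) = (LINT y|lborel. \<psi> y * ft (\<lambda>x. chirp k d x * F x) y)"
    if "\<psi> \<in> schwartz" for \<psi>
    by (intro ft_mult_formula integrable_chirp_mult F schwartz_integrable that)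
qed

lemma fresnel_density_continuous:
  assumes "integrable lborel f"
  shows "continuous_on UNIV (fresnel_density k d (ft f))"
  unfolding fresnel_density_def[abs_def]
  by (intro continuous_intros chirp_continuous continuous_on_compose2[OF ft_continuous[OF assms]]) auto

lemma fresnel_density_bounded:
  assumes "integrable lborel f"
  obtains C where "\<And>x. norm (fresnel_density k d (ft f) x) \<le> C"
proof
  fix x :: "real^'a"
  show "norm (fresnel_density k d (ft f) x) \<le>
    norm (of_real ((2 * pi) powr (- real CARD('a) / 2)) * fresnel_const k d TYPE('a)) * (LINT x|lborel. norm (f x))"
    unfolding fresnel_density_def norm_mult norm_chirp mult_1
    by (intro mult_left_mono norm_ft_le[OF assms]) auto
qed

section \<open>Probes\<close>

text \<open>The transform of the inner chirp is again a Gaussian with imaginary exponent; rescaled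
  by \<open>k / d\<close> it is, up to a constant, the inverse of the outer chirp. Free propagation
  thus maps constants to constants.\<close>

lemma plane_wave_propagated:
  fixes p0 :: complex
  assumes k: "k > 0" "d > 0" and \<phi>: "\<phi> \<in> schwartz"
  defines "a \<equiv> - \<i> * of_real (k / d) / 2"
  shows "fresnel k d (dist_of_fun (\<lambda>_. p0)) \<phi> =
    (LINT x|lborel. (of_real ((2 * pi) powr (- real CARD('m) / 2)) * fresnel_const k d TYPE('m) *
      (p0 * csqrt (of_real pi / a) ^ CARD('m))) * \<phi> (x :: real^'m::finite))"
proof -
  have a: "Re a \<ge> 0" "a \<noteq> 0" using k by (auto simp: a_def simp del: of_real_divide)
  define K where "K = p0 * csqrt (of_real pi / a) ^ CARD('m)"
  have "fresnel k d (dist_of_fun (\<lambda>_. p0)) \<phi> =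
      (LINT x|lborel. fresnel_density k d (\<lambda>y. K * gauss (1 / (4 * a)) y) x * \<phi> x)"
  proof (rule fresnel_pairing[OF k \<phi>])
    show "dist_of_fun (\<lambda>_. p0) \<omega> = (LINT x|lborel. p0 * \<omega> x)" if "\<omega> \<in> schwartz" for \<omega> :: "real^'m \<Rightarrow> complex"
      by (rule dist_of_fun_apply[OF that]) simp
    fix \<psi> :: "real^'m \<Rightarrow> complex" assume \<psi>: "\<psi> \<in> schwartz"
    have "(LINT x|lborel. chirp k d x * p0 * ft \<psi> x) = p0 * (LINT x|lborel. gauss a x * ft \<psi> x)"
      unfolding chirp_eq_gauss a_def[symmetric] mult.commute[of _ p0] mult.assoc integral_mult_right_zero ..
    also have "\<dots> = p0 * (csqrt (of_real pi / a) ^ CARD('m) * (LINT y|lborel. \<psi> y * gauss (1 / (4 * a)) y))"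
      by (subst gauss_ft_pairing[OF a schwartz_integrable[OF \<psi>] schwartz_integrable[OF ft_schwartz[OF \<psi>]]]) simp
    also have "\<dots> = (LINT y|lborel. K * (\<psi> y * gauss (1 / (4 * a)) y))"
      unfolding integral_mult_right_zero by (simp add: K_def)
    finally show "(LINT x|lborel. chirp k d x * p0 * ft \<psi> x) = (LINT y|lborel. \<psi> y * (K * gauss (1 / (4 * a)) y))"
      by (simp add: mult_ac)
  qed measurable
  also have "(\<lambda>x. fresnel_density k d (\<lambda>y. K * gauss (1 / (4 * a)) y) x * \<phi> x) =
      (\<lambda>x. of_real ((2 * pi) powr (- real CARD('m) / 2)) * fresnel_const k d TYPE('m) * K * \<phi> x)"
  proof
    fix x :: "real^'m"
    have "a + 1 / (4 * a) * of_real ((k / d)\<^sup>2) = 0"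
      using k by (simp add: a_def field_simps power2_eq_square)
    then have "chirp k d x * gauss (1 / (4 * a)) ((k / d) *\<^sub>R x) = 1"
      unfolding chirp_eq_gauss a_def[symmetric] gauss_scale gauss_add by simp
    then show "fresnel_density k d (\<lambda>y. K * gauss (1 / (4 * a)) y) x * \<phi> x =
        of_real ((2 * pi) powr (- real CARD('m) / 2)) * fresnel_const k d TYPE('m) * K * \<phi> x"
      by (simp add: fresnel_density_def mult.left_commute[of "chirp _ _ _"])
  qed
  finally show ?thesis unfolding K_def .
qed

text \<open>The hypothesis is tested against modulated Gaussians that concentrate in frequency at \<open>z\<close>.\<close>

lemma gaussian_probe_inversion:
  fixes P :: "real^'m::finite \<Rightarrow> complex"
  assumes k: "k > 0" "d > 0" and P: "continuous_on UNIV P" "\<And>x. norm (P x) \<le> B"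
    and \<alpha>: "Re \<alpha> < 0" and "g \<noteq> 0"
    and eq: "fresnel k d (dist_of_fun P) = dist_of_fun (\<lambda>x. g * gauss (- \<alpha> * of_real (k / d)) x)"
  obtains C \<tau> where "C \<noteq> 0" "Re \<tau> \<ge> 0" "P = (\<lambda>x. C * gauss \<tau> x)"
proof -
  define \<kappa> where "\<kappa> = k / d"
  have \<kappa>: "\<kappa> > 0" using k by (simp add: \<kappa>_def)
  define h where "h = \<i> * complex_of_real \<kappa> / 2"
  have Re_h: "Re h = 0" by (simp add: h_def)
  have chirp_h: "chirp k d = gauss (- h)" by (simp add: chirp_eq_gauss h_def flip: \<kappa>_def)
  \<comment> \<open>Exponent of the propagated probe with the outer chirp divided out;
    \<open>Re \<alpha> < 0\<close> makes this Gaussian integrable.\<close>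
  define b where "b = h - \<alpha> * of_real \<kappa>"
  have b: "Re b > 0" using \<alpha> \<kappa> Re_h by (simp add: b_def mult_pos_neg mult_neg_pos)
  define N where "N = complex_of_real ((2 * pi) powr (- real CARD('m) / 2))"
  define c where "c = fresnel_const k d TYPE('m)"
  have c: "c \<noteq> 0" unfolding c_def by (rule fresnel_const_nonzero[OF k])
  define q where "q = (\<lambda>x. P x * chirp k d x)"
  have q: "continuous_on UNIV q" "\<And>x. norm (q x) \<le> B"
    using P by (auto simp: q_def norm_mult intro!: continuous_intros chirp_continuous)
  have [measurable]: "P \<in> borel_measurable borel" "q \<in> borel_measurable borel"
    using P(1) q(1) by (auto intro: borel_measurable_continuous_onI)
  define e where "e = (\<lambda>n. 1 / real (Suc n))"
  have e: "e n > 0" for n by (simp add: e_def)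
  have lim: "e \<longlonglongrightarrow> 0" unfolding e_def by (rule LIMSEQ_Suc[OF lim_1_over_n])
  \<comment> \<open>\<open>X\<close> and \<open>Y\<close> collect the constants of the two limits
    compared in \<open>qz\<close>: the mollification of \<open>q\<close> at \<open>z\<close>, and an
    explicit Gaussian transform.\<close>
  define X where "X = of_real (\<kappa> powr (- real CARD('m))) * N * of_real ((2 * sqrt pi) ^ CARD('m)) * of_real (sqrt pi ^ CARD('m))"
  define Y where "Y = g / c * csqrt (of_real pi / b) ^ CARD('m)"
  have X: "X \<noteq> 0" using \<kappa> by (simp add: X_def N_def)
  have Y: "Y \<noteq> 0" using b c \<open>g \<noteq> 0\<close> by (auto simp: Y_def)
  have qz: "X * q z = Y * gauss (1 / (4 * b)) (- \<kappa> *\<^sub>R z)" for z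
  proof -
    \<comment> \<open>For this width the transform of \<open>\<psi> n\<close> is a multiple of the
      Gaussian of scale \<open>e n\<close> centred at \<open>z\<close>.\<close>
    define s where "s = (\<lambda>n. complex_of_real ((e n)\<^sup>2 / 4))"
    have s: "Re (s n) > 0" for n using e[of n] by (simp add: s_def)
    define \<beta> where "\<beta> = (\<lambda>n. b + s n * of_real (\<kappa>\<^sup>2))"
    have \<beta>: "Re (\<beta> n) > 0" for n using b by (auto simp: \<beta>_def s_def intro: add_pos_nonneg)
    have lim\<beta>: "\<beta> \<longlonglongrightarrow> b"
    proof -
      have "(\<lambda>n. b + complex_of_real ((e n)\<^sup>2 / 4) * of_real (\<kappa>\<^sup>2)) \<longlonglongrightarrow> b + complex_of_real (0\<^sup>2 / 4) * of_real (\<kappa>\<^sup>2)"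
        by (intro tendsto_intros lim) simp
      then show ?thesis by (simp add: \<beta>_def s_def)
    qed
    define \<psi> where "\<psi> = (\<lambda>n (y :: real^'m). wave (- z) y * gauss (s n) y)"
    have \<psi>: "\<psi> n \<in> schwartz" for n unfolding \<psi>_def by (intro schwartz_wave_mult gauss_schwartz s)
    \<comment> \<open>Preimage of \<open>\<psi> n\<close> under \<open>fresnel_pullback\<close>:
      \<open>gauss h\<close> undoes the chirp, \<open>1 / c\<close> the constant.\<close>
    define \<phi> where "\<phi> = (\<lambda>n x. (1 / c) * (gauss h x * \<psi> n (\<kappa> *\<^sub>R x)))"
    have \<phi>: "\<phi> n \<in> schwartz" for n
      unfolding \<phi>_def using \<kappa> Re_h by (intro schwartz_cmult schwartz_gauss_mult schwartz_scale \<psi>) auto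
    have pull: "fresnel_pullback k d (\<phi> n) = \<psi> n" for n
    proof
      fix y :: "real^'m"
      have "gauss (- h) ((1 / \<kappa>) *\<^sub>R y) * gauss h ((1 / \<kappa>) *\<^sub>R y) = 1" unfolding gauss_add by simp
      then have "gauss (- h) ((1 / \<kappa>) *\<^sub>R y) * (gauss h ((1 / \<kappa>) *\<^sub>R y) * \<psi> n y) = \<psi> n y"
        by (simp flip: mult.assoc)
      then show "fresnel_pullback k d (\<phi> n) y = \<psi> n y"
        using \<kappa> c unfolding fresnel_pullback_def \<kappa>_def[symmetric] c_def[symmetric] chirp_h \<phi>_def
        by (simp add: mult.left_commute[of "gauss _ _" "1 / c"])
    qed
    have ft\<psi>: "ft (\<psi> n) x = csqrt (of_real pi / s n) ^ CARD('m) * gauss (1 / (4 * s n)) (x - z)" for n x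
    proof -
      have "\<psi> n y * wave x y = gauss (s n) y * wave (x - z) y" for y
        using wave_add_left[of "- z" x y] by (simp add: \<psi>_def)
      then show ?thesis using gauss_fourier[OF s, of n "x - z"] by (simp add: ft_def)
    qed
    have lhs: "fresnel k d (dist_of_fun P) (\<phi> n) =
        of_real (\<kappa> powr (- real CARD('m))) * N * of_real ((2 * sqrt pi) ^ CARD('m)) * (LINT y|lborel. gauss 1 y * q (z + e n *\<^sub>R y))" for n
    proof -
      have "fresnel k d (dist_of_fun P) (\<phi> n) = of_real (\<kappa> powr (- real CARD('m))) *
          dist_of_fun P (\<lambda>x. chirp k d x * fourier (\<psi> n) x)"
        unfolding fresnel_apply[OF k \<phi>] pull \<kappa>_def ..
      also have "dist_of_fun P (\<lambda>x. chirp k d x * fourier (\<psi> n) x) = (LINT x|lborel. P x * (chirp k d x * fourier (\<psi> n) x))"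
        by (intro dist_of_fun_apply schwartz_chirp_mult fourier_schwartz \<psi>) simp
      also have "\<dots> = (LINT x|lborel. (N * csqrt (of_real pi / s n) ^ CARD('m)) * (q x * gauss (1 / (4 * s n)) (x - z)))"
        by (simp add: fourier_eq_ft[OF \<psi>] ft\<psi> N_def q_def mult_ac)
      also have "\<dots> = (N * csqrt (of_real pi / s n) ^ CARD('m)) * (LINT x|lborel. q x * gauss (1 / (4 * s n)) (x - z))"
        by (rule integral_mult_right_zero)
      also have "(LINT x|lborel. q x * gauss (1 / (4 * s n)) (x - z)) = of_real (\<bar>e n\<bar> ^ DIM(real^'m)) *
          (LINT y|lborel. q (z + e n *\<^sub>R y) * gauss (1 / (4 * s n)) (z + e n *\<^sub>R y - z))"
        using e[of n] by (intro lborel_integral_affine) auto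
      also have "(\<lambda>y. q (z + e n *\<^sub>R y) * gauss (1 / (4 * s n)) (z + e n *\<^sub>R y - z)) = (\<lambda>y. gauss 1 y * q (z + e n *\<^sub>R y))"
        using e[of n] by (auto simp: fun_eq_iff gauss_scale s_def)
      \<comment> \<open>Its power cancels the Jacobian \<open>\<bar>e n\<bar> ^ CARD('m)\<close>, so
        the prefactor does not depend on \<open>n\<close>.\<close>
      also have "csqrt (of_real pi / s n) = of_real (2 * sqrt pi / e n)"
      proof -
        have "of_real pi / s n = of_real ((2 * sqrt pi / e n)\<^sup>2)"
          using e[of n] by (simp add: s_def field_simps)
        moreover have "2 * sqrt pi / e n \<ge> 0" using e[of n] by simp
        ultimately show ?thesis using e[of n] by (simp del: of_real_divide of_real_mult of_real_power add: csqrt_of_real_nonneg)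
      qed
      finally have "fresnel k d (dist_of_fun P) (\<phi> n) = of_real (\<kappa> powr (- real CARD('m))) *
         (N * of_real (2 * sqrt pi / e n) ^ CARD('m) * (of_real (\<bar>e n\<bar> ^ CARD('m)) * (LINT y|lborel. gauss 1 y * q (z + e n *\<^sub>R y))))"
        by simp
      moreover have "complex_of_real (2 * sqrt pi / e n) ^ CARD('m) * of_real (\<bar>e n\<bar> ^ CARD('m)) = of_real ((2 * sqrt pi) ^ CARD('m))"
        using e[of n] by (simp add: power_divide)
      ultimately show ?thesis by (metis (no_types, lifting) mult.assoc)
    qed
    have rhs: "dist_of_fun (\<lambda>x. g * gauss (- \<alpha> * of_real (k / d)) x) (\<phi> n) =
        g / c * csqrt (of_real pi / \<beta> n) ^ CARD('m) * gauss (1 / (4 * \<beta> n)) (- \<kappa> *\<^sub>R z)" for n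
    proof -
      have "dist_of_fun (\<lambda>x. g * gauss (- \<alpha> * of_real (k / d)) x) (\<phi> n) =
          (LINT x|lborel. g * gauss (- \<alpha> * of_real \<kappa>) x * \<phi> n x)"
        unfolding \<kappa>_def by (rule dist_of_fun_apply[OF \<phi>]) measurable
      also have "(\<lambda>x. g * gauss (- \<alpha> * of_real \<kappa>) x * \<phi> n x) = (\<lambda>x. g / c * (gauss (\<beta> n) x * wave (- \<kappa> *\<^sub>R z) x))"
      proof
        fix x :: "real^'m"
        have "gauss (- \<alpha> * of_real \<kappa>) x * (gauss h x * gauss (s n) (\<kappa> *\<^sub>R x)) = gauss (\<beta> n) x"
          unfolding gauss_scale gauss_add by (simp add: \<beta>_def b_def algebra_simps)
        moreover have "wave (- z) (\<kappa> *\<^sub>R x) = wave (- \<kappa> *\<^sub>R z) x" by (simp add: wave_def)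
        ultimately show "g * gauss (- \<alpha> * of_real \<kappa>) x * \<phi> n x = g / c * (gauss (\<beta> n) x * wave (- \<kappa> *\<^sub>R z) x)"
          by (simp add: \<phi>_def \<psi>_def mult_ac flip: \<open>_ = gauss (\<beta> n) x\<close>)
      qed
      also have "(LINT x|lborel. g / c * (gauss (\<beta> n) x * wave (- \<kappa> *\<^sub>R z) x)) =
          g / c * (LINT x|lborel. gauss (\<beta> n) x * wave (- \<kappa> *\<^sub>R z) x)"
        by (rule integral_mult_right_zero)
      finally show ?thesis unfolding gauss_fourier[OF \<beta>] by (simp add: mult.assoc)
    qed
    have "(\<lambda>n. of_real (\<kappa> powr (- real CARD('m))) * N * of_real ((2 * sqrt pi) ^ CARD('m)) * (LINT y|lborel. gauss 1 y * q (z + e n *\<^sub>R y)))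
        \<longlonglongrightarrow> of_real (\<kappa> powr (- real CARD('m))) * N * of_real ((2 * sqrt pi) ^ CARD('m)) * (of_real (sqrt pi ^ DIM(real^'m)) * q z)"
      by (intro tendsto_mult tendsto_const gauss_average_tendsto[OF q lim])
    then have "(\<lambda>n. fresnel k d (dist_of_fun P) (\<phi> n)) \<longlonglongrightarrow> X * q z"
      unfolding lhs by (simp add: X_def mult.assoc)
    moreover have "(\<lambda>n. g / c * csqrt (of_real pi / \<beta> n) ^ CARD('m) * gauss (1 / (4 * \<beta> n)) (- \<kappa> *\<^sub>R z))
        \<longlonglongrightarrow> Y * gauss (1 / (4 * b)) (- \<kappa> *\<^sub>R z)"
      unfolding Y_def gauss_def
    proof (intro tendsto_intros lim\<beta>)
      have "Re (of_real pi / b) > 0"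
        using b by (auto simp: Re_divide intro!: divide_pos_pos sum_power2_gt_zero_iff[THEN iffD2])
      then have "of_real pi / b \<notin> \<real>\<^sub>\<le>\<^sub>0" by (auto simp: complex_nonpos_Reals_iff)
      then show "(\<lambda>n. csqrt (of_real pi / \<beta> n)) \<longlonglongrightarrow> csqrt (of_real pi / b)"
        using b by (intro isCont_tendsto_compose[OF continuous_at_csqrt] tendsto_intros lim\<beta>) auto
    qed (use b in auto)
    then have "(\<lambda>n. fresnel k d (dist_of_fun P) (\<phi> n)) \<longlonglongrightarrow> Y * gauss (1 / (4 * b)) (- \<kappa> *\<^sub>R z)"
      unfolding eq rhs .
    ultimately show ?thesis by (rule LIMSEQ_unique)
  qed
  have "P z = (Y / X) * gauss (1 / (4 * b) * of_real (\<kappa>\<^sup>2) + h) z" for z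
  proof -
    have "P z = q z * gauss h z"
      unfolding q_def chirp_h mult.assoc gauss_add by simp
    also have "q z = (Y / X) * gauss (1 / (4 * b)) (- \<kappa> *\<^sub>R z)" using qz[of z] X by (simp add: field_simps)
    finally show ?thesis unfolding gauss_scale mult.assoc gauss_add by simp
  qed
  moreover have "Re (1 / (4 * b) * of_real (\<kappa>\<^sup>2) + h) \<ge> 0"
    using Re_inverse_nonneg[of b] b Re_h unfolding plus_complex.simps by (simp only: Re_complex_of_real Im_complex_of_real times_complex.simps) simp
  ultimately show thesis using X Y by (intro that[of "Y / X" "1 / (4 * b) * of_real (\<kappa>\<^sup>2) + h"]) auto
qed

text \<open>What the rest of the proof uses of a probe: \<open>P\<close> is bounded and can be
  divided out, and the propagated field is a nonvanishing Gaussian with known signs of the exponent.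
  The plane wave is the case \<open>\<tau> = 0\<close>, \<open>\<alpha> = 0\<close>.\<close>

lemma probe_normal_form:
  fixes P :: "real^'m::finite \<Rightarrow> complex"
  assumes k: "k > 0" "d > 0" and probe: "plane_wave P \<or> gaussian_probe k d P"
  obtains C \<tau> C' \<alpha> where "C \<noteq> 0" "Re \<tau> \<ge> 0" "P = (\<lambda>x. C * gauss \<tau> x)"
    "C' \<noteq> 0" "Re \<alpha> \<le> 0" "Im \<alpha> \<le> 0"
    "\<forall>\<phi>\<in>schwartz. fresnel k d (dist_of_fun P) \<phi> =
      (LINT x|lborel. C' * gauss (- \<alpha> * of_real (k / d)) x * \<phi> x)"
  using probe
proof
  assume "plane_wave P"
  then obtain p0 where p0: "p0 \<noteq> 0" "P = (\<lambda>_. p0)" by (auto simp: plane_wave_def)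
  define C' where "C' = of_real ((2 * pi) powr (- real CARD('m) / 2)) * fresnel_const k d TYPE('m) *
      (p0 * csqrt (of_real pi / (- \<i> * of_real (k / d) / 2)) ^ CARD('m))"
  show thesis
  proof (rule that[of p0 0 C' 0])
    show "C' \<noteq> 0" using p0 k by (simp add: C'_def fresnel_const_nonzero)
    show "\<forall>\<phi>\<in>schwartz. fresnel k d (dist_of_fun P) \<phi> = (LINT x|lborel. C' * gauss (- 0 * of_real (k / d)) x * \<phi> x)"
    proof
      fix \<phi> :: "real^'m \<Rightarrow> complex" assume "\<phi> \<in> schwartz"
      then show "fresnel k d (dist_of_fun P) \<phi> = (LINT x|lborel. C' * gauss (- 0 * of_real (k / d)) x * \<phi> x)"
        using plane_wave_propagated[OF k, of \<phi> p0] by (simp add: p0 C'_def)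
    qed
  qed (use p0 in auto)
next
  assume "gaussian_probe k d P"
  then obtain p0 \<alpha> where P: "continuous_on UNIV P" "bounded (range P)" and p0: "p0 \<noteq> 0" and \<alpha>: "Re \<alpha> < 0" "Im \<alpha> \<le> 0"
    and eq: "fresnel k d (dist_of_fun P) =
      dist_of_fun (\<lambda>x. p0 * exp (\<i> * of_real (k * d)) * exp (\<alpha> * of_real (k / d * (x \<bullet> x))))"
    unfolding gaussian_probe_def by blast
  define g where "g = p0 * exp (\<i> * of_real (k * d))"
  have eq': "fresnel k d (dist_of_fun P) = dist_of_fun (\<lambda>x. g * gauss (- \<alpha> * of_real (k / d)) x)"
    unfolding eq by (rule arg_cong[where f = dist_of_fun]) (simp add: g_def gauss_def fun_eq_iff mult.assoc)
  obtain B where B: "\<And>x. norm (P x) \<le> B" using P(2) by (auto simp: bounded_iff)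
  have g: "g \<noteq> 0" using p0 by (simp add: g_def)
  obtain C \<tau> where C: "C \<noteq> 0" "Re \<tau> \<ge> 0" "P = (\<lambda>x. C * gauss \<tau> x)"
    using gaussian_probe_inversion[OF k P(1) B \<alpha>(1) g eq'] by blast
  show thesis
  proof (rule that[OF C g _ \<alpha>(2)])
    show "\<forall>\<phi>\<in>schwartz. fresnel k d (dist_of_fun P) \<phi> = (LINT x|lborel. g * gauss (- \<alpha> * of_real (k / d)) x * \<phi> x)"
      unfolding eq' by (intro ballI dist_of_fun_apply) measurable
  qed (use \<alpha> in simp)
qed

section \<open>Object transmission functions\<close>

text \<open>The transmission function is only known to be Lebesgue measurable, whereas the Fourier
  theory above lives on \<open>lborel\<close>.\<close>

lemma integrable_lebesgue_imp_borel:
  fixes f :: "'a::euclidean_space \<Rightarrow> complex"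
  assumes f: "integrable lebesgue f"
  obtains g where "integrable lborel g" "AE x in lebesgue. f x = g x"
proof -
  have [measurable]: "f \<in> borel_measurable lebesgue" using f by simp
  obtain u where u: "u \<in> borel_measurable lborel" "AE x in lborel. Re (f x) = u x"
    using completion_ex_borel_measurable_real[of "\<lambda>x. Re (f x)" lborel] by auto
  obtain v where v: "v \<in> borel_measurable lborel" "AE x in lborel. Im (f x) = v x"
    using completion_ex_borel_measurable_real[of "\<lambda>x. Im (f x)" lborel] by auto
  define g where "g = (\<lambda>x. of_real (u x) + \<i> * of_real (v x))"
  have [measurable]: "g \<in> borel_measurable lborel" unfolding g_def using u(1) v(1) by measurable
  have "AE x in lborel. f x = g x"
    using u(2) v(2) by eventually_elim (simp add: g_def complex_eq_iff)
  then have ae: "AE x in lebesgue. f x = g x" by (rule AE_completion)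
  have "g \<in> borel_measurable lebesgue" by (rule measurable_completion) measurable
  then have "integrable lebesgue g"
    using f ae by (subst integrable_cong_AE[of g lebesgue f]) auto
  then have "integrable lborel g" by (subst (asm) integrable_completion) auto
  then show thesis using ae by (rule that)
qed

lemma sample_component_support:
  assumes "sample_component L f"
  obtains R where "\<And>x z. norm x > R \<Longrightarrow> f (x, z) = 0"
proof -
  have "bounded (closure {p. f p \<noteq> 0})"
    using assms by (auto simp: sample_component_def compact_imp_bounded)
  then obtain R where R: "\<And>p. p \<in> closure {p. f p \<noteq> 0} \<Longrightarrow> norm p \<le> R"
    by (auto simp: bounded_iff)
  have "f (x, z) = 0" if "norm x > R" for x z
  proof (rule ccontr)
    assume "f (x, z) \<noteq> 0"
    then have "(x, z) \<in> closure {p. f p \<noteq> 0}" using closure_subset[of "{p. f p \<noteq> 0}"] by auto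
    then show False using R[of "(x, z)"] norm_fst_le[of x z] that by simp
  qed
  then show thesis by (rule that)
qed

text \<open>Lines that miss the sample have transmission 1, so the deviation from 1 is confined to a
  ball, where local integrability makes it integrable.\<close>

lemma object_transmission_normal_form:
  fixes Ob :: "'m::finite functional"
  assumes "Ob \<in> object_transmission k L"
  obtains h R where "integrable lborel h" "\<And>x. norm x > R \<Longrightarrow> h x = 0" "Ob = dist_of_fun (\<lambda>x. 1 + h x)"
proof -
  obtain \<delta> \<beta> where samples: "sample_component L \<delta>" "sample_component L \<beta>"
    and int: "\<And>K. compact K \<Longrightarrow> transmission k L \<delta> \<beta> absolutely_integrable_on K"
    and Ob: "Ob = dist_of_fun (transmission k L \<delta> \<beta>)"
    using assms unfolding object_transmission_def by blast
  define t where "t = transmission k L \<delta> \<beta>"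
  obtain R1 where R1: "\<And>x z. norm x > R1 \<Longrightarrow> \<delta> (x, z) = 0" using sample_component_support[OF samples(1)] by blast
  obtain R2 where R2: "\<And>x z. norm x > R2 \<Longrightarrow> \<beta> (x, z) = 0" using sample_component_support[OF samples(2)] by blast
  define R where "R = max R1 R2"
  have outside: "t x = 1" if "norm x > R" for x
    using that R1[of x] R2[of x] by (simp add: t_def transmission_def R_def)
  define B where "B = cball (0 :: real^'m) R"
  have "t absolutely_integrable_on B" "(\<lambda>_. 1 :: complex) absolutely_integrable_on B"
    unfolding t_def B_def by (auto intro!: int absolutely_integrable_on_const)
  then have "set_integrable lebesgue B (\<lambda>x. t x - 1)" by (rule set_integral_diff)
  then have "integrable lebesgue (\<lambda>x. indicator B x *\<^sub>R (t x - 1))" by (simp add: set_integrable_def)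
  also have "(\<lambda>x. indicator B x *\<^sub>R (t x - 1)) = (\<lambda>x. t x - 1)"
    using outside by (auto simp: fun_eq_iff B_def indicator_def)
  finally have t1: "integrable lebesgue (\<lambda>x. t x - 1)" .
  then obtain g where g: "integrable lborel g" "AE x in lebesgue. t x - 1 = g x"
    using integrable_lebesgue_imp_borel by blast
  have [measurable]: "g \<in> borel_measurable borel" using borel_measurable_integrable[OF g(1)] by simp
  \<comment> \<open>\<open>g\<close> equals \<open>t - 1\<close> only almost everywhere; the cutoff
    makes it vanish at every point outside the ball.\<close>
  define h where "h = (\<lambda>x. indicator B x *\<^sub>R g x)"
  have h: "integrable lborel h"
    unfolding h_def by (intro integrable_mult_indicator g(1)) (simp add: B_def)
  have [measurable]: "h \<in> borel_measurable borel" using borel_measurable_integrable[OF h] by simp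
  have tm: "t \<in> borel_measurable lebesgue"
    using borel_measurable_add[OF borel_measurable_integrable[OF t1] borel_measurable_const[of 1]] by simp
  have ae: "AE x in lebesgue. t x = 1 + h x"
    using g(2) by eventually_elim (use outside in \<open>auto simp: h_def B_def indicator_def algebra_simps\<close>)
  have "dist_of_fun t = dist_of_fun (\<lambda>x. 1 + h x)"
    unfolding dist_of_fun_def
  proof (rule restrict_ext)
    fix \<phi> :: "real^'m \<Rightarrow> complex" assume "\<phi> \<in> schwartz"
    then have [measurable]: "\<phi> \<in> borel_measurable borel" by (rule schwartz_measurable)
    have \<phi>': "\<phi> \<in> borel_measurable lebesgue" by (rule measurable_completion) measurable
    have h': "h \<in> borel_measurable lebesgue" by (rule measurable_completion) measurable
    show "(LINT x|lebesgue. t x * \<phi> x) = (LINT x|lebesgue. (1 + h x) * \<phi> x)"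
    proof (rule integral_cong_AE)
      show "AE x in lebesgue. t x * \<phi> x = (1 + h x) * \<phi> x" using ae by eventually_elim simp
    qed (intro borel_measurable_times borel_measurable_add borel_measurable_const tm \<phi>' h')+
  qed
  then show thesis
    using h by (intro that[of h R]) (auto simp: Ob t_def h_def B_def)
qed

section \<open>The fields at the detector as continuous functions\<close>

lemma schwartz_integrable_mult:
  assumes h: "integrable lborel h" and \<phi>: "\<phi> \<in> schwartz"
  shows "integrable lborel (\<lambda>x. h x * \<phi> x)"
proof -
  obtain C where C: "\<And>x. norm (\<phi> x) \<le> C" using schwartz_bounded[OF \<phi>] by blast
  show ?thesis using schwartz_measurable[OF \<phi>] by (intro integrable_bounded_mult[OF h _ C]) auto
qed

lemma dist_of_fun_one_plus:
  assumes h: "integrable lborel h" and \<phi>: "\<phi> \<in> schwartz"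
  shows "dist_of_fun (\<lambda>x. 1 + h x) \<phi> = (LINT x|lborel. \<phi> x) + (LINT x|lborel. h x * \<phi> x)"
proof -
  have "h \<in> borel_measurable borel" using borel_measurable_integrable[OF h] by simp
  then show ?thesis
    using schwartz_integrable[OF \<phi>] schwartz_integrable_mult[OF h \<phi>]
    by (simp add: dist_of_fun_apply[OF \<phi>] ring_distribs)
qed

lemma probe_mult_schwartz:
  "Re \<tau> \<ge> 0 \<Longrightarrow> P = (\<lambda>x. C * gauss \<tau> x) \<Longrightarrow> \<phi> \<in> schwartz \<Longrightarrow> (\<lambda>x. P x * \<phi> x) \<in> schwartz"
  by (simp add: mult.assoc schwartz_cmult schwartz_gauss_mult)

lemma probe_mult_integrable:
  assumes \<tau>: "Re \<tau> \<ge> 0" and P: "P = (\<lambda>x. C * gauss \<tau> x)" and h: "integrable lborel h"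
  shows "integrable lborel (\<lambda>x. P x * h x)"
proof -
  have [measurable]: "P \<in> borel_measurable borel" unfolding P by measurable
  have "norm (P x) \<le> norm C" for x
    using norm_gauss_le_1[OF \<tau>, of x] by (simp add: P norm_mult mult_left_le)
  then show ?thesis
    using integrable_bounded_mult[OF h, of P "norm C"] by (simp add: mult.commute)
qed

lemma density_scattered:
  fixes P h :: "real^'m::finite \<Rightarrow> complex"
  assumes k: "k > 0" "d > 0" and \<tau>: "Re \<tau> \<ge> 0" and P: "P = (\<lambda>x. C * gauss \<tau> x)"
    and h: "integrable lborel h"
  shows "dist_density (fresnel k d (dist_mult P (dist_diff (dist_of_fun (\<lambda>x. 1 + h x)) (dist_of_fun (\<lambda>_. 1))))) =
    fresnel_density k d (ft (\<lambda>x. chirp k d x * (P x * h x)))"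
proof -
  have [measurable]: "P \<in> borel_measurable borel" unfolding P by measurable
  note Ph = probe_mult_integrable[OF \<tau> P h]
  have int: "integrable lborel (\<lambda>x. chirp k d x * (P x * h x))"
    by (intro integrable_chirp_mult Ph)
  note cont = fresnel_density_continuous[OF int]
  obtain B where B: "\<And>x. norm (fresnel_density k d (ft (\<lambda>x. chirp k d x * (P x * h x))) x) \<le> B"
    using fresnel_density_bounded[OF int] by blast
  have "fresnel k d (dist_mult P (dist_diff (dist_of_fun (\<lambda>x. 1 + h x)) (dist_of_fun (\<lambda>_. 1)))) =
      dist_of_fun (fresnel_density k d (ft (\<lambda>x. chirp k d x * (P x * h x))))"
  proof (rule dist_of_fun_eqI[OF fresnel_extensional borel_measurable_continuous_onI[OF cont]],
      rule fresnel_integrable[OF k _ _ Ph])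
    fix \<omega> :: "real^'m \<Rightarrow> complex" assume \<omega>: "\<omega> \<in> schwartz"
    note P\<omega> = probe_mult_schwartz[OF \<tau> P \<omega>]
    have "dist_of_fun (\<lambda>_. 1) (\<lambda>x. P x * \<omega> x) = (LINT x|lborel. P x * \<omega> x)"
      by (subst dist_of_fun_apply[OF P\<omega>]) auto
    then show "dist_mult P (dist_diff (dist_of_fun (\<lambda>x. 1 + h x)) (dist_of_fun (\<lambda>_. 1))) \<omega> =
        (LINT x|lborel. P x * h x * \<omega> x)"
      using \<omega> P\<omega> dist_of_fun_one_plus[OF h P\<omega>]
      by (simp add: dist_mult_def dist_diff_def mult_ac)
  qed
  then show ?thesis using dist_density_eq[OF cont B] by simp
qed

text \<open>\<open>P\<close> itself need not be integrable. The field is therefore split: the probe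
  is propagated by hypothesis, and only \<open>P h\<close> goes through an ordinary Fourier
  transform. Both parts are bounded and continuous, as \<open>dist_density_eq\<close>
  requires.\<close>

lemma density_total:
  fixes P h :: "real^'m::finite \<Rightarrow> complex"
  assumes k: "k > 0" "d > 0" and \<tau>: "Re \<tau> \<ge> 0" and P: "P = (\<lambda>x. C * gauss \<tau> x)"
    and \<alpha>: "Re \<alpha> \<le> 0"
    and propagated: "\<forall>\<phi>\<in>schwartz. fresnel k d (dist_of_fun P) \<phi> =
      (LINT x|lborel. C' * gauss (- \<alpha> * of_real (k / d)) x * \<phi> x)"
    and h: "integrable lborel h"
  shows "dist_density (fresnel k d (dist_mult P (dist_of_fun (\<lambda>x. 1 + h x)))) =
    (\<lambda>x. C' * gauss (- \<alpha> * of_real (k / d)) x + fresnel_density k d (ft (\<lambda>x. chirp k d x * (P x * h x))) x)"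
proof -
  have [measurable]: "P \<in> borel_measurable borel" unfolding P by measurable
  note Ph = probe_mult_integrable[OF \<tau> P h]
  have int: "integrable lborel (\<lambda>x. chirp k d x * (P x * h x))"
    by (intro integrable_chirp_mult Ph)
  define p where "p = (\<lambda>x::real^'m. C' * gauss (- \<alpha> * of_real (k / d)) x)"
  define w where "w = fresnel_density k d (ft (\<lambda>x. chirp k d x * (P x * h x)))"
  have wc: "continuous_on UNIV w" unfolding w_def by (rule fresnel_density_continuous[OF int])
  obtain B where B: "\<And>x. norm (w x) \<le> B" unfolding w_def using fresnel_density_bounded[OF int] by blast
  have pc: "continuous_on UNIV p" unfolding p_def by (intro continuous_intros gauss_continuous_on)
  have pb: "norm (p x) \<le> norm C'" for x
  proof -
    have "Re (- \<alpha> * of_real (k / d)) \<ge> 0"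
    proof -
      have "Re \<alpha> * (k / d) \<le> 0" using \<alpha> k by (intro mult_nonpos_nonneg) auto
      then show ?thesis by (simp del: of_real_divide)
    qed
    from norm_gauss_le_1[OF this, of x] show ?thesis
      by (simp add: p_def norm_mult mult_left_le del: of_real_divide)
  qed
  have [measurable]: "p \<in> borel_measurable borel" "w \<in> borel_measurable borel"
    using pc wc by (auto intro: borel_measurable_continuous_onI)
  have "fresnel k d (dist_mult P (dist_of_fun (\<lambda>x. 1 + h x))) = dist_of_fun (\<lambda>x. p x + w x)"
  proof (rule dist_of_fun_eqI[OF fresnel_extensional])
    fix \<phi> :: "real^'m \<Rightarrow> complex" assume \<phi>: "\<phi> \<in> schwartz"
    have T: "dist_mult P (dist_of_fun (\<lambda>x. 1 + h x)) \<omega> = dist_of_fun P \<omega> + dist_of_fun (\<lambda>x. P x * h x) \<omega>"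
      if \<omega>: "\<omega> \<in> schwartz" for \<omega>
    proof -
      note P\<omega> = probe_mult_schwartz[OF \<tau> P \<omega>]
      have "dist_of_fun P \<omega> = (LINT x|lborel. P x * \<omega> x)"
        by (rule dist_of_fun_apply[OF \<omega>]) measurable
      moreover have "dist_of_fun (\<lambda>x. P x * h x) \<omega> = (LINT x|lborel. P x * h x * \<omega> x)"
        using borel_measurable_integrable[OF Ph] by (intro dist_of_fun_apply[OF \<omega>]) simp
      ultimately show ?thesis
        using \<omega> dist_of_fun_one_plus[OF h P\<omega>] by (simp add: dist_mult_def mult_ac)
    qed
    define \<omega> where "\<omega> = (\<lambda>x. chirp k d x * fourier (fresnel_pullback k d \<phi>) x)"
    have \<omega>: "\<omega> \<in> schwartz"
      unfolding \<omega>_def by (intro schwartz_chirp_mult fourier_schwartz fresnel_pullback_schwartz k \<phi>)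
    have "fresnel k d (dist_mult P (dist_of_fun (\<lambda>x. 1 + h x))) \<phi> =
        fresnel k d (dist_of_fun P) \<phi> + fresnel k d (dist_of_fun (\<lambda>x. P x * h x)) \<phi>"
      unfolding fresnel_apply[OF k \<phi>] \<omega>_def[symmetric] T[OF \<omega>] by (simp add: ring_distribs)
    also have "fresnel k d (dist_of_fun P) \<phi> = (LINT x|lborel. p x * \<phi> x)"
      unfolding p_def by (rule bspec[OF propagated \<phi>])
    also have "fresnel k d (dist_of_fun (\<lambda>x. P x * h x)) \<phi> = (LINT x|lborel. w x * \<phi> x)"
      unfolding w_def
      using borel_measurable_integrable[OF Ph]
      by (intro fresnel_integrable[OF k \<phi> _ Ph] dist_of_fun_apply) auto
    also have "(LINT x|lborel. p x * \<phi> x) + (LINT x|lborel. w x * \<phi> x) = (LINT x|lborel. (p x + w x) * \<phi> x)"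
    proof -
      have "integrable lborel (\<lambda>x. \<phi> x * p x)" "integrable lborel (\<lambda>x. \<phi> x * w x)"
        by (auto intro!: integrable_bounded_mult[OF schwartz_integrable[OF \<phi>] _ pb]
            integrable_bounded_mult[OF schwartz_integrable[OF \<phi>] _ B])
      then show ?thesis by (simp add: ring_distribs mult.commute)
    qed
    finally show "fresnel k d (dist_mult P (dist_of_fun (\<lambda>x. 1 + h x))) \<phi> = (LINT x|lborel. (p x + w x) * \<phi> x)" .
  qed measurable
  moreover have "dist_density (dist_of_fun (\<lambda>x. p x + w x)) = (\<lambda>x. p x + w x)"
  proof (rule dist_density_eq)
    show "continuous_on UNIV (\<lambda>x. p x + w x)" by (intro continuous_intros pc wc)
    show "norm (p x + w x) \<le> norm C' + B" for x
      using pb[of x] B[of x] norm_triangle_ineq[of "p x" "w x"] by linarith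
  qed
  ultimately show ?thesis by (simp add: p_def w_def)
qed

section \<open>Fourier transforms of compactly supported functions on complex lines\<close>

text \<open>The entire extension of \<open>ft f\<close> to the complex line \<open>x0 + t v\<close>,
  with \<open>t\<close> isolated in one exponent as \<open>exp_integral_holomorphic\<close>
  expects.\<close>

definition ft_line :: "(real^'m::finite \<Rightarrow> complex) \<Rightarrow> real^'m \<Rightarrow> real^'m \<Rightarrow> complex \<Rightarrow> complex" where
  "ft_line f x0 v t = (LINT x|lborel. (f x * wave x0 x) * exp (t * (- \<i> * of_real (v \<bullet> x))))"

lemma ft_line_of_real: "ft_line f x0 v (of_real t) = ft f (x0 + t *\<^sub>R v)"
proof -
  have "wave x0 x * exp (of_real t * (- \<i> * of_real (v \<bullet> x))) = wave (x0 + t *\<^sub>R v) x" for x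
    by (simp add: wave_def inner_add_left algebra_simps flip: exp_add)
  then show ?thesis by (simp add: ft_line_def ft_def mult.assoc)
qed

text \<open>The easy half of Paley-Wiener: \<open>\<bar>v \<bullet> x\<bar>\<close> is at most
  \<open>K\<close> on the support, and \<open>K\<close> becomes the type.\<close>

lemma exp_type_ft_line:
  assumes f: "integrable lborel f" and supp: "\<And>x. norm x > R \<Longrightarrow> f x = 0"
  shows "exp_type (ft_line f x0 v)"
proof -
  have [measurable]: "f \<in> borel_measurable borel" using borel_measurable_integrable[OF f] by simp
  define K where "K = norm v * \<bar>R\<bar>"
  have vx: "\<bar>v \<bullet> x\<bar> \<le> K" if "f x \<noteq> 0" for x
  proof -
    have "norm x \<le> R" using supp that by force
    then have "norm v * norm x \<le> norm v * \<bar>R\<bar>" by (intro mult_left_mono) auto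
    then show ?thesis using Cauchy_Schwarz_ineq2[of v x] by (simp add: K_def)
  qed
  have le: "norm (f x * wave x0 x * exp (t * (- \<i> * of_real (v \<bullet> x)))) \<le> exp (K * norm t) * norm (f x)" for x t
  proof (cases "f x = 0")
    case False
    have "norm (exp (t * (- \<i> * of_real (v \<bullet> x)))) \<le> exp (norm (t * (- \<i> * of_real (v \<bullet> x))))" by (rule norm_exp)
    also have "\<dots> \<le> exp (K * norm t)"
      using mult_right_mono[OF vx[OF False], of "norm t"] by (simp add: norm_mult mult.commute)
    finally show ?thesis by (simp add: norm_mult mult.commute[of _ "norm (f x)"] mult_left_mono)
  qed simp
  show ?thesis
  proof (rule exp_typeI)
    show "ft_line f x0 v holomorphic_on UNIV"
      unfolding ft_line_def[abs_def]
    proof (rule exp_integral_holomorphic)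
      fix t
      show "\<exists>r>0. integrable lborel (\<lambda>x. norm (f x * wave x0 x * exp (t * (- \<i> * of_real (v \<bullet> x)))) * exp (r * norm (- \<i> * complex_of_real (v \<bullet> x))))"
      proof (intro exI[of _ 1] conjI)
        show "integrable lborel (\<lambda>x. norm (f x * wave x0 x * exp (t * (- \<i> * of_real (v \<bullet> x)))) * exp (1 * norm (- \<i> * complex_of_real (v \<bullet> x))))"
        proof (rule Bochner_Integration.integrable_bound)
          show "integrable lborel (\<lambda>x. exp (K * norm t) * norm (f x) * exp K)" using f by simp
          show "AE x in lborel. norm (norm (f x * wave x0 x * exp (t * (- \<i> * of_real (v \<bullet> x)))) * exp (1 * norm (- \<i> * complex_of_real (v \<bullet> x))))
              \<le> norm (exp (K * norm t) * norm (f x) * exp K)"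
          proof (rule AE_I2)
            fix x
            show "norm (norm (f x * wave x0 x * exp (t * (- \<i> * of_real (v \<bullet> x)))) * exp (1 * norm (- \<i> * complex_of_real (v \<bullet> x))))
              \<le> norm (exp (K * norm t) * norm (f x) * exp K)"
            proof (cases "f x = 0")
              case False
              have "norm (f x * wave x0 x * exp (t * (- \<i> * of_real (v \<bullet> x)))) * exp (1 * norm (- \<i> * complex_of_real (v \<bullet> x)))
                \<le> exp (K * norm t) * norm (f x) * exp K"
                using vx[OF False] by (intro mult_mono le) (auto simp: norm_mult)
              then show ?thesis by (simp add: abs_mult)
            qed simp
          qed
        qed measurable
      qed simp
    qed auto
    fix t
    have "norm (ft_line f x0 v t) \<le> (LINT x|lborel. norm (f x * wave x0 x * exp (t * (- \<i> * of_real (v \<bullet> x)))))"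
      unfolding ft_line_def by (rule integral_norm_bound)
    also have "\<dots> \<le> (LINT x|lborel. exp (K * norm t) * norm (f x))"
    proof (rule integral_mono)
      show i: "integrable lborel (\<lambda>x. exp (K * norm t) * norm (f x))" using f by simp
      show "integrable lborel (\<lambda>x. norm (f x * wave x0 x * exp (t * (- \<i> * of_real (v \<bullet> x)))))"
      proof (rule Bochner_Integration.integrable_bound[OF i])
        show "AE x in lborel. norm (norm (f x * wave x0 x * exp (t * (- \<i> * of_real (v \<bullet> x))))) \<le> norm (exp (K * norm t) * norm (f x))"
          using le[of _ t] by (intro AE_I2) (simp add: abs_mult)
      qed measurable
    qed (rule le)
    finally show "norm (ft_line f x0 v t) \<le> (LINT x|lborel. norm (f x)) * exp (K * norm t)" by (simp add: mult.commute)
  qed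
qed

text \<open>Both kinds of data give this identity, with \<open>s = 1\<close> for the intensities and \<open>s = 0\<close> for the
  linearized ones; \<open>a\<close> collects the quadratic phases of the conjugated probe and of the chirp.\<close>

lemma interference_identity_unique:
  fixes f f' :: "real^'m::finite \<Rightarrow> complex" and s :: complex
  assumes f: "integrable lborel f" "\<And>x. norm x > R \<Longrightarrow> f x = 0"
    and f': "integrable lborel f'" "\<And>x. norm x > R' \<Longrightarrow> f' x = 0"
    and a: "Im a > 0" and c: "c \<noteq> 0" and \<kappa>: "\<kappa> > (0::real)" and U: "open U" "U \<noteq> {}"
    and eq: "\<And>x. x \<in> U \<Longrightarrow>
      (let z = c * exp (a * of_real (x \<bullet> x)) * (ft f (\<kappa> *\<^sub>R x) - ft f' (\<kappa> *\<^sub>R x)) in z + cnj z) +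
      s * (ft f (\<kappa> *\<^sub>R x) * cnj (ft f (\<kappa> *\<^sub>R x)) - ft f' (\<kappa> *\<^sub>R x) * cnj (ft f' (\<kappa> *\<^sub>R x))) = 0"
  shows "ft f \<eta> = ft f' \<eta>"
proof -
  obtain x0 e where x0: "e > 0" "ball x0 e \<subseteq> U" using U by (metis all_not_in_conv openE)
  have line: "ft f (\<kappa> *\<^sub>R (x0 + t *\<^sub>R v)) = ft f' (\<kappa> *\<^sub>R (x0 + t *\<^sub>R v))" if v: "v \<noteq> 0" for v t
  proof -
    define L where "L = ft_line f (\<kappa> *\<^sub>R x0) (\<kappa> *\<^sub>R v)"
    define L' where "L' = ft_line f' (\<kappa> *\<^sub>R x0) (\<kappa> *\<^sub>R v)"
    have L: "L (of_real t) = ft f (\<kappa> *\<^sub>R (x0 + t *\<^sub>R v))" "L' (of_real t) = ft f' (\<kappa> *\<^sub>R (x0 + t *\<^sub>R v))" for t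
      by (simp_all add: L_def L'_def ft_line_of_real scaleR_add_right mult.commute)
    have et: "exp_type L" "exp_type L'"
      unfolding L_def L'_def using exp_type_ft_line[OF f] exp_type_ft_line[OF f'] by blast+
    \<comment> \<open>Pairing \<open>L\<close> with its reflection extends the squared norm
      analytically; at real \<open>t\<close> the product is \<open>L t * cnj (L t)\<close>.\<close>
    define E where "E = (\<lambda>t. s * (L t * cnj (L (cnj t)) + (-1) * (L' t * cnj (L' (cnj t)))))"
    \<comment> \<open>Only the part of \<open>x \<bullet> x\<close> quadratic in \<open>t\<close> is
      kept apart; the affine rest of the exponent is of exponential type and is absorbed
      here.\<close>
    define A where "A = (\<lambda>t. (c * exp (a * of_real (2 * (x0 \<bullet> v)) * t + a * of_real (x0 \<bullet> x0))) * (L t + (-1) * L' t))"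
    have "A (of_real t) = 0"
    \<comment> \<open>\<open>e / norm v\<close> bounds the parameters for which the line stays in
      the ball around \<open>x0\<close>.\<close>
    proof (rule real_interference_zero[of A E "a * of_real (v \<bullet> v)" "e / norm v"])
      show "exp_type A" unfolding A_def
        by (intro exp_type_mult exp_type_add exp_type_const exp_type_exp et)
      show "exp_type E" unfolding E_def
        by (intro exp_type_mult exp_type_add exp_type_const exp_type_cnj et)
      show "Im (a * of_real (v \<bullet> v)) > 0" using a v by simp
      show "e / norm v > 0" using x0 v by simp
      fix r :: real assume r: "\<bar>r\<bar> < e / norm v"
      define x where "x = x0 + r *\<^sub>R v"
      have "dist x0 x < e" using r v by (simp add: x_def dist_norm field_simps)
      then have "x \<in> U" using x0 by auto
      have "x \<bullet> x = (v \<bullet> v) * r\<^sup>2 + (2 * (x0 \<bullet> v) * r + x0 \<bullet> x0)"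
        by (simp add: x_def inner_add_left inner_add_right inner_commute power2_eq_square algebra_simps)
      then have "a * of_real (x \<bullet> x) = a * of_real (v \<bullet> v) * of_real (r\<^sup>2) + (a * of_real (2 * (x0 \<bullet> v)) * of_real r + a * of_real (x0 \<bullet> x0))"
        by (simp add: algebra_simps)
      then have "exp (a * of_real (v \<bullet> v) * of_real (r\<^sup>2)) * A (of_real r) =
          c * exp (a * of_real (x \<bullet> x)) * (ft f (\<kappa> *\<^sub>R x) - ft f' (\<kappa> *\<^sub>R x))"
        by (simp only: A_def L x_def[symmetric] exp_add) (simp add: algebra_simps)
      moreover have "E (of_real r) =
          s * (ft f (\<kappa> *\<^sub>R x) * cnj (ft f (\<kappa> *\<^sub>R x)) - ft f' (\<kappa> *\<^sub>R x) * cnj (ft f' (\<kappa> *\<^sub>R x)))"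
        by (simp add: E_def L x_def[symmetric])
      ultimately show "exp (a * of_real (v \<bullet> v) * of_real (r\<^sup>2)) * A (of_real r) +
          cnj (exp (a * of_real (v \<bullet> v) * of_real (r\<^sup>2)) * A (of_real r)) + E (of_real r) = 0"
        using eq[OF \<open>x \<in> U\<close>] unfolding Let_def by (simp only:)
    qed
    then show ?thesis using c by (simp add: A_def L)
  qed
  define y where "y = (1 / \<kappa>) *\<^sub>R \<eta>"
  have \<eta>: "\<eta> = \<kappa> *\<^sub>R y" using \<kappa> by (simp add: y_def)
  show ?thesis
  \<comment> \<open>Lines need a nonzero direction; for \<open>y = x0\<close> any direction will do,
    at parameter 0.\<close>
  proof (cases "y = x0")
    case True
    obtain b :: "real^'m" where "b \<in> Basis" using nonempty_Basis by blast
    then show ?thesis using line[of b 0] True \<eta> nonzero_Basis by auto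
  next
    case False
    then show ?thesis using line[of "y - x0" 1] \<eta> by simp
  qed
qed

text \<open>The Gaussian factor has no zeros and its inverse is bounded on the supports, so the
  inverse can be moved onto the test function before \<open>fourier_uniqueness\<close> is
  applied.\<close>

lemma dist_of_fun_eq_of_ft_eq:
  fixes h h' :: "real^'m::finite \<Rightarrow> complex"
  assumes h: "integrable lborel h" "\<And>x. norm x > R \<Longrightarrow> h x = 0"
    and h': "integrable lborel h'" "\<And>x. norm x > R' \<Longrightarrow> h' x = 0"
    and C: "C \<noteq> 0" and \<rho>: "Re \<rho> \<ge> 0"
    and eq: "\<And>\<eta>. ft (\<lambda>x. C * gauss \<rho> x * h x) \<eta> = ft (\<lambda>x. C * gauss \<rho> x * h' x) \<eta>"
  shows "dist_of_fun (\<lambda>x. 1 + h x) = dist_of_fun (\<lambda>x. 1 + h' x)"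
proof (rule extensionalityI)
  fix \<omega> :: "real^'m \<Rightarrow> complex" assume \<omega>: "\<omega> \<in> schwartz"
  have [measurable]: "h \<in> borel_measurable borel" "h' \<in> borel_measurable borel" "\<omega> \<in> borel_measurable borel"
    using borel_measurable_integrable[OF h(1)] borel_measurable_integrable[OF h'(1)] schwartz_measurable[OF \<omega>] by auto
  define S where "S = max \<bar>R\<bar> \<bar>R'\<bar>"
  \<comment> \<open>Inverse of the factor on the ball of radius \<open>S\<close>; \<open>min\<close>
    freezes it outside, which keeps it continuous and bounded everywhere.\<close>
  define \<theta> where "\<theta> = (\<lambda>x::real^'m. (1 / C) * exp (\<rho> * of_real (min (x \<bullet> x) (S\<^sup>2))))"
  have int: "integrable lborel (\<lambda>x. C * gauss \<rho> x * h x)" "integrable lborel (\<lambda>x. C * gauss \<rho> x * h' x)"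
  proof -
    have "norm (C * gauss \<rho> x) \<le> norm C" for x :: "real^'m"
      using norm_gauss_le_1[OF \<rho>, of x] by (simp add: norm_mult mult_left_le)
    then show "integrable lborel (\<lambda>x. C * gauss \<rho> x * h x)" "integrable lborel (\<lambda>x. C * gauss \<rho> x * h' x)"
      using integrable_bounded_mult[OF h(1), of "\<lambda>x. C * gauss \<rho> x" "norm C"]
        integrable_bounded_mult[OF h'(1), of "\<lambda>x. C * gauss \<rho> x" "norm C"] by (simp_all add: mult.commute)
  qed
  define v where "v = (\<lambda>x. C * gauss \<rho> x * h x - C * gauss \<rho> x * h' x)"
  have cont: "continuous_on UNIV \<theta>" unfolding \<theta>_def by (intro continuous_intros)
  have \<theta>b: "norm (\<theta> x) \<le> norm (1 / C) * exp (Re \<rho> * S\<^sup>2)" for x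
    using \<rho> unfolding \<theta>_def norm_mult by (intro mult_left_mono) (auto simp: mult_left_mono)
  obtain B where B: "\<And>x. norm (\<omega> x) \<le> B" using schwartz_bounded[OF \<omega>] by blast
  have "(LINT x|lborel. v x * (\<omega> x * \<theta> x)) = 0"
  proof (rule fourier_uniqueness)
    show "integrable lborel v" unfolding v_def by (intro Bochner_Integration.integrable_diff int)
    show "(LINT x|lborel. v x * wave \<eta> x) = 0" for \<eta>
      using eq[of \<eta>] integrable_mult_wave[OF int(1)] integrable_mult_wave[OF int(2)]
      by (simp add: v_def ft_def left_diff_distrib)
    show "continuous_on UNIV (\<lambda>x. \<omega> x * \<theta> x)" by (intro continuous_intros schwartz_continuous \<omega> cont)
    show "integrable lborel (\<lambda>x. \<omega> x * \<theta> x)"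
      by (intro integrable_bounded_mult[OF schwartz_integrable[OF \<omega>] _ \<theta>b])
        (use borel_measurable_continuous_onI[OF cont] in simp)
    show "norm (\<omega> x * \<theta> x) \<le> B * (norm (1 / C) * exp (Re \<rho> * S\<^sup>2))" for x
      unfolding norm_mult using order_trans[OF norm_ge_zero B] by (intro mult_mono B \<theta>b[unfolded norm_mult]) auto
  qed
  moreover have "v x * (\<omega> x * \<theta> x) = h x * \<omega> x - h' x * \<omega> x" for x
  proof (cases "norm x > S")
    case True
    then have "norm x > R" "norm x > R'" by (auto simp: S_def)
    then show ?thesis by (simp add: v_def h(2) h'(2))
  next
    case False
    then have "(norm x)\<^sup>2 \<le> S\<^sup>2" by (intro power_mono) auto
    then have "min (x \<bullet> x) (S\<^sup>2) = x \<bullet> x" by (simp add: power2_norm_eq_inner)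
    then have "C * gauss \<rho> x * \<theta> x = 1" using C by (simp add: \<theta>_def gauss_def flip: exp_add)
    moreover have "v x * (\<omega> x * \<theta> x) = (C * gauss \<rho> x * \<theta> x) * (h x * \<omega> x - h' x * \<omega> x)"
      by (simp add: v_def algebra_simps)
    ultimately show ?thesis by simp
  qed
  ultimately have "(LINT x|lborel. h x * \<omega> x) = (LINT x|lborel. h' x * \<omega> x)"
    using schwartz_integrable_mult[OF h(1) \<omega>] schwartz_integrable_mult[OF h'(1) \<omega>] by simp
  then show "dist_of_fun (\<lambda>x. 1 + h x) \<omega> = dist_of_fun (\<lambda>x. 1 + h' x) \<omega>"
    by (simp add: dist_of_fun_one_plus[OF h(1) \<omega>] dist_of_fun_one_plus[OF h'(1) \<omega>])
qed (simp_all add: dist_of_fun_def)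

theorem corollary2:
  fixes P :: "real^'m::finite \<Rightarrow> complex" and U :: "(real^'m) set" and k d L :: real
    and Ob Ob' :: "'m functional"
  assumes "k > 0" and "d > 0" and "L > 0"
    and "plane_wave P \<or> gaussian_probe k d P"
    and "open U" and "U \<noteq> {}"
    and "Ob \<in> object_transmission k L" and "Ob' \<in> object_transmission k L"
    and "(\<forall>x\<in>U. intensity k d P Ob x = intensity k d P Ob' x) \<or>
         (\<forall>x\<in>U. lin_intensity k d P Ob x = lin_intensity k d P Ob' x)"
  shows "Ob = Ob'"
proof -
  note k = assms(1,2)
  obtain h R where h: "integrable lborel h" "\<And>x. norm x > R \<Longrightarrow> h x = 0" and Ob: "Ob = dist_of_fun (\<lambda>x. 1 + h x)"
    using object_transmission_normal_form[OF assms(7)] by blast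
  obtain h' R' where h': "integrable lborel h'" "\<And>x. norm x > R' \<Longrightarrow> h' x = 0" and Ob': "Ob' = dist_of_fun (\<lambda>x. 1 + h' x)"
    using object_transmission_normal_form[OF assms(8)] by blast
  obtain C \<tau> C' \<alpha> where C: "C \<noteq> 0" and \<tau>: "Re \<tau> \<ge> 0" and P: "P = (\<lambda>x. C * gauss \<tau> x)"
    and C': "C' \<noteq> 0" and \<alpha>: "Re \<alpha> \<le> 0" "Im \<alpha> \<le> 0"
    and propagated: "\<forall>\<phi>\<in>schwartz. fresnel k d (dist_of_fun P) \<phi> =
      (LINT x|lborel. C' * gauss (- \<alpha> * of_real (k / d)) x * \<phi> x)"
    using probe_normal_form[OF k assms(4)] by blast
  define \<kappa> where "\<kappa> = k / d"
  have \<kappa>: "\<kappa> > 0" using k by (simp add: \<kappa>_def)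
  define f where "f = (\<lambda>x. chirp k d x * (P x * h x))"
  define f' where "f' = (\<lambda>x. chirp k d x * (P x * h' x))"
  define p where "p = (\<lambda>x::real^'m. C' * gauss (- \<alpha> * of_real \<kappa>) x)"
  define w where "w = fresnel_density k d (ft f)"
  define w' where "w' = fresnel_density k d (ft f')"
  note dens = density_total[OF k \<tau> P \<alpha>(1) propagated] density_scattered[OF k \<tau> P]
  have I: "intensity k d P Ob x = (norm (p x + w x))\<^sup>2" "intensity k d P Ob' x = (norm (p x + w' x))\<^sup>2" for x
    by (simp_all add: intensity_def Ob Ob' dens(1)[OF h(1)] dens(1)[OF h'(1)] p_def w_def w'_def f_def f'_def \<kappa>_def)
  have I_lin: "lin_intensity k d P Ob x = (norm (p x + w x))\<^sup>2 - (norm (w x))\<^sup>2"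
    "lin_intensity k d P Ob' x = (norm (p x + w' x))\<^sup>2 - (norm (w' x))\<^sup>2" for x
    by (simp_all add: lin_intensity_def I)
      (simp_all add: Ob Ob' dens(2)[OF h(1)] dens(2)[OF h'(1)] w_def w'_def f_def f'_def)
  define N where "N = of_real ((2 * pi) powr (- real CARD('m) / 2)) * fresnel_const k d TYPE('m)"
  have N: "N \<noteq> 0" using k by (simp add: N_def fresnel_const_nonzero)
  have w: "w x = N * chirp k d x * ft f (\<kappa> *\<^sub>R x)" "w' x = N * chirp k d x * ft f' (\<kappa> *\<^sub>R x)" for x
    by (simp_all add: w_def w'_def fresnel_density_def N_def \<kappa>_def mult.assoc)
  \<comment> \<open>The square of the probe field is common to both objects and drops out. Leaving
    \<open>s\<close> open lets the two kinds of data continue in one argument.\<close>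
  obtain s where s: "\<And>x. x \<in> U \<Longrightarrow>
      (cnj (p x) * (w x - w' x) + cnj (cnj (p x) * (w x - w' x))) + s * (w x * cnj (w x) - w' x * cnj (w' x)) = 0"
  proof -
    have ident: "complex_of_real ((norm (p x + y))\<^sup>2) = p x * cnj (p x) + (cnj (p x) * y + cnj (cnj (p x) * y)) + y * cnj y" for x y
      unfolding complex_norm_square by (simp add: algebra_simps)
    from assms(9) show thesis
    proof
      assume "\<forall>x\<in>U. intensity k d P Ob x = intensity k d P Ob' x"
      then have "complex_of_real ((norm (p x + w x))\<^sup>2) = of_real ((norm (p x + w' x))\<^sup>2)" if "x \<in> U" for x
        using that unfolding I by simp
      then have "(cnj (p x) * (w x - w' x) + cnj (cnj (p x) * (w x - w' x))) + 1 * (w x * cnj (w x) - w' x * cnj (w' x)) = 0" if "x \<in> U" for x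
        using that unfolding ident by (simp add: algebra_simps)
      then show thesis by (rule that)
    next
      assume "\<forall>x\<in>U. lin_intensity k d P Ob x = lin_intensity k d P Ob' x"
      then have "complex_of_real ((norm (p x + w x))\<^sup>2) - of_real ((norm (w x))\<^sup>2) =
          of_real ((norm (p x + w' x))\<^sup>2) - of_real ((norm (w' x))\<^sup>2)" if "x \<in> U" for x
        using that unfolding I_lin of_real_diff[symmetric] by simp
      then have "(cnj (p x) * (w x - w' x) + cnj (cnj (p x) * (w x - w' x))) + 0 * (w x * cnj (w x) - w' x * cnj (w' x)) = 0" if "x \<in> U" for x
        using that unfolding ident complex_norm_square by (simp add: algebra_simps)
      then show thesis by (rule that)
    qed
  qed
  define a where "a = cnj \<alpha> * of_real \<kappa> + \<i> * of_real \<kappa> / 2"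
  have a: "Im a > 0"
  proof -
    \<comment> \<open>The chirp of the scattered field contributes 1/2;
      \<open>Im \<alpha> \<le> 0\<close>, that is, a beam that does not converge, can only increase
      it.\<close>
    have "Im a = \<kappa> * (1 / 2 - Im \<alpha>)" by (simp add: a_def algebra_simps)
    then show ?thesis using \<kappa> \<alpha>(2) by simp
  qed
  \<comment> \<open>The inner chirp is merged with the probe; its exponent is imaginary, so
    boundedness is preserved.\<close>
  define \<rho> where "\<rho> = \<tau> - \<i> * of_real \<kappa> / 2"
  have \<rho>: "Re \<rho> \<ge> 0" using \<tau> by (simp add: \<rho>_def)
  have f_eq: "f = (\<lambda>x. C * gauss \<rho> x * h x)" "f' = (\<lambda>x. C * gauss \<rho> x * h' x)"
  proof -
    have "chirp k d x * (C * gauss \<tau> x) = C * gauss \<rho> x" for x :: "real^'m"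
      using gauss_add[of "- \<i> * of_real (k / d) / 2" x \<tau>]
      by (simp add: chirp_eq_gauss \<rho>_def \<kappa>_def mult.left_commute del: of_real_divide)
    then have "chirp k d x * (P x * y) = C * gauss \<rho> x * y" for x y
      unfolding P by (metis mult.assoc)
    then show "f = (\<lambda>x. C * gauss \<rho> x * h x)" "f' = (\<lambda>x. C * gauss \<rho> x * h' x)"
      by (simp_all only: f_def f'_def)
  qed
  have "ft f \<eta> = ft f' \<eta>" for \<eta>
  \<comment> \<open>The identity is now expressed through \<open>ft f\<close> in place of
    \<open>w\<close>: the propagation constant \<open>N\<close> enters the interference once and the
    self-interference as \<open>N * cnj N\<close>.\<close>
  proof (rule interference_identity_unique[where a = a and c = "cnj C' * N" and \<kappa> = \<kappa> and U = U and s = "s * (N * cnj N)"])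
    show "integrable lborel f" "integrable lborel f'"
      unfolding f_def f'_def
      by (intro integrable_chirp_mult probe_mult_integrable[OF \<tau> P] h(1) h'(1))+
    show "f x = 0" if "norm x > R" for x using h(2)[OF that] by (simp add: f_def)
    show "f' x = 0" if "norm x > R'" for x using h'(2)[OF that] by (simp add: f'_def)
    show "cnj C' * N \<noteq> 0" using C' N by simp
    fix x assume x: "x \<in> U"
    have p_chirp: "cnj (p x) * chirp k d x = cnj C' * exp (a * of_real (x \<bullet> x))"
      by (simp add: p_def chirp_eq_gauss gauss_def exp_cnj a_def \<kappa>_def algebra_simps flip: exp_add)
    have "cnj (p x) * (w x - w' x) = (cnj (p x) * chirp k d x) * (N * (ft f (\<kappa> *\<^sub>R x) - ft f' (\<kappa> *\<^sub>R x)))"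
      by (simp add: w algebra_simps)
    then have z: "cnj (p x) * (w x - w' x) = cnj C' * N * exp (a * of_real (x \<bullet> x)) * (ft f (\<kappa> *\<^sub>R x) - ft f' (\<kappa> *\<^sub>R x))"
      unfolding p_chirp by (simp only: mult_ac)
    \<comment> \<open>The outer chirp cancels in the self-interference, which leaves only products
      of the transforms there.\<close>
    have unit: "chirp k d x * cnj (chirp k d x) = 1"
      unfolding complex_norm_square[symmetric] by simp
    have "w x * cnj (w x) = (chirp k d x * cnj (chirp k d x)) * ((N * cnj N) * (ft f (\<kappa> *\<^sub>R x) * cnj (ft f (\<kappa> *\<^sub>R x))))"
      "w' x * cnj (w' x) = (chirp k d x * cnj (chirp k d x)) * ((N * cnj N) * (ft f' (\<kappa> *\<^sub>R x) * cnj (ft f' (\<kappa> *\<^sub>R x))))"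
      unfolding w complex_cnj_mult by (simp_all only: mult_ac)
    then have ww: "w x * cnj (w x) = (N * cnj N) * (ft f (\<kappa> *\<^sub>R x) * cnj (ft f (\<kappa> *\<^sub>R x)))"
      "w' x * cnj (w' x) = (N * cnj N) * (ft f' (\<kappa> *\<^sub>R x) * cnj (ft f' (\<kappa> *\<^sub>R x)))"
      unfolding unit by simp_all
    show "(let z = cnj C' * N * exp (a * of_real (x \<bullet> x)) * (ft f (\<kappa> *\<^sub>R x) - ft f' (\<kappa> *\<^sub>R x)) in z + cnj z) +
      s * (N * cnj N) * (ft f (\<kappa> *\<^sub>R x) * cnj (ft f (\<kappa> *\<^sub>R x)) - ft f' (\<kappa> *\<^sub>R x) * cnj (ft f' (\<kappa> *\<^sub>R x))) = 0"
      using s[OF x] unfolding Let_def z ww by (simp only: mult.assoc right_diff_distrib)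
  qed (use a \<kappa> assms in auto)
  then have eq: "ft (\<lambda>x. C * gauss \<rho> x * h x) \<eta> = ft (\<lambda>x. C * gauss \<rho> x * h' x) \<eta>" for \<eta>
    unfolding f_eq .
  show ?thesis
    unfolding Ob Ob' by (rule dist_of_fun_eq_of_ft_eq[OF h(1) _ h'(1) _ C \<rho> eq]) (auto intro: h(2) h'(2))
qed

end
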